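(* Let $\{X_{t,T}\}_{t=1}^{T}$, $T\ge1$, be a locally stationary functional time series in $L^4_H$: for every $u\in[0,1]$ there is an associated process $\{X_t^{(u)}\}_{t\in\mathbb Z}$ in $L^4_H$ as in the definition of local stationarity with $p=4$ and $\rho=4$. Assume moreover that $\{X_t^{(u)}\}$ is $L^4$-$m$-approximable, with approximations $X_{m,t}^{(u)}$, that $E[X_t^{(u)}]=0$ in $L^2$, and that $\lim_{m\to\infty}m\,v_2(X_0^{(u)}-X_{m,0}^{(u)})=0$. Let $K_1:\mathbb R\to\mathbb R$ be symmetric around zero, bounded, Lipschitz continuous, with compact support and $\int K_1(z)\,dz=1$. Let $K_2:\mathbb R\to\mathbb R$ be bounded, with compact support, and $K_2(0)=1$. Let $h=h_T>0$ with $h\to0$ and $b=b_T>0$ satisfy $\min\{Th,\frac1{Th^3},b,\frac{Th}b\}\to\infty$ as $T\to\infty$. Put $K_{1,h}(x)=K_1(x/h)$, $\bar X_T^{(u)}=\frac1{Th}\sum_{t=1}^TK_{1,h}(u-\frac tT)X_{t,T}$, for $0\le t\le T-1$ $$\hat\gamma_t^{(u)}(s_1,s_2)=\frac1{Th}\sum_{j=t+1}^{T}K_{1,h}\Big(u-\frac jT\Big)\big(X_{j,T}(s_1)-\bar X_T^{(u)}(s_1)\big)\big(X_{j-t,T}(s_2)-\bar X_T^{(u)}(s_2)\big),$$ and $$\hat c^{(u)}(s_1,s_2)=\hat\gamma_0^{(u)}(s_1,s_2)+\sum_{t=1}^{T-1}K_2\Big(\frac tb\Big)\big\{\hat\gamma_t^{(u)}(s_1,s_2)+\hat\gamma_t^{(u)}(s_2,s_1)\big\}.$$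 Then for each $u\in(0,1)$, $$\int_{[0,1]^d}\int_{[0,1]^d}\big\{\hat c^{(u)}(s_1,s_2)-c^{(u)}(s_1,s_2)\big\}^2ds_1ds_2\stackrel p\to0\quad\text{as }T\to\infty,$$ where $$c^{(u)}(s_1,s_2)=E[X_0^{(u)}(s_1)X_0^{(u)}(s_2)]+\sum_{t\ge1}E[X_0^{(u)}(s_1)X_t^{(u)}(s_2)]+\sum_{t\ge1}E[X_0^{(u)}(s_2)X_t^{(u)}(s_1)].$$
   Context: $H=L^2=L^2([0,1]^d)$ is the real Hilbert space with $\langle x,y\rangle=\int_{[0,1]^d}x(t)y(t)\,dt$ and norm $\|\cdot\|$. $L^p_H$ is the space of $H$-valued random functions $X$ on a probability space with $v_p(X)=(E\|X\|^p)^{1/p}<\infty$. $\stackrel p\to$ denotes convergence in probability. The infinite sums defining $c^{(u)}$ are understood in $L^2([0,1]^d\times[0,1]^d)$. Local stationarity. $\{X_{t,T}\}_{t=1}^T$ in $L^p_H$ is locally stationary if for each $u\in[0,1]$ there is an $H$-valued process $\{X_t^{(u)}\}_{t\in\mathbb Z}$ in $L^p_H$ such that (i) $\{X_t^{(u)}\}_t$ is strictly stationary; (ii) for all $1\le t\le T$, almost surely $$\|X_{t,T}-X_t^{(u)}\|\le\Big(\Big|\frac tT-u\Big|+\frac1T\Big)U_{t,T}^{(u)},$$ where $U_{t,T}^{(u)}$ are positive random variables with $E[(U_{t,T}^{(u)})^\rho]<C$ for some $\rho>0$ and $C<\infty$ independent of $u,t,T$. $L^p$-$m$-approximability. $\{X_t^{(u)}\}$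 is $L^p$-$m$-approximable if $X_t^{(u)}\in L^p_H$ has the form $X_t^{(u)}=f_u(\varepsilon_t,\varepsilon_{t-1},\dots)$ with $\varepsilon_j$ i.i.d. elements of a measurable space $S$ and $f_u:S^\infty\to H$ measurable, and, with $\{\varepsilon_{t,k}^{(m)}\}_k$ (for each $t$ and $m$) independent copies of $\{\varepsilon_k\}_k$ defined on the same probability space and $$X_{m,t}^{(u)}=f_u(\varepsilon_t,\dots,\varepsilon_{t-m+1},\varepsilon_{t,t-m}^{(m)},\varepsilon_{t,t-m-1}^{(m)},\dots),$$ one has $\sum_{m\ge1}v_p(X_t^{(u)}-X_{m,t}^{(u)})<\infty$.
   Formalization: K_2 is additionally assumed right-continuous at 0 (K_2(x)→K_2(0)=1 as x→0+); without this the claim fails, e.g. for K_2 the indicator of {0} and X_t=(ε_t+ε_{t-1})e, where ĉ→2 but c=4. *)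

theory Defs
  imports "HOL-Probability.Probability"
begin

section \<open>The Hilbert space \<open>L\<^sup>2([0,1]\<^sup>d)\<close>\<close>

text \<open>
  Lebesgue measure on the unit cube of a Euclidean space. For the type \<open>real ^ 'd\<close> this is
  \<open>[0,1]\<^sup>d\<close>; for \<open>(real ^ 'd) \<times> (real ^ 'd)\<close>, which is again a Euclidean space, it is
  \<open>[0,1]\<^sup>d \<times> [0,1]\<^sup>d\<close> (see \<open>cube_prod\<close>).
\<close>

definition cube :: "'a::euclidean_space measure" where
  "cube = restrict_space lborel (cbox 0 One)"

lemma space_cube: "space cube = cbox 0 One"
  by (simp add: cube_def space_restrict_space)

lemma emeasure_cube_space: "emeasure (cube :: 'a::euclidean_space measure) (space cube) = 1"
  by (simp add: space_cube) (simp add: cube_def emeasure_restrict_space emeasure_lborel_cbox_eq)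

interpretation cube: prob_space "cube :: 'a::euclidean_space measure"
  by standard (rule emeasure_cube_space)

definition sq_integrable :: "('a::euclidean_space \<Rightarrow> real) \<Rightarrow> bool" where
  "sq_integrable f \<longleftrightarrow> f \<in> borel_measurable cube \<and> integrable cube (\<lambda>s. (f s)\<^sup>2)"

lemma sq_integrable_measurable[measurable_dest]: "sq_integrable f \<Longrightarrow> f \<in> borel_measurable cube"
  by (simp add: sq_integrable_def)

lemma sq_integrable_mult:
  assumes "sq_integrable f" "sq_integrable g"
  shows "integrable cube (\<lambda>s. f s * g s)"
proof (rule Bochner_Integration.integrable_bound[where f="\<lambda>s. (f s)\<^sup>2 + (g s)\<^sup>2"])
  show "integrable cube (\<lambda>s. (f s)\<^sup>2 + (g s)\<^sup>2)"
    using assms by (auto simp: sq_integrable_def)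
  show "(\<lambda>s. f s * g s) \<in> borel_measurable cube"
    using assms by (auto simp: sq_integrable_def)
  have "\<bar>a * b\<bar> \<le> a\<^sup>2 + b\<^sup>2" for a b :: real
  proof -
    have "2 * \<bar>a * b\<bar> \<le> a\<^sup>2 + b\<^sup>2"
      using sum_squares_bound[of "\<bar>a\<bar>" "\<bar>b\<bar>"] by (simp add: abs_mult)
    then show ?thesis by simp
  qed
  then show "AE s in cube. norm (f s * g s) \<le> norm ((f s)\<^sup>2 + (g s)\<^sup>2)"
    by auto
qed

lemma sq_integrable_0: "sq_integrable (\<lambda>_. 0)"
  by (simp add: sq_integrable_def)

lemma sq_integrable_add:
  assumes "sq_integrable f" "sq_integrable g"
  shows "sq_integrable (\<lambda>s. f s + g s)"
  using assms sq_integrable_mult[OF assms]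
  by (auto simp: sq_integrable_def power2_sum mult.assoc)

lemma sq_integrable_scale:
  assumes "sq_integrable f"
  shows "sq_integrable (\<lambda>s. c * f s)"
  using assms by (auto simp: sq_integrable_def power_mult_distrib)

lemma sq_integrable_uminus: "sq_integrable f \<Longrightarrow> sq_integrable (\<lambda>s. - f s)"
  by (auto simp: sq_integrable_def)

lemma sq_integrable_diff:
  "sq_integrable f \<Longrightarrow> sq_integrable g \<Longrightarrow> sq_integrable (\<lambda>s. f s - g s)"
  using sq_integrable_add[OF _ sq_integrable_uminus, of f g] by simp

lemma sq_integrable_bound:
  assumes "sq_integrable f" "g \<in> borel_measurable cube" "AE s in cube. \<bar>g s\<bar> \<le> \<bar>f s\<bar>"
  shows "sq_integrable g"
  unfolding sq_integrable_def
proof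
  show "integrable cube (\<lambda>s. (g s)\<^sup>2)"
    by (rule Bochner_Integration.integrable_bound[where f="\<lambda>s. (f s)\<^sup>2"])
       (use assms in \<open>auto simp: sq_integrable_def abs_le_square_iff\<close>)
qed fact

lemma AE_eq_combine:
  assumes "AE s in M. f s = g s" "AE s in M. f' s = g' s"
  shows "AE s in M. h (f s) (f' s) = h (g s) (g' s)"
  using assms by eventually_elim simp

text \<open>
  Square integrable functions modulo equality almost everywhere. Borel measurable representatives
  are no restriction, as every Lebesgue measurable function agrees a.e. with a Borel measurable one.
  The norm is the usual one: see \<open>norm_abs_L2\<close>.
\<close>

quotient_type (overloaded) 'a L2 = "'a::euclidean_space \<Rightarrow> real" / partial:
  "\<lambda>f g. sq_integrable f \<and> sq_integrable g \<and> (AE s in cube. f s = g s)"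
proof (rule part_equivpI)
  show "\<exists>f :: 'a \<Rightarrow> real. sq_integrable f \<and> sq_integrable f \<and> (AE s in cube. f s = f s)"
    using sq_integrable_0 by blast
  show "symp (\<lambda>f g :: 'a \<Rightarrow> real. sq_integrable f \<and> sq_integrable g \<and> (AE s in cube. f s = g s))"
    by (rule sympI) (auto simp: eq_commute)
  show "transp (\<lambda>f g :: 'a \<Rightarrow> real. sq_integrable f \<and> sq_integrable g \<and> (AE s in cube. f s = g s))"
  proof (rule transpI, intro conjI; (elim conjE)?)
    fix f g h :: "'a \<Rightarrow> real"
    assume "AE s in cube. f s = g s" "AE s in cube. g s = h s"
    then show "AE s in cube. f s = h s" by eventually_elim simp
  qed auto
qed

instantiation L2 :: (euclidean_space) real_vector
begin

lift_definition zero_L2 :: "'a L2" is "\<lambda>_. 0"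
  by (simp add: sq_integrable_0)

lift_definition plus_L2 :: "'a L2 \<Rightarrow> 'a L2 \<Rightarrow> 'a L2" is "\<lambda>f g s. f s + g s"
  by (auto intro: sq_integrable_add AE_eq_combine[where h="(+)"])

lift_definition uminus_L2 :: "'a L2 \<Rightarrow> 'a L2" is "\<lambda>f s. - f s"
  by (auto simp: sq_integrable_uminus)

lift_definition minus_L2 :: "'a L2 \<Rightarrow> 'a L2 \<Rightarrow> 'a L2" is "\<lambda>f g s. f s - g s"
  by (auto intro: sq_integrable_diff AE_eq_combine[where h="(-)"])

lift_definition scaleR_L2 :: "real \<Rightarrow> 'a L2 \<Rightarrow> 'a L2" is "\<lambda>c f s. c * f s"
  by (auto intro: sq_integrable_scale AE_eq_combine[where h="\<lambda>a b. _ * a"])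

instance
proof
  fix x y z :: "'a L2" and a b :: real
  show "x + y + z = x + (y + z)"
    by transfer (auto simp: add.assoc intro!: sq_integrable_add)
  show "x + y = y + x"
    by transfer (auto simp: add.commute intro!: sq_integrable_add)
  show "0 + x = x" by transfer auto
  show "- x + x = 0" by transfer (auto simp: sq_integrable_0)
  show "x - y = x + - y"
    by transfer (auto intro!: sq_integrable_diff sq_integrable_add sq_integrable_uminus)
  show "a *\<^sub>R (x + y) = a *\<^sub>R x + a *\<^sub>R y"
    by transfer (auto simp: distrib_left intro!: sq_integrable_add sq_integrable_scale)
  show "(a + b) *\<^sub>R x = a *\<^sub>R x + b *\<^sub>R x"
    by transfer (auto simp: distrib_right intro!: sq_integrable_add sq_integrable_scale)
  show "a *\<^sub>R b *\<^sub>R x = (a * b) *\<^sub>R x"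
    by transfer (auto simp: mult.assoc intro!: sq_integrable_scale)
  show "1 *\<^sub>R x = x" by transfer auto
qed

end

instantiation L2 :: (euclidean_space) real_inner
begin

lift_definition inner_L2 :: "'a L2 \<Rightarrow> 'a L2 \<Rightarrow> real" is "\<lambda>f g. \<integral>s. f s * g s \<partial>cube"
  by (intro integral_cong_AE) (auto simp: sq_integrable_def intro: AE_eq_combine[where h="(*)"])

definition norm_L2 :: "'a L2 \<Rightarrow> real" where
  "norm_L2 x = sqrt (x \<bullet> x)"

definition sgn_L2 :: "'a L2 \<Rightarrow> 'a L2" where
  "sgn_L2 x = x /\<^sub>R norm x"

definition dist_L2 :: "'a L2 \<Rightarrow> 'a L2 \<Rightarrow> real" where
  "dist_L2 x y = norm (x - y)"

definition uniformity_L2 :: "('a L2 \<times> 'a L2) filter" where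
  "uniformity_L2 = (INF e\<in>{0<..}. principal {(x, y). dist x y < e})"

definition open_L2 :: "'a L2 set \<Rightarrow> bool" where
  "open_L2 U \<longleftrightarrow> (\<forall>x\<in>U. eventually (\<lambda>(x', y). x' = x \<longrightarrow> y \<in> U) uniformity)"

instance
proof
  fix x y z :: "'a L2" and a :: real
  show "dist x y = norm (x - y)" by (simp add: dist_L2_def)
  show "sgn x = x /\<^sub>R norm x" by (simp add: sgn_L2_def)
  show "uniformity = (INF e\<in>{0<..}. principal {(x :: 'a L2, y). dist x y < e})"
    by (simp add: uniformity_L2_def)
  show "open U \<longleftrightarrow> (\<forall>x\<in>U. eventually (\<lambda>(x', y). x' = x \<longrightarrow> y \<in> U) uniformity)"
    for U :: "'a L2 set" by (simp add: open_L2_def)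
  show "norm x = sqrt (x \<bullet> x)" by (simp add: norm_L2_def)
  show "x \<bullet> y = y \<bullet> x" by transfer (simp add: mult.commute)
  show "(x + y) \<bullet> z = x \<bullet> z + y \<bullet> z"
    by transfer (simp add: sq_integrable_mult distrib_right)
  show "a *\<^sub>R x \<bullet> y = a * (x \<bullet> y)"
    by transfer (simp add: mult.assoc)
  show "0 \<le> x \<bullet> x" by transfer simp
  show "x \<bullet> x = 0 \<longleftrightarrow> x = 0"
  proof transfer
    fix f :: "'a \<Rightarrow> real"
    assume *: "sq_integrable f \<and> sq_integrable f \<and> (AE s in cube. f s = f s)"
    have "(\<integral>s. f s * f s \<partial>cube) = 0 \<longleftrightarrow> (AE s in cube. f s * f s = 0)"
      by (rule integral_nonneg_eq_0_iff_AE) (use * in \<open>auto intro: sq_integrable_mult\<close>)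
    then show "((\<integral>s. f s * f s \<partial>cube) = 0) =
        (sq_integrable f \<and> sq_integrable (\<lambda>_::'a. 0 :: real) \<and> (AE s in cube. f s = 0))"
      using * by (simp add: sq_integrable_0)
  qed
qed

end

lemma norm_abs_L2:
  assumes "sq_integrable f"
  shows "(norm (abs_L2 f))\<^sup>2 = (\<integral>s. (f s)\<^sup>2 \<partial>cube)"
proof -
  have "abs_L2 f \<bullet> abs_L2 f = (\<integral>s. f s * f s \<partial>cube)"
    using assms by (simp add: inner_L2.abs_eq)
  then show ?thesis by (simp add: power2_norm_eq_inner flip: power2_eq_square)
qed

lemma norm_abs_L2_le:
  assumes "sq_integrable f" "(\<integral>\<^sup>+s. ennreal ((f s)\<^sup>2) \<partial>cube) \<le> ennreal (e\<^sup>2)" "0 \<le> e"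
  shows "norm (abs_L2 f) \<le> e"
proof -
  have "ennreal (\<integral>s. (f s)\<^sup>2 \<partial>cube) = (\<integral>\<^sup>+s. ennreal ((f s)\<^sup>2) \<partial>cube)"
    using assms(1) by (subst nn_integral_eq_integral) (auto simp: sq_integrable_def)
  with assms(2) have "ennreal ((norm (abs_L2 f))\<^sup>2) \<le> ennreal (e\<^sup>2)"
    using assms(1) by (simp add: norm_abs_L2)
  then have "(norm (abs_L2 f))\<^sup>2 \<le> e\<^sup>2"
    by (simp add: ennreal_le_iff)
  then show ?thesis
    using assms(3) by (rule power2_le_imp_le)
qed

lemma nn_integral_norm_abs_L2:
  assumes "sq_integrable f"
  shows "(\<integral>\<^sup>+s. ennreal ((f s)\<^sup>2) \<partial>cube) = ennreal ((norm (abs_L2 f))\<^sup>2)"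
  using assms by (subst nn_integral_eq_integral) (auto simp: sq_integrable_def norm_abs_L2)

lemma abs_L2_diff:
  assumes "sq_integrable f" "sq_integrable g"
  shows "abs_L2 (\<lambda>s. f s - g s) = abs_L2 f - abs_L2 g"
  using assms by (simp add: minus_L2.abs_eq)

lemma sq_integrable_rep_L2: "sq_integrable (rep_L2 x)"
  using Quotient3_rep_reflp[OF Quotient3_L2, of x] by simp

lemma abs_rep_L2: "abs_L2 (rep_L2 x) = x"
  by (rule Quotient3_abs_rep[OF Quotient3_L2])

lemma L2_fast_Cauchy_convergent:
  fixes X :: "nat \<Rightarrow> 'a::euclidean_space L2"
  assumes fast: "\<And>n m. n \<le> m \<Longrightarrow> norm (X m - X n) \<le> (1/2) ^ n"
  shows "\<exists>x. X \<longlonglongrightarrow> x"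
proof -
  define f where "f n = rep_L2 (X n)" for n
  have f: "sq_integrable (f n)" and X: "abs_L2 (f n) = X n" for n
    by (simp_all add: f_def sq_integrable_rep_L2 abs_rep_L2)
  have [measurable]: "f n \<in> borel_measurable cube" for n
    using f by (rule sq_integrable_measurable)
  have d2: "(\<integral>\<^sup>+s. ennreal ((f m s - f n s)\<^sup>2) \<partial>cube) \<le> ennreal (((1/2) ^ n)\<^sup>2)"
    if "n \<le> m" for n m
    unfolding nn_integral_norm_abs_L2[OF sq_integrable_diff[OF f f]] abs_L2_diff[OF f f] X
    using fast[OF that] by (intro ennreal_leI power_mono) auto
  have d1: "(\<integral>\<^sup>+s. ennreal \<bar>f (Suc n) s - f n s\<bar> \<partial>cube) \<le> ennreal ((1/2) ^ n)" for n
  proof -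
    have amgm: "\<bar>t\<bar> \<le> (1/2) ^ n / 2 + 2 ^ n * t\<^sup>2 / 2" for t :: real
    proof -
      have "0 \<le> (1/2) ^ n / 2 * (2 ^ n * \<bar>t\<bar> - 1)\<^sup>2" by simp
      also have "\<dots> = ((1/2) ^ n / 2 + 2 ^ n * t\<^sup>2 / 2) - \<bar>t\<bar>"
        by (simp add: power2_eq_square field_simps)
      finally show ?thesis by simp
    qed
    have "(\<integral>\<^sup>+s. ennreal \<bar>f (Suc n) s - f n s\<bar> \<partial>cube)
        \<le> (\<integral>\<^sup>+s. ennreal ((1/2) ^ n / 2) + ennreal (2 ^ n / 2) * ennreal ((f (Suc n) s - f n s)\<^sup>2) \<partial>cube)"
      by (intro nn_integral_mono) (simp add: amgm flip: ennreal_mult ennreal_plus)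
    also have "\<dots> = ennreal ((1/2) ^ n / 2)
        + ennreal (2 ^ n / 2) * (\<integral>\<^sup>+s. ennreal ((f (Suc n) s - f n s)\<^sup>2) \<partial>cube)"
      by (subst nn_integral_add) (auto simp: nn_integral_cmult cube.emeasure_space_1)
    also have "\<dots> \<le> ennreal ((1/2) ^ n / 2) + ennreal (2 ^ n / 2) * ennreal (((1/2) ^ n)\<^sup>2)"
      by (intro add_left_mono mult_left_mono d2) auto
    also have "\<dots> = ennreal ((1/2) ^ n)"
      by (simp add: power2_eq_square field_simps flip: ennreal_mult ennreal_plus)
    finally show ?thesis .
  qed
  have "(\<integral>\<^sup>+s. (\<Sum>n. ennreal \<bar>f (Suc n) s - f n s\<bar>) \<partial>cube)
      = (\<Sum>n. \<integral>\<^sup>+s. ennreal \<bar>f (Suc n) s - f n s\<bar> \<partial>cube)"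
    by (rule nn_integral_suminf) measurable
  also have "\<dots> \<le> (\<Sum>n. ennreal ((1/2) ^ n))"
    by (intro suminf_le d1) auto
  also have "\<dots> = ennreal (\<Sum>n. (1/2) ^ n)"
    by (rule suminf_ennreal2) (auto intro: summable_geometric)
  finally have "(\<integral>\<^sup>+s. (\<Sum>n. ennreal \<bar>f (Suc n) s - f n s\<bar>) \<partial>cube) \<noteq> \<infinity>"
    by (metis ennreal_neq_top infinity_ennreal_def neq_top_trans)
  then have "AE s in cube. (\<Sum>n. ennreal \<bar>f (Suc n) s - f n s\<bar>) \<noteq> \<infinity>"
    by (intro nn_integral_PInf_AE) auto
  then have conv: "AE s in cube. convergent (\<lambda>n. f n s)"
  proof eventually_elim
    case (elim s)
    then have "summable (\<lambda>n. \<bar>f (Suc n) s - f n s\<bar>)"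
      by (intro summable_suminf_not_top) auto
    then have "summable (\<lambda>n. f (Suc n) s - f n s)"
      by (rule summable_rabs_cancel)
    then have "convergent (\<lambda>n. \<Sum>k<n. f (Suc k) s - f k s)"
      by (simp add: summable_iff_convergent)
    then have "convergent (\<lambda>n. f n s - f 0 s)"
      by (subst (asm) sum_lessThan_telescope)
    then have "convergent (\<lambda>n. (f n s - f 0 s) + f 0 s)"
      by (intro convergent_add convergent_const)
    then show ?case by simp
  qed
  define g where "g s = lim (\<lambda>n. f n s)" for s
  have g[measurable]: "g \<in> borel_measurable cube"
    unfolding g_def by measurable
  have bound: "(\<integral>\<^sup>+s. ennreal ((g s - f n s)\<^sup>2) \<partial>cube) \<le> ennreal (((1/2) ^ n)\<^sup>2)" for n
  proof -
    have "AE s in cube. ennreal ((g s - f n s)\<^sup>2) = liminf (\<lambda>m. ennreal ((f m s - f n s)\<^sup>2))"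
      using conv
    proof eventually_elim
      case (elim s)
      then have "(\<lambda>m. f m s) \<longlonglongrightarrow> g s"
        by (simp add: g_def convergent_LIMSEQ_iff)
      then have "(\<lambda>m. ennreal ((f m s - f n s)\<^sup>2)) \<longlonglongrightarrow> ennreal ((g s - f n s)\<^sup>2)"
        by (intro tendsto_intros) auto
      then show ?case by (rule lim_imp_Liminf[OF sequentially_bot, symmetric])
    qed
    then have "(\<integral>\<^sup>+s. ennreal ((g s - f n s)\<^sup>2) \<partial>cube)
        = (\<integral>\<^sup>+s. liminf (\<lambda>m. ennreal ((f m s - f n s)\<^sup>2)) \<partial>cube)"
      by (rule nn_integral_cong_AE)
    also have "\<dots> \<le> liminf (\<lambda>m. \<integral>\<^sup>+s. ennreal ((f m s - f n s)\<^sup>2) \<partial>cube)"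
      by (rule nn_integral_liminf) measurable
    also have "\<dots> \<le> ennreal (((1/2) ^ n)\<^sup>2)"
    proof (rule Liminf_le[OF sequentially_bot])
      show "\<forall>\<^sub>F m in sequentially. (\<integral>\<^sup>+s. ennreal ((f m s - f n s)\<^sup>2) \<partial>cube) \<le> ennreal (((1/2) ^ n)\<^sup>2)"
        using eventually_ge_at_top[of n] by eventually_elim (rule d2)
    qed
    finally show ?thesis .
  qed
  have gf: "sq_integrable (\<lambda>s. g s - f n s)" for n
    unfolding sq_integrable_def
  proof
    show "integrable cube (\<lambda>s. (g s - f n s)\<^sup>2)"
      using bound[of n] by (intro integrableI_bounded) (auto intro: le_less_trans)
  qed simp
  have "sq_integrable g"
    using sq_integrable_add[OF gf f, of 0 0] by simp
  then have "norm (abs_L2 g - X n) \<le> (1/2) ^ n" for n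
    using norm_abs_L2_le[OF gf bound, of n] by (simp add: abs_L2_diff f X)
  then have "(\<lambda>n. X n - abs_L2 g) \<longlonglongrightarrow> 0"
    by (intro tendsto_0_le[where K=1, OF LIMSEQ_power_zero[of "1/2 :: real"]])
       (auto simp: norm_minus_commute)
  then have "X \<longlonglongrightarrow> abs_L2 g"
    by (simp add: LIM_zero_iff)
  then show ?thesis ..
qed

instance L2 :: (euclidean_space) banach
proof
  fix X :: "nat \<Rightarrow> 'a L2"
  assume X: "Cauchy X"
  have "\<exists>N. \<forall>m\<ge>N. \<forall>n\<ge>N. norm (X m - X n) < (1/2) ^ k" for k
    using X by (simp add: Cauchy_def dist_norm)
  then have "\<exists>N. \<forall>k. \<forall>m\<ge>N k. \<forall>n\<ge>N k. norm (X m - X n) < (1/2) ^ k"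
    by (intro choice allI)
  then obtain N where N: "\<And>k m n. N k \<le> m \<Longrightarrow> N k \<le> n \<Longrightarrow> norm (X m - X n) < (1/2) ^ k"
    by blast
  define r where "r k = (\<Sum>i\<le>k. N i) + k" for k
  have r: "strict_mono r"
    by (intro strict_monoI_Suc) (simp add: r_def)
  have rN: "N k \<le> r l" if "k \<le> l" for k l
  proof -
    have "N k \<le> (\<Sum>i\<le>l. N i)" using that by (intro member_le_sum) auto
    then show ?thesis by (simp add: r_def)
  qed
  have "\<exists>x. (X \<circ> r) \<longlonglongrightarrow> x"
  proof (rule L2_fast_Cauchy_convergent)
    fix n m :: nat assume "n \<le> m"
    then show "norm ((X \<circ> r) m - (X \<circ> r) n) \<le> (1/2) ^ n"
      using N[OF rN[of n m] rN[of n n]] by simp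
  qed
  then obtain x where "(X \<circ> r) \<longlonglongrightarrow> x" ..
  then have "X \<longlonglongrightarrow> x"
    using Cauchy_converges_subseq[OF X r] by blast
  then show "convergent X"
    by (rule convergentI)
qed

lemma abs_L2_eqI:
  assumes "sq_integrable f" "sq_integrable g" "AE s in cube. f s = g s"
  shows "abs_L2 f = abs_L2 g"
  using assms Quotient3_rel_abs[OF Quotient3_L2, of f g] by blast

lemma abs_L2_add:
  assumes "sq_integrable f" "sq_integrable g"
  shows "abs_L2 (\<lambda>s. f s + g s) = abs_L2 f + abs_L2 g"
  using assms by (simp add: plus_L2.abs_eq)

lemma abs_L2_scale:
  assumes "sq_integrable f"
  shows "abs_L2 (\<lambda>s. c * f s) = c *\<^sub>R abs_L2 f"
  using assms by (simp add: scaleR_L2.abs_eq)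

lemma abs_L2_tendsto:
  assumes g: "sq_integrable g"
    and u: "\<And>n. u n \<in> borel_measurable cube" "\<And>n s. s \<in> space cube \<Longrightarrow> \<bar>u n s\<bar> \<le> \<bar>g s\<bar>"
    and f: "f \<in> borel_measurable cube" "\<And>s. s \<in> space cube \<Longrightarrow> (\<lambda>n. u n s) \<longlonglongrightarrow> f s"
  shows "(\<lambda>n. abs_L2 (u n)) \<longlonglongrightarrow> abs_L2 f"
proof -
  have f_le: "\<bar>f s\<bar> \<le> \<bar>g s\<bar>" if "s \<in> space cube" for s
    by (rule tendsto_upperbound[OF tendsto_rabs[OF f(2)[OF that]]]) (use u(2)[OF that] in auto)
  have sq: "sq_integrable (u n)" "sq_integrable f" for n
    using u f f_le by (auto intro!: sq_integrable_bound[OF g])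
  have "(\<lambda>n. \<integral>s. (u n s - f s)\<^sup>2 \<partial>cube) \<longlonglongrightarrow> (\<integral>s. 0 \<partial>(cube :: 'a measure))"
  proof (rule integral_dominated_convergence[where w="\<lambda>s. 4 * (g s)\<^sup>2"])
    show "integrable cube (\<lambda>s. 4 * (g s)\<^sup>2)"
      using g by (simp add: sq_integrable_def)
    show "AE s in cube. (\<lambda>n. (u n s - f s)\<^sup>2) \<longlonglongrightarrow> 0"
    proof (rule AE_I2)
      fix s :: 'a assume "s \<in> space cube"
      then have "(\<lambda>n. (u n s - f s)\<^sup>2) \<longlonglongrightarrow> (f s - f s)\<^sup>2"
        by (intro tendsto_intros f)
      then show "(\<lambda>n. (u n s - f s)\<^sup>2) \<longlonglongrightarrow> 0" by simp
    qed
    show "AE s in cube. norm ((u n s - f s)\<^sup>2) \<le> 4 * (g s)\<^sup>2" for n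
    proof (rule AE_I2)
      fix s :: 'a assume s: "s \<in> space cube"
      have "\<bar>u n s - f s\<bar> \<le> 2 * \<bar>g s\<bar>"
        using u(2)[OF s, of n] f_le[OF s] by linarith
      then have "\<bar>u n s - f s\<bar>\<^sup>2 \<le> (2 * \<bar>g s\<bar>)\<^sup>2"
        by (rule power_mono) simp
      then show "norm ((u n s - f s)\<^sup>2) \<le> 4 * (g s)\<^sup>2"
        by (simp add: power_mult_distrib)
    qed
  qed (use u f in measurable)
  then have "(\<lambda>n. (norm (abs_L2 (u n) - abs_L2 f))\<^sup>2) \<longlonglongrightarrow> 0"
    by (simp add: norm_abs_L2 sq_integrable_diff sq flip: abs_L2_diff)
  then have "(\<lambda>n. sqrt ((norm (abs_L2 (u n) - abs_L2 f))\<^sup>2)) \<longlonglongrightarrow> sqrt 0"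
    by (rule tendsto_real_sqrt)
  then have "(\<lambda>n. abs_L2 (u n) - abs_L2 f) \<longlonglongrightarrow> 0"
    by (simp add: tendsto_norm_zero_iff)
  then show ?thesis
    by (rule LIM_zero_cancel)
qed

lemma sq_integrable_indicator:
  "A \<in> sets borel \<Longrightarrow> sq_integrable (indicator A :: 'a::euclidean_space \<Rightarrow> real)"
  unfolding sq_integrable_def
proof
  assume A: "A \<in> sets borel"
  then show m: "(indicator A :: 'a \<Rightarrow> real) \<in> borel_measurable cube"
    by (auto simp: cube_def intro!: measurable_restrict_space1)
  show "integrable cube (\<lambda>s. (indicator A s :: real)\<^sup>2)"
  proof (rule cube.integrable_const_bound[where B=1])
    show "AE s in cube. norm ((indicator A s :: real)\<^sup>2) \<le> 1"
      by (rule AE_I2) (simp add: indicator_def)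
    show "(\<lambda>s. (indicator A s :: real)\<^sup>2) \<in> borel_measurable cube"
      using m by (rule borel_measurable_power)
  qed
qed

lemma abs_L2_indicator_empty: "abs_L2 (indicator {}) = 0"
proof -
  have "(indicator {} :: 'a \<Rightarrow> real) = (\<lambda>_. 0)" by auto
  then show ?thesis by (simp add: zero_L2_def)
qed

lemma ex_countable_dense_closed_subspace:
  fixes b :: "nat \<Rightarrow> 'v::real_normed_vector"
  shows "\<exists>D. countable D \<and> subspace (closure D) \<and> range b \<subseteq> closure D"
proof -
  define g :: "(rat \<times> nat) list \<Rightarrow> 'v"
    where "g l = (\<Sum>(q, i)\<leftarrow>l. of_rat q *\<^sub>R b i)" for l
  have g_append: "g (l @ l') = g l + g l'" for l l'
    by (simp add: g_def)
  have g_scale: "g (map (\<lambda>(p, i). (q * p, i)) l) = of_rat q *\<^sub>R g l" for q l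
    by (induction l) (auto simp: g_def of_rat_mult scaleR_add_right)
  have "subspace (closure (range g))"
  proof (rule subspaceI)
    have "g [] \<in> closure (range g)" by (rule subsetD[OF closure_subset]) simp
    then show "0 \<in> closure (range g)" by (simp add: g_def)
  next
    fix x y assume "x \<in> closure (range g)" "y \<in> closure (range g)"
    then obtain X Y where X: "\<And>n::nat. X n \<in> range g" "X \<longlonglongrightarrow> x"
      and Y: "\<And>n::nat. Y n \<in> range g" "Y \<longlonglongrightarrow> y"
      unfolding closure_sequential by blast
    have "X n + Y n \<in> range g" for n
    proof -
      obtain l l' where "X n = g l" "Y n = g l'"
        using X(1)[of n] Y(1)[of n] by (elim rangeE)
      then have "X n + Y n = g (l @ l')" by (simp only: g_append)
      then show ?thesis by (rule range_eqI)
    qed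
    moreover have "(\<lambda>n. X n + Y n) \<longlonglongrightarrow> x + y"
      by (intro tendsto_add X Y)
    ultimately show "x + y \<in> closure (range g)"
      unfolding closure_sequential by (intro exI[of _ "\<lambda>n. X n + Y n"]) auto
  next
    fix x and c :: real assume "x \<in> closure (range g)"
    then obtain X where X: "\<And>n::nat. X n \<in> range g" "X \<longlonglongrightarrow> x"
      unfolding closure_sequential by blast
    have "c \<in> closure \<rat>" by (simp add: Rats_closure_real)
    then obtain q where q: "\<And>n::nat. q n \<in> \<rat>" "q \<longlonglongrightarrow> c"
      unfolding closure_sequential by blast
    have "q n *\<^sub>R X n \<in> range g" for n
    proof -
      obtain l where "X n = g l"
        using X(1)[of n] by (elim rangeE)
      moreover obtain p where "q n = of_rat p"
        using q(1)[of n] by (elim Rats_cases)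
      ultimately have "q n *\<^sub>R X n = g (map (\<lambda>(r, i). (p * r, i)) l)"
        by (simp only: g_scale)
      then show ?thesis by (rule range_eqI)
    qed
    moreover have "(\<lambda>n. q n *\<^sub>R X n) \<longlonglongrightarrow> c *\<^sub>R x"
      by (intro tendsto_scaleR X q)
    ultimately show "c *\<^sub>R x \<in> closure (range g)"
      unfolding closure_sequential by (intro exI[of _ "\<lambda>n. q n *\<^sub>R X n"]) auto
  qed
  moreover have "b i \<in> range g" for i
    by (rule range_eqI[of _ _ "[(1, i)]"]) (simp add: g_def)
  then have "range b \<subseteq> closure (range g)"
    using closure_subset[of "range g"] by blast
  moreover have "countable (range g)" by simp
  ultimately show ?thesis by blast
qed

lemma ex_countable_Int_stable_generator:
  "\<exists>E :: 'a::second_countable_topology set set.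
     countable E \<and> Int_stable E \<and> UNIV \<in> E \<and> (\<forall>A\<in>E. open A) \<and> sets borel = sigma_sets UNIV E"
proof -
  obtain B :: "'a set set" where B: "countable B" "topological_basis B"
    using ex_countable_basis by blast
  define E where "E = Inter ` {F. finite F \<and> F \<subseteq> B}"
  have "countable E"
    unfolding E_def by (intro countable_image countable_Collect_finite_subset B)
  moreover have "Int_stable E"
  proof (rule Int_stableI)
    fix a c assume "a \<in> E" "c \<in> E"
    then obtain F G where "a = \<Inter>F" "finite F" "F \<subseteq> B" "c = \<Inter>G" "finite G" "G \<subseteq> B"
      by (auto simp: E_def)
    then show "a \<inter> c \<in> E"
      by (auto simp: E_def intro!: image_eqI[of _ _ "F \<union> G"])
  qed
  moreover have "UNIV \<in> E"
    unfolding E_def by (intro image_eqI[of _ _ "{}"]) auto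
  moreover have E_open: "open A" if "A \<in> E" for A
  proof -
    obtain F where "A = \<Inter>F" "finite F" "F \<subseteq> B"
      using \<open>A \<in> E\<close> by (auto simp: E_def)
    then show ?thesis
      using topological_basis_open[OF B(2)] by (simp add: open_Inter subset_iff)
  qed
  moreover have "sets borel = sigma_sets UNIV E"
  proof
    have "A \<in> sigma_sets UNIV E" if "open A" for A
    proof -
      have "\<exists>B'\<subseteq>B. \<Union>B' = A"
        using that B(2) by (simp add: topological_basis_def)
      then obtain B' where B': "B' \<subseteq> B" "\<Union>B' = A" by (elim exE conjE)
      have "\<Union>B' \<in> sigma_sets UNIV E"
      proof (rule sigma_sets_UNION)
        show "countable B'" by (rule countable_subset[OF B'(1) B(1)])
        fix b assume "b \<in> B'"
        then have "\<Inter>{b} \<in> E"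
          using B'(1) by (auto simp: E_def simp del: Inf_insert)
        then show "b \<in> sigma_sets UNIV E" by (intro sigma_sets.Basic) simp
      qed
      then show ?thesis using B' by simp
    qed
    then show "sets borel \<subseteq> sigma_sets UNIV E"
      unfolding sets_borel by (intro sigma_sets_mono) auto
    show "sigma_sets UNIV E \<subseteq> sets (borel :: 'a measure)"
      unfolding sets_borel by (intro sigma_sets_mono subsetI sigma_sets.Basic CollectI E_open)
  qed
  ultimately show ?thesis by (intro exI[of _ E] conjI ballI)
qed

lemma closed_subspace_L2_eq_UNIV:
  fixes V :: "'a::euclidean_space L2 set"
  assumes V: "subspace V" "closed V"
    and E: "Int_stable E" "UNIV \<in> E" "sets borel = sigma_sets UNIV E"
    and ind: "\<And>A. A \<in> E \<Longrightarrow> abs_L2 (indicator A) \<in> V"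
  shows "V = UNIV"
proof -
  have lim: "x \<in> V" if "\<And>n. X n \<in> V" "X \<longlonglongrightarrow> x" for X :: "nat \<Rightarrow> 'a L2" and x
    using V(2) that unfolding closed_sequential_limits by blast
  have meas: "A \<in> sets borel" if "A \<in> sigma_sets UNIV E" for A
    using that E(3) by simp
  have E_sub: "E \<subseteq> Pow UNIV" by simp
  have borel: "abs_L2 (indicator A) \<in> V" if "A \<in> sigma_sets UNIV E" for A
    using E(1) E_sub that
  proof (induction rule: sigma_sets_induct_disjoint)
    case (basic A)
    then show ?case by (rule ind)
  next
    case empty
    show ?case using subspace_0[OF V(1)] by (simp only: abs_L2_indicator_empty)
  next
    case (compl A)
    have "indicator (UNIV - A) = (\<lambda>s :: 'a. indicator UNIV s - indicator A s :: real)"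
      by (auto simp: indicator_def)
    then have "abs_L2 (indicator (UNIV - A)) = abs_L2 (indicator UNIV) - abs_L2 (indicator A)"
      using meas[OF compl(1)] by (simp only:) (intro abs_L2_diff sq_integrable_indicator; simp)
    then show ?case
      using subspace_diff[OF V(1) ind[OF E(2)] compl(2)] by simp
  next
    case (union A)
    then have A: "A i \<in> sets borel" for i using meas by blast
    have "abs_L2 (indicator (\<Union>i<n. A i)) \<in> V" for n :: nat
    proof (induction n)
      case 0
      show ?case
        using subspace_0[OF V(1)]
        by (simp only: lessThan_0 image_empty Union_empty abs_L2_indicator_empty)
    next
      case (Suc n)
      have "A n \<inter> A i = {}" if "i < n" for i
        using union(1) that by (simp add: disjoint_family_on_def)
      then have "A n \<inter> (\<Union>i<n. A i) = {}" by auto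
      then have "indicator (\<Union>i<Suc n. A i) = (\<lambda>s. indicator (\<Union>i<n. A i) s + indicator (A n) s :: real)"
        by (auto simp: lessThan_Suc fun_eq_iff indicator_def)
      then have "abs_L2 (indicator (\<Union>i<Suc n. A i))
          = abs_L2 (indicator (\<Union>i<n. A i)) + abs_L2 (indicator (A n))"
        using A by (simp only:) (intro abs_L2_add sq_integrable_indicator; auto)
      then show ?case
        using subspace_add[OF V(1) Suc union(3)] by simp
    qed
    moreover have "(\<lambda>n. abs_L2 (indicator (\<Union>i<n. A i))) \<longlonglongrightarrow> abs_L2 (indicator (\<Union>i. A i))"
    proof (rule abs_L2_tendsto[where g="indicator UNIV"])
      show "(indicator (\<Union>i<n. A i) :: 'a \<Rightarrow> real) \<in> borel_measurable cube" for n
        by (rule sq_integrable_measurable, rule sq_integrable_indicator) (use A in auto)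
      show "(indicator (\<Union>i. A i) :: 'a \<Rightarrow> real) \<in> borel_measurable cube"
        by (rule sq_integrable_measurable, rule sq_integrable_indicator) (use A in auto)
      show "(\<lambda>n. indicator (\<Union>i<n. A i) s :: real) \<longlonglongrightarrow> indicator (\<Union>i. A i) s" for s
        by (rule LIMSEQ_indicator_UN)
      show "sq_integrable (indicator UNIV :: 'a \<Rightarrow> real)"
        by (rule sq_integrable_indicator) simp
    qed (simp add: indicator_def)
    ultimately show ?case by (rule lim)
  qed
  have nonneg: "sq_integrable u \<longrightarrow> abs_L2 u \<in> V" if "u \<in> borel_measurable cube" "\<And>s. 0 \<le> u s" for u
    using that
  proof (induction rule: borel_measurable_induct_real)
    case (set A)
    then obtain A' where A': "A' \<in> sets borel" "A = A' \<inter> cbox 0 One"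
      by (auto simp: cube_def sets_restrict_space)
    have "abs_L2 (indicator A :: 'a \<Rightarrow> real) = abs_L2 (indicator A')"
      using A' by (intro abs_L2_eqI sq_integrable_indicator) (auto simp: space_cube indicator_def)
    then show ?case using borel[of A'] A'(1) E(3) by simp
  next
    case (mult u c)
    show ?case
    proof (cases "c = 0")
      case True
      then show ?thesis using subspace_0[OF V(1)] by (simp add: zero_L2_def)
    next
      case False
      show ?thesis
      proof
        assume *: "sq_integrable (\<lambda>s. c * u s)"
        have "sq_integrable u"
          using sq_integrable_scale[OF *, of "1/c"] False by simp
        then show "abs_L2 (\<lambda>s. c * u s) \<in> V"
          using mult.IH subspace_scale[OF V(1)] by (simp add: abs_L2_scale)
      qed
    qed
  next
    case (add u v)
    show ?case
    proof
      assume *: "sq_integrable (\<lambda>s. v s + u s)"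
      have "sq_integrable u" "sq_integrable v"
        using add by (auto intro!: sq_integrable_bound[OF *])
      then show "abs_L2 (\<lambda>s. v s + u s) \<in> V"
        using add subspace_add[OF V(1)] by (simp add: abs_L2_add)
    qed
  next
    case (seq U)
    show ?case
    proof
      assume u: "sq_integrable u"
      have le: "\<bar>U n s\<bar> \<le> \<bar>u s\<bar>" if "s \<in> space cube" for n s
      proof -
        have "U n s \<le> u s"
          using seq.hyps(3) seq.hyps(4)[OF that] by (intro incseq_le) (auto simp: incseq_def le_fun_def)
        then show ?thesis using seq.hyps(2)[of n s] by simp
      qed
      then have "sq_integrable (U n)" for n
        using seq.hyps(1) by (auto intro!: sq_integrable_bound[OF u])
      then have "abs_L2 (U n) \<in> V" for n using seq.IH by blast
      moreover have "(\<lambda>n. abs_L2 (U n)) \<longlonglongrightarrow> abs_L2 u"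
        by (rule abs_L2_tendsto[OF u]) (use seq.hyps le sq_integrable_measurable[OF u] in auto)
      ultimately show "abs_L2 u \<in> V" by (rule lim)
    qed
  qed
  have "x \<in> V" for x
  proof -
    define f where "f = rep_L2 x"
    have f: "sq_integrable f" "x = abs_L2 f"
      unfolding f_def
      by (simp_all only: sq_integrable_rep_L2 abs_rep_L2)
    have p: "sq_integrable (\<lambda>s. max 0 (f s))" "sq_integrable (\<lambda>s. max 0 (- f s))"
      using sq_integrable_measurable[OF f(1)] by (auto intro!: sq_integrable_bound[OF f(1)])
    have "f = (\<lambda>s. max 0 (f s) - max 0 (- f s))" by auto
    then have "x = abs_L2 (\<lambda>s. max 0 (f s)) - abs_L2 (\<lambda>s. max 0 (- f s))"
      using f(2) abs_L2_diff[OF p] by simp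
    moreover have "abs_L2 (\<lambda>s. max 0 (f s)) \<in> V" "abs_L2 (\<lambda>s. max 0 (- f s)) \<in> V"
      using nonneg p sq_integrable_measurable by auto
    ultimately show ?thesis using subspace_diff[OF V(1)] by simp
  qed
  then show ?thesis by auto
qed

lemma L2_separable: "\<exists>D :: 'a::euclidean_space L2 set. countable D \<and> closure D = UNIV"
proof -
  obtain E :: "'a set set" where E: "countable E" "Int_stable E" "UNIV \<in> E"
      "sets borel = sigma_sets UNIV E"
    using ex_countable_Int_stable_generator by blast
  obtain D where D: "countable D" "subspace (closure D)"
      "range (\<lambda>n. abs_L2 (indicator (from_nat_into E n)) :: 'a L2) \<subseteq> closure D"
    using ex_countable_dense_closed_subspace by blast
  have "closure D = UNIV"
  proof (rule closed_subspace_L2_eq_UNIV[OF D(2) closed_closure E(2-4)])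
    fix A assume "A \<in> E"
    then obtain n where "from_nat_into E n = A"
      using from_nat_into_surj[OF E(1)] by blast
    then show "abs_L2 (indicator A) \<in> closure D"
      using D(3) by blast
  qed
  then show ?thesis using D(1) by blast
qed

instance L2 :: (euclidean_space) second_countable_topology
proof
  obtain D :: "'a L2 set" where D: "countable D" "closure D = UNIV"
    using L2_separable by blast
  define B where "B = (\<lambda>(x, n). ball x (1 / real (Suc n))) ` (D \<times> (UNIV :: nat set))"
  have "countable B"
    unfolding B_def using D(1) by (intro countable_image countable_SIGMA) auto
  moreover have "topological_basis B"
  proof (rule topological_basisI)
    show "open b" if "b \<in> B" for b
      using that by (auto simp: B_def)
    fix U and x :: "'a L2" assume "open U" "x \<in> U"
    then obtain e where e: "0 < e" "ball x e \<subseteq> U"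
      by (auto simp: open_contains_ball)
    obtain n where n: "1 / real (Suc n) < e / 2"
      using e(1) nat_approx_posE[of "e / 2"] by auto
    have "x \<in> closure D" by (simp add: D)
    then obtain y where y: "y \<in> D" "dist y x < 1 / real (Suc n)"
      unfolding closure_approachable by (meson divide_pos_pos of_nat_0_less_iff zero_less_Suc zero_less_one)
    have "ball y (1 / real (Suc n)) \<subseteq> ball x e"
    proof
      fix z assume "z \<in> ball y (1 / real (Suc n))"
      then show "z \<in> ball x e"
        using y(2) n dist_triangle[of x z y] by (simp add: dist_commute)
    qed
    then show "\<exists>b\<in>B. x \<in> b \<and> b \<subseteq> U"
      using y e(2) unfolding B_def
      by (intro bexI[of _ "ball y (1 / real (Suc n))"]) (auto intro!: rev_image_eqI[of "(y, n)"])
  qed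
  ultimately show "\<exists>B :: 'a L2 set set. countable B \<and> open = generate_topology B"
    using topological_basis_imp_subbasis by blast
qed

section \<open>Kernels in \<open>L\<^sup>2([0,1]\<^sup>d \<times> [0,1]\<^sup>d)\<close>\<close>

lemma cbox_One_Times:
  "cbox 0 One = (cbox 0 One :: 'a::euclidean_space set) \<times> (cbox 0 One :: 'b::euclidean_space set)"
  by (simp add: sum_Basis_prod_eq sum_prod zero_prod_def cbox_Pair_eq)

lemma cube_prod: "cube \<Otimes>\<^sub>M cube = (cube :: ('a::euclidean_space \<times> 'b::euclidean_space) measure)"
proof (rule pair_measure_eqI)
  show "sigma_finite_measure (cube :: 'a measure)" "sigma_finite_measure (cube :: 'b measure)"
    by unfold_locales
  have cubeD: "A \<in> sets lborel \<and> A \<subseteq> cbox 0 One" if "A \<in> sets cube" for A :: "'c::euclidean_space set"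
    using that by (auto simp: cube_def sets_restrict_space)
  have cubeI: "A \<in> sets cube" if "A \<in> sets borel" "A \<subseteq> cbox 0 One" for A :: "'c::euclidean_space set"
    using that unfolding cube_def sets_restrict_space sets_lborel
    by (intro image_eqI[of _ _ A]) (simp_all add: Int_absorb1)
  have times: "A \<times> B \<in> sets (cube :: ('a \<times> 'b) measure)"
    if "A \<in> sets cube" "B \<in> sets cube" for A :: "'a set" and B :: "'b set"
    using cubeD[OF that(1)] cubeD[OF that(2)]
    by (intro cubeI) (auto simp: cbox_One_Times intro!: borel_Times)
  show "sets (cube \<Otimes>\<^sub>M cube :: ('a \<times> 'b) measure) = sets cube"
  proof
    show "sets (cube \<Otimes>\<^sub>M cube :: ('a \<times> 'b) measure) \<subseteq> sets cube"
      unfolding sets_pair_measure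
      by (rule sets.sigma_sets_subset') (auto intro: times)
    show "sets cube \<subseteq> sets (cube \<Otimes>\<^sub>M cube :: ('a \<times> 'b) measure)"
    proof
      fix X :: "('a \<times> 'b) set" assume "X \<in> sets cube"
      then have X: "X \<in> sets (borel \<Otimes>\<^sub>M borel)" "X \<subseteq> cbox 0 One \<times> cbox 0 One"
        unfolding borel_prod cbox_One_Times[symmetric] using cubeD[of X] by simp_all
      have "(\<lambda>s. s) \<in> (cube :: 'c::euclidean_space measure) \<rightarrow>\<^sub>M borel"
        by (simp add: cube_def measurable_restrict_space1)
      then have "(\<lambda>s. (fst s, snd s)) \<in> cube \<Otimes>\<^sub>M cube \<rightarrow>\<^sub>M borel \<Otimes>\<^sub>M borel"
        by measurable
      from measurable_sets[OF this X(1)] show "X \<in> sets (cube \<Otimes>\<^sub>M cube)"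
        using X(2) by (simp add: space_pair_measure space_cube Int_absorb2)
    qed
  qed
  fix A :: "'a set" and B :: "'b set" assume AB: "A \<in> sets cube" "B \<in> sets cube"
  have em: "emeasure cube C = emeasure lborel C" if "C \<in> sets cube" for C :: "'c::euclidean_space set"
    using cubeD[OF that] by (simp add: cube_def emeasure_restrict_space)
  have "emeasure cube (A \<times> B) = emeasure (lborel \<Otimes>\<^sub>M lborel) (A \<times> B)"
    unfolding lborel_prod by (rule em[OF times[OF AB]])
  also have "\<dots> = emeasure lborel A * emeasure lborel B"
    by (rule lborel.emeasure_pair_measure_Times) (rule cubeD[THEN conjunct1], rule AB)+
  finally show "emeasure cube A * emeasure cube B = emeasure cube (A \<times> B)"
    by (simp only: em AB)
qed

interpretation cube_pair: pair_prob_space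
  "cube :: 'a::euclidean_space measure" "cube :: 'b::euclidean_space measure" ..

lemma measurable_fst_cube: "fst \<in> (cube :: ('a::euclidean_space \<times> 'b::euclidean_space) measure) \<rightarrow>\<^sub>M cube"
  and measurable_snd_cube: "snd \<in> (cube :: ('a \<times> 'b) measure) \<rightarrow>\<^sub>M cube"
  by (simp_all flip: cube_prod)

lemma measurable_swap_cube:
  "prod.swap \<in> (cube :: ('a::euclidean_space \<times> 'b::euclidean_space) measure) \<rightarrow>\<^sub>M cube"
  unfolding prod.swap_def by (simp flip: cube_prod)

lemma distr_fst_cube:
  "distr (cube :: ('a::euclidean_space \<times> 'b::euclidean_space) measure) cube fst = cube"
  unfolding cube_prod[symmetric] by (rule cube.distr_pair_fst)

lemma distr_swap_cube:
  "distr (cube :: ('a::euclidean_space \<times> 'b::euclidean_space) measure) cube prod.swap = cube"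
proof -
  have "(prod.swap :: 'a \<times> 'b \<Rightarrow> _) = (\<lambda>(x, y). (y, x))" by auto
  then show ?thesis
    using cube_pair.distr_pair_swap[where 'a='b and 'b='a, symmetric] by (simp only: cube_prod)
qed

lemma distr_snd_cube:
  "distr (cube :: ('a::euclidean_space \<times> 'b::euclidean_space) measure) cube snd = cube"
proof -
  have "snd = (fst :: 'b \<times> 'a \<Rightarrow> 'b) \<circ> (prod.swap :: 'a \<times> 'b \<Rightarrow> _)"
    by (rule ext) (simp only: o_apply fst_swap)
  then have "distr cube cube (snd :: 'a \<times> 'b \<Rightarrow> 'b) = distr (distr cube cube prod.swap) cube (fst :: 'b \<times> 'a \<Rightarrow> 'b)"
    by (simp only: distr_distr[OF measurable_fst_cube measurable_swap_cube])
  then show ?thesis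
    unfolding distr_swap_cube distr_fst_cube .
qed

lemma AE_cube_fst: "AE s in cube. P s \<Longrightarrow> AE s in cube. P (fst s)"
  by (rule AE_distrD[OF measurable_fst_cube]) (subst distr_fst_cube)

lemma AE_cube_snd: "AE s in cube. P s \<Longrightarrow> AE s in cube. P (snd s)"
  by (rule AE_distrD[OF measurable_snd_cube]) (subst distr_snd_cube)

lemma AE_cube_swap: "AE s in cube. P s \<Longrightarrow> AE s in cube. P (prod.swap s)"
  by (rule AE_distrD[OF measurable_swap_cube]) (subst distr_swap_cube)

lemma sq_integrable_tensor:
  assumes f: "sq_integrable f" and g: "sq_integrable g"
  shows "sq_integrable (\<lambda>s. f (fst s) * g (snd s))"
  unfolding sq_integrable_def
proof
  have [measurable]: "f \<in> borel_measurable cube" "g \<in> borel_measurable cube"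
    using f g by (simp_all add: sq_integrable_def)
  have m: "(\<lambda>s. f (fst s) * g (snd s)) \<in> borel_measurable (cube \<Otimes>\<^sub>M cube)"
    by measurable
  then show "(\<lambda>s. f (fst s) * g (snd s)) \<in> borel_measurable cube"
    by (simp add: cube_prod)
  have "integrable (cube \<Otimes>\<^sub>M cube) (\<lambda>s. (f (fst s) * g (snd s))\<^sup>2)"
  proof (rule cube_pair.Fubini_integrable)
    show "(\<lambda>s. (f (fst s) * g (snd s))\<^sup>2) \<in> borel_measurable (cube \<Otimes>\<^sub>M cube)"
      using m by (rule borel_measurable_power)
    show "integrable cube (\<lambda>x. \<integral>y. norm ((f (fst (x, y)) * g (snd (x, y)))\<^sup>2) \<partial>cube)"
      using f g by (simp add: sq_integrable_def power_mult_distrib)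
    show "AE x in cube. integrable cube (\<lambda>y. (f (fst (x, y)) * g (snd (x, y)))\<^sup>2)"
      using g by (simp add: sq_integrable_def power_mult_distrib)
  qed
  then show "integrable cube (\<lambda>s. (f (fst s) * g (snd s))\<^sup>2)"
    by (simp add: cube_prod)
qed

lemma sq_integrable_swap:
  assumes k: "sq_integrable k"
  shows "sq_integrable (\<lambda>s. k (prod.swap s))"
  unfolding sq_integrable_def
proof
  show "(\<lambda>s. k (prod.swap s)) \<in> borel_measurable cube"
    using sq_integrable_measurable[OF k] measurable_swap_cube by (rule measurable_compose[rotated])
  have "integrable (distr cube cube prod.swap) (\<lambda>s. (k s)\<^sup>2)"
    using k by (simp add: distr_swap_cube sq_integrable_def)
  then show "integrable cube (\<lambda>s. (k (prod.swap s))\<^sup>2)"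
    by (rule integrable_distr[OF measurable_swap_cube])
qed

text \<open>The kernel \<open>(s\<^sub>1, s\<^sub>2) \<mapsto> x(s\<^sub>1) y(s\<^sub>2)\<close>.\<close>

lift_definition tensor :: "'a::euclidean_space L2 \<Rightarrow> 'b::euclidean_space L2 \<Rightarrow> ('a \<times> 'b) L2" (infixr "\<otimes>\<^sub>2" 75)
  is "\<lambda>f g s. f (fst s) * g (snd s)"
proof (elim conjE, intro conjI)
  fix f f' :: "'a \<Rightarrow> real" and g g' :: "'b \<Rightarrow> real"
  assume "AE s in cube. f s = f' s" "AE s in cube. g s = g' s"
  then show "AE s in cube. f (fst s) * g (snd s) = f' (fst s) * g' (snd s)"
    by (intro AE_eq_combine[where h="(*)"] AE_cube_fst AE_cube_snd)
qed (rule sq_integrable_tensor; assumption)+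

text \<open>The kernel \<open>(s\<^sub>1, s\<^sub>2) \<mapsto> k(s\<^sub>2, s\<^sub>1)\<close>.\<close>

lift_definition flip_kernel :: "('a::euclidean_space \<times> 'b::euclidean_space) L2 \<Rightarrow> ('b \<times> 'a) L2"
  is "\<lambda>k s. k (prod.swap s)"
proof (elim conjE, intro conjI)
  fix k k' :: "'a \<times> 'b \<Rightarrow> real"
  assume "AE s in cube. k s = k' s"
  then show "AE s in cube. k (prod.swap s) = k' (prod.swap s)"
    by (rule AE_cube_swap)
qed (rule sq_integrable_swap; assumption)+

section \<open>Random functions, stationarity and approximability\<close>

text \<open>
  Since \<open>'a L2\<close> is a separable Banach space, random functions are Borel measurable maps into it
  and expectations are Bochner integrals.
\<close>

definition Lp_H :: "'w measure \<Rightarrow> real \<Rightarrow> ('w \<Rightarrow> 'h::real_normed_vector) set" where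
  "Lp_H M p = {X \<in> borel_measurable M. integrable M (\<lambda>\<omega>. norm (X \<omega>) powr p)}"

definition v_norm :: "'w measure \<Rightarrow> real \<Rightarrow> ('w \<Rightarrow> 'h::real_normed_vector) \<Rightarrow> real" where
  "v_norm M p X = (\<integral>\<omega>. norm (X \<omega>) powr p \<partial>M) powr (1 / p)"

text \<open>All finite-dimensional distributions are invariant under time shifts.\<close>

definition strictly_stationary :: "'w measure \<Rightarrow> (int \<Rightarrow> 'w \<Rightarrow> 'h::topological_space) \<Rightarrow> bool" where
  "strictly_stationary M X \<longleftrightarrow>
     (\<forall>J k. finite J \<longrightarrow>
        distr M (PiM J (\<lambda>_. borel)) (\<lambda>\<omega>. \<lambda>t\<in>J. X (t + k) \<omega>) =
        distr M (PiM J (\<lambda>_. borel)) (\<lambda>\<omega>. \<lambda>t\<in>J. X t \<omega>))"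

text \<open>
  \<open>X t T\<close> is \<open>X\<^sub>t\<^sub>,\<^sub>T\<close> and \<open>Xs u t\<close> is the approximating stationary process at rescaled time \<open>u\<close>.
\<close>

definition locally_stationary ::
  "'w measure \<Rightarrow> real \<Rightarrow> real \<Rightarrow> (nat \<Rightarrow> nat \<Rightarrow> 'w \<Rightarrow> 'h::real_normed_vector) \<Rightarrow>
   (real \<Rightarrow> int \<Rightarrow> 'w \<Rightarrow> 'h) \<Rightarrow> bool" where
  "locally_stationary M p \<rho> X Xs \<longleftrightarrow>
     (\<forall>T. \<forall>t\<in>{1..T}. X t T \<in> Lp_H M p) \<and>
     (\<forall>u\<in>{0..1}. (\<forall>t. Xs u t \<in> Lp_H M p) \<and> strictly_stationary M (Xs u)) \<and>
     (\<exists>U :: real \<Rightarrow> nat \<Rightarrow> nat \<Rightarrow> 'w \<Rightarrow> real. \<exists>C :: real. \<forall>u\<in>{0..1}. \<forall>T. \<forall>t\<in>{1..T}.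
        U u t T \<in> borel_measurable M \<and>
        (\<forall>\<omega>\<in>space M. 0 < U u t T \<omega>) \<and>
        integrable M (\<lambda>\<omega>. U u t T \<omega> powr \<rho>) \<and>
        (\<integral>\<omega>. U u t T \<omega> powr \<rho> \<partial>M) < C \<and>
        (AE \<omega> in M. norm (X t T \<omega> - Xs u (int t) \<omega>)
                     \<le> (\<bar>real t / real T - u\<bar> + 1 / real T) * U u t T \<omega>))"

definition iid_sequence :: "'w measure \<Rightarrow> 's measure \<Rightarrow> (int \<Rightarrow> 'w \<Rightarrow> 's) \<Rightarrow> bool" where
  "iid_sequence M S \<epsilon> \<longleftrightarrow>
     prob_space.indep_vars M (\<lambda>_. S) \<epsilon> UNIV \<and> (\<forall>j k. distr M S (\<epsilon> j) = distr M S (\<epsilon> k))"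

definition independent_copy ::
  "'w measure \<Rightarrow> 's measure \<Rightarrow> (int \<Rightarrow> 'w \<Rightarrow> 's) \<Rightarrow> (int \<Rightarrow> 'w \<Rightarrow> 's) \<Rightarrow> bool" where
  "independent_copy M S \<epsilon> \<epsilon>' \<longleftrightarrow>
     prob_space.indep_var M
       (PiM UNIV (\<lambda>_. S)) (\<lambda>\<omega> k. \<epsilon> k \<omega>) (PiM UNIV (\<lambda>_. S)) (\<lambda>\<omega> k. \<epsilon>' k \<omega>) \<and>
     distr M (PiM UNIV (\<lambda>_. S)) (\<lambda>\<omega> k. \<epsilon>' k \<omega>) = distr M (PiM UNIV (\<lambda>_. S)) (\<lambda>\<omega> k. \<epsilon> k \<omega>)"

text \<open>
  \<open>f(\<epsilon>\<^sub>t, \<dots>, \<epsilon>\<^sub>t\<^sub>-\<^sub>m\<^sub>+\<^sub>1, \<epsilon>'\<^sub>t\<^sub>-\<^sub>m, \<epsilon>'\<^sub>t\<^sub>-\<^sub>m\<^sub>-\<^sub>1, \<dots>)\<close>, where \<open>\<epsilon>' m t\<close> is the copy of the innovations used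
  at time \<open>t\<close> with lag \<open>m\<close>; argument number \<open>k\<close> of \<open>f\<close> is the innovation at time \<open>t - k\<close>.
\<close>

definition m_approximation ::
  "((nat \<Rightarrow> 's) \<Rightarrow> 'h) \<Rightarrow> (int \<Rightarrow> 'w \<Rightarrow> 's) \<Rightarrow> (nat \<Rightarrow> int \<Rightarrow> int \<Rightarrow> 'w \<Rightarrow> 's) \<Rightarrow>
   nat \<Rightarrow> int \<Rightarrow> 'w \<Rightarrow> 'h" where
  "m_approximation f \<epsilon> \<epsilon>' m t \<omega> =
     f (\<lambda>k. if k < m then \<epsilon> (t - int k) \<omega> else \<epsilon>' m t (t - int k) \<omega>)"

definition Lp_m_approximable ::
  "'w measure \<Rightarrow> 's measure \<Rightarrow> real \<Rightarrow> ((nat \<Rightarrow> 's) \<Rightarrow> 'h::real_normed_vector) \<Rightarrow>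
   (int \<Rightarrow> 'w \<Rightarrow> 's) \<Rightarrow> (nat \<Rightarrow> int \<Rightarrow> int \<Rightarrow> 'w \<Rightarrow> 's) \<Rightarrow> (int \<Rightarrow> 'w \<Rightarrow> 'h) \<Rightarrow> bool" where
  "Lp_m_approximable M S p f \<epsilon> \<epsilon>' X \<longleftrightarrow>
     (\<forall>t. X t \<in> Lp_H M p) \<and>
     iid_sequence M S \<epsilon> \<and>
     f \<in> PiM UNIV (\<lambda>_. S) \<rightarrow>\<^sub>M borel \<and>
     (\<forall>t. AE \<omega> in M. X t \<omega> = f (\<lambda>k. \<epsilon> (t - int k) \<omega>)) \<and>
     (\<forall>m\<ge>1. \<forall>t. independent_copy M S \<epsilon> (\<epsilon>' m t)) \<and>
     (\<forall>t. summable (\<lambda>m. v_norm M p (\<lambda>\<omega>. X t \<omega> - m_approximation f \<epsilon> \<epsilon>' (Suc m) t \<omega>)))"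

definition converges_in_prob :: "'w measure \<Rightarrow> (nat \<Rightarrow> 'w \<Rightarrow> real) \<Rightarrow> real \<Rightarrow> bool" where
  "converges_in_prob M Y y \<longleftrightarrow>
     (\<forall>e>0. (\<lambda>n. measure M {\<omega> \<in> space M. \<bar>Y n \<omega> - y\<bar> > e}) \<longlonglongrightarrow> 0)"

section \<open>Localized autocovariances and the long-run covariance\<close>

text \<open>
  The estimators are functions of an observed path \<open>x 1, \<dots>, x T\<close>; \<open>K\<^sub>1\<^sub>,\<^sub>h(u - j/T)\<close> is
  \<open>K1 ((u - j/T) / h)\<close>.
\<close>

definition local_mean ::
  "(real \<Rightarrow> real) \<Rightarrow> real \<Rightarrow> real \<Rightarrow> nat \<Rightarrow> (nat \<Rightarrow> 'h::real_vector) \<Rightarrow> 'h" where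
  "local_mean K1 h u T x =
     (1 / (real T * h)) *\<^sub>R (\<Sum>t\<in>{1..T}. K1 ((u - real t / real T) / h) *\<^sub>R x t)"

definition gamma_hat ::
  "(real \<Rightarrow> real) \<Rightarrow> real \<Rightarrow> real \<Rightarrow> nat \<Rightarrow> (nat \<Rightarrow> 'a::euclidean_space L2) \<Rightarrow> nat \<Rightarrow>
   ('a \<times> 'a) L2" where
  "gamma_hat K1 h u T x t =
     (1 / (real T * h)) *\<^sub>R
     (\<Sum>j\<in>{t + 1..T}. K1 ((u - real j / real T) / h) *\<^sub>R
        ((x j - local_mean K1 h u T x) \<otimes>\<^sub>2 (x (j - t) - local_mean K1 h u T x)))"

definition c_hat ::
  "(real \<Rightarrow> real) \<Rightarrow> (real \<Rightarrow> real) \<Rightarrow> real \<Rightarrow> real \<Rightarrow> real \<Rightarrow> nat \<Rightarrow>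
   (nat \<Rightarrow> 'a::euclidean_space L2) \<Rightarrow> ('a \<times> 'a) L2" where
  "c_hat K1 K2 h b u T x =
     gamma_hat K1 h u T x 0 +
     (\<Sum>t\<in>{1..T - 1}. K2 (real t / b) *\<^sub>R
        (gamma_hat K1 h u T x t + flip_kernel (gamma_hat K1 h u T x t)))"

text \<open>\<open>cross_cov M X Y\<close> is the kernel \<open>E[X(s\<^sub>1) Y(s\<^sub>2)]\<close> of centred random functions.\<close>

definition cross_cov ::
  "'w measure \<Rightarrow> ('w \<Rightarrow> 'a::euclidean_space L2) \<Rightarrow> ('w \<Rightarrow> 'a L2) \<Rightarrow> ('a \<times> 'a) L2" where
  "cross_cov M X Y = (\<integral>\<omega>. X \<omega> \<otimes>\<^sub>2 Y \<omega> \<partial>M)"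

definition long_run_cov ::
  "'w measure \<Rightarrow> (int \<Rightarrow> 'w \<Rightarrow> 'a::euclidean_space L2) \<Rightarrow> ('a \<times> 'a) L2" where
  "long_run_cov M X =
     cross_cov M (X 0) (X 0) +
     (\<Sum>t. cross_cov M (X 0) (X (int (Suc t)))) +
     (\<Sum>t. cross_cov M (X (int (Suc t))) (X 0))"

end

(*
  The estimator is a quadratic form (T h)^-1 * sum_{j,k} a_{jk} (X_j - Xbar) (x) (X_k - Xbar) with
  weights supported on a band of width O(b) around the diagonal.  For the stationary approximation
  Y_t = f(eps_t, eps_{t-1}, ...) everything follows from the Efron-Stein inequality: replacing one
  innovation changes Y_t by delta_{t-i} in L^4 with delta summable, which gives
  ||sum a_t Y_t||_4 = O((sum a_t^2)^(1/2)), and a second application bounds the variance of the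
  quadratic form by O(b / (T h)).  Local nonstationarity and the local mean perturb Y_t by
  O(h + (T h)^(-1/2)) in L^2; paired with the sums sum_k a_{jk} Y_k of size O(sqrt b) this costs
  O(h sqrt b + sqrt (b / (T h))), which vanishes.  The expectation converges by Tannery's theorem.
*)

theory Submission
  imports Defs
begin

text \<open>Approximability controls the exchange of the whole remote past, whereas Efron--Stein
  needs the exchange of one innovation. The latter is a difference of two couplings at adjacent
  lags, so it costs at most \<open>\<theta> m + \<theta> (Suc m)\<close> and inherits summability.
  To have all couplings on one space, the innovations and one copy become coordinates of a product
  measure indexed by \<open>int \<times> bool\<close>; a coupling is then a measure-preserving
  exchange of coordinates. The infinite past before the sample counts as a single innovation, which
  leaves finitely many exchanges. Fourth moments enter because one exchange changes the quadratic
  form by products of an increment and a linear form, measured in L^2. It is decisive to bound the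
  sums of a_{jk} Y_k by cancellation: term by term, the bias would cost h b instead of h sqrt b, and
  the rates do not force h b to vanish (h = T^(-0.4), b = T^(0.5)). Right continuity of
  \<open>K2\<close> at 0 enters through the expectation: it gives K2(t/b) -> 1 at each fixed lag t,
  which \<open>K2 0 = 1\<close> alone does not.\<close>

section \<open>Moment bounds\<close>

text \<open>An upper bound \<open>c\<close> for the L^p norm. As the integral is an extended
  nonnegative one, the bound includes integrability, and no root has to be taken.\<close>

definition Lp_le :: "'w measure \<Rightarrow> nat \<Rightarrow> ('w \<Rightarrow> 'b::real_normed_vector) \<Rightarrow> real \<Rightarrow> bool" where
  "Lp_le M p X c \<longleftrightarrow> X \<in> borel_measurable M \<and> 0 \<le> c \<and>
     (\<integral>\<^sup>+\<omega>. ennreal (norm (X \<omega>) ^ p) \<partial>M) \<le> ennreal (c ^ p)"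

lemma Lp_le_measurable: "Lp_le M p X c \<Longrightarrow> X \<in> borel_measurable M"
  by (simp add: Lp_le_def)

lemma Lp_le_nonneg: "Lp_le M p X c \<Longrightarrow> 0 \<le> c"
  by (simp add: Lp_le_def)

lemma Lp_le_mono:
  assumes "Lp_le M p X c" "c \<le> d"
  shows "Lp_le M p X d"
  using assms power_mono[of c d p] unfolding Lp_le_def
  by (metis ennreal_leI order_trans)

lemma Lp_le_zero: "p > 0 \<Longrightarrow> 0 \<le> c \<Longrightarrow> Lp_le M p (\<lambda>_. 0) c"
  by (simp add: Lp_le_def power_0_left)

lemma Lp_le_dominated:
  assumes Y: "Lp_le M p Y c" and X: "X \<in> borel_measurable M"
    and le: "AE \<omega> in M. norm (X \<omega>) \<le> norm (Y \<omega>)"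
  shows "Lp_le M p X c"
proof -
  have "(\<integral>\<^sup>+\<omega>. ennreal (norm (X \<omega>) ^ p) \<partial>M) \<le> (\<integral>\<^sup>+\<omega>. ennreal (norm (Y \<omega>) ^ p) \<partial>M)"
    using le by (intro nn_integral_mono_AE) (auto elim!: eventually_mono intro!: ennreal_leI power_mono)
  with X Y show ?thesis unfolding Lp_le_def by (auto intro: order_trans)
qed

lemma Lp_le_cong_AE:
  assumes "Lp_le M p Y c" "X \<in> borel_measurable M" "AE \<omega> in M. X \<omega> = Y \<omega>"
  shows "Lp_le M p X c"
  by (rule Lp_le_dominated[OF assms(1,2)]) (use assms(3) in auto)

lemma Lp_le_norm:
  "Lp_le M p X c \<Longrightarrow> Lp_le M p (\<lambda>\<omega>. norm (X \<omega>)) c"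
  by (auto simp: Lp_le_def)

text \<open>The constants in the proofs of Minkowski and Cauchy--Schwarz appear in denominators.
  Enlarging them by \<open>e > 0\<close> and letting \<open>e\<close> tend to 0 covers the case of a
  zero constant.\<close>

lemma Lp_le_eps:
  assumes X: "X \<in> borel_measurable M" and c: "0 \<le> c" and *: "\<And>e. 0 < e \<Longrightarrow> Lp_le M p X (c + e)"
  shows "Lp_le M p X c"
proof -
  have "((\<lambda>e. ennreal ((c + e) ^ p)) \<longlongrightarrow> ennreal ((c + 0) ^ p)) (at_right 0)"
    by (intro tendsto_intros)
  moreover have "\<forall>\<^sub>F e in at_right 0. (\<integral>\<^sup>+\<omega>. ennreal (norm (X \<omega>) ^ p) \<partial>M) \<le> ennreal ((c + e) ^ p)"
    using eventually_at_right_less by eventually_elim (use * in \<open>simp add: Lp_le_def\<close>)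
  ultimately have "(\<integral>\<^sup>+\<omega>. ennreal (norm (X \<omega>) ^ p) \<partial>M) \<le> ennreal ((c + 0) ^ p)"
    by (intro tendsto_lowerbound) auto
  with X c show ?thesis by (simp add: Lp_le_def)
qed

text \<open>Minkowski's inequality, from the convexity of \<open>x\<^sup>p\<close> with the weights \<open>c / (c + d)\<close> and \<open>d / (c + d)\<close>.\<close>

lemma Lp_le_add_pos:
  fixes X Y :: "'w \<Rightarrow> 'b::{real_normed_vector, second_countable_topology}"
  assumes X: "Lp_le M p X c" and Y: "Lp_le M p Y d" and pos: "0 < c" "0 < d"
  shows "Lp_le M p (\<lambda>\<omega>. X \<omega> + Y \<omega>) (c + d)"
proof -
  have [measurable]: "X \<in> borel_measurable M" "Y \<in> borel_measurable M"
    using X Y by (auto simp: Lp_le_def)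
  define r s where "r = (c + d) ^ p * (c / (c + d)) / c ^ p" and "s = (c + d) ^ p * (d / (c + d)) / d ^ p"
  have rs: "0 \<le> r" "0 \<le> s" using pos by (auto simp: r_def s_def)
  have conv: "norm (x + y) ^ p \<le> r * norm x ^ p + s * norm y ^ p" for x y :: 'b
  proof -
    have "((c / (c + d)) * (norm x / c) + (d / (c + d)) * (norm y / d)) ^ p
        \<le> (c / (c + d)) * (norm x / c) ^ p + (d / (c + d)) * (norm y / d) ^ p"
    proof (cases "p = 0")
      case True
      then show ?thesis using pos by (simp flip: add_divide_distrib)
    next
      case False
      have "convex_on {0..} (\<lambda>x::real. x ^ p)"
        by (cases "even p") (auto intro: convex_on_subset[OF convex_power_even] convex_power_odd)
      from convex_onD[OF this, of "d / (c + d)" "norm x / c" "norm y / d"] pos show ?thesis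
        by (simp add: field_simps)
    qed
    moreover have "(c / (c + d)) * (norm x / c) + (d / (c + d)) * (norm y / d) = (norm x + norm y) / (c + d)"
      using pos by (simp add: add_divide_distrib)
    ultimately have "(norm x + norm y) ^ p / (c + d) ^ p \<le> (c / (c + d)) * (norm x ^ p / c ^ p) + (d / (c + d)) * (norm y ^ p / d ^ p)"
      by (simp add: power_divide)
    then have "(c + d) ^ p * ((norm x + norm y) ^ p / (c + d) ^ p)
        \<le> (c + d) ^ p * ((c / (c + d)) * (norm x ^ p / c ^ p) + (d / (c + d)) * (norm y ^ p / d ^ p))"
      using pos by (intro mult_left_mono) auto
    then have "(norm x + norm y) ^ p \<le> r * norm x ^ p + s * norm y ^ p"
      using pos by (simp add: r_def s_def distrib_left)
    then show ?thesis
      by (rule order_trans[OF power_mono[OF norm_triangle_ineq norm_ge_zero]])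
  qed
  have "(\<integral>\<^sup>+\<omega>. ennreal (norm (X \<omega> + Y \<omega>) ^ p) \<partial>M)
      \<le> (\<integral>\<^sup>+\<omega>. ennreal r * ennreal (norm (X \<omega>) ^ p) + ennreal s * ennreal (norm (Y \<omega>) ^ p) \<partial>M)"
  proof (rule nn_integral_mono)
    fix \<omega>
    have "ennreal (norm (X \<omega> + Y \<omega>) ^ p) \<le> ennreal (r * norm (X \<omega>) ^ p + s * norm (Y \<omega>) ^ p)"
      by (rule ennreal_leI[OF conv])
    also have "\<dots> = ennreal r * ennreal (norm (X \<omega>) ^ p) + ennreal s * ennreal (norm (Y \<omega>) ^ p)"
      using rs by (simp add: ennreal_mult)
    finally show "ennreal (norm (X \<omega> + Y \<omega>) ^ p)
        \<le> ennreal r * ennreal (norm (X \<omega>) ^ p) + ennreal s * ennreal (norm (Y \<omega>) ^ p)" .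
  qed
  also have "\<dots> = ennreal r * (\<integral>\<^sup>+\<omega>. ennreal (norm (X \<omega>) ^ p) \<partial>M) + ennreal s * (\<integral>\<^sup>+\<omega>. ennreal (norm (Y \<omega>) ^ p) \<partial>M)"
    by (simp add: nn_integral_add nn_integral_cmult)
  also have "\<dots> \<le> ennreal r * ennreal (c ^ p) + ennreal s * ennreal (d ^ p)"
    using X Y by (intro add_mono mult_left_mono) (auto simp: Lp_le_def)
  also have "\<dots> = ennreal (r * c ^ p + s * d ^ p)"
    using rs pos by (simp add: ennreal_mult ennreal_plus)
  also have "r * c ^ p + s * d ^ p = (c + d) ^ p"
    using pos by (simp add: r_def s_def flip: distrib_left add_divide_distrib)
  finally show ?thesis using pos by (simp add: Lp_le_def)
qed

lemma Lp_le_add: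
  fixes X Y :: "'w \<Rightarrow> 'b::{real_normed_vector, second_countable_topology}"
  assumes X: "Lp_le M p X c" and Y: "Lp_le M p Y d"
  shows "Lp_le M p (\<lambda>\<omega>. X \<omega> + Y \<omega>) (c + d)"
proof (rule Lp_le_eps)
  show "(\<lambda>\<omega>. X \<omega> + Y \<omega>) \<in> borel_measurable M" "0 \<le> c + d"
    using X Y by (auto simp: Lp_le_def)
  fix e :: real assume e: "0 < e"
  have "Lp_le M p X (c + e / 2)" "Lp_le M p Y (d + e / 2)"
    using e by (auto intro: Lp_le_mono[OF X] Lp_le_mono[OF Y])
  from Lp_le_add_pos[OF this] show "Lp_le M p (\<lambda>\<omega>. X \<omega> + Y \<omega>) (c + d + e)"
    using e Lp_le_nonneg[OF X] Lp_le_nonneg[OF Y] by (simp add: add_nonneg_pos algebra_simps)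
qed

lemma Lp_le_sum:
  fixes X :: "'i \<Rightarrow> 'w \<Rightarrow> 'b::{real_normed_vector, second_countable_topology}"
  assumes "p > 0" "\<And>i. i \<in> I \<Longrightarrow> Lp_le M p (X i) (c i)"
  shows "Lp_le M p (\<lambda>\<omega>. \<Sum>i\<in>I. X i \<omega>) (\<Sum>i\<in>I. c i)"
  using assms(2)
  by (induction I rule: infinite_finite_induct) (auto intro!: Lp_le_add Lp_le_zero assms(1))

lemma Lp_le_uminus: "Lp_le M p X c \<Longrightarrow> Lp_le M p (\<lambda>\<omega>. - X \<omega>) c"
  for X :: "'w \<Rightarrow> 'b::{real_normed_vector, second_countable_topology}"
  by (auto simp: Lp_le_def)

lemma Lp_le_diff:
  fixes X Y :: "'w \<Rightarrow> 'b::{real_normed_vector, second_countable_topology}"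
  assumes "Lp_le M p X c" "Lp_le M p Y d"
  shows "Lp_le M p (\<lambda>\<omega>. X \<omega> - Y \<omega>) (c + d)"
  using Lp_le_add[OF assms(1) Lp_le_uminus[OF assms(2)]] by simp

lemma Lp_le_scaleR:
  fixes X :: "'w \<Rightarrow> 'b::{real_normed_vector, second_countable_topology}"
  assumes "Lp_le M p X c" "\<bar>a\<bar> * c \<le> d"
  shows "Lp_le M p (\<lambda>\<omega>. a *\<^sub>R X \<omega>) d"
proof -
  have [measurable]: "X \<in> borel_measurable M"
    using assms by (auto simp: Lp_le_def)
  have "(\<integral>\<^sup>+\<omega>. ennreal (norm (a *\<^sub>R X \<omega>) ^ p) \<partial>M) = ennreal (\<bar>a\<bar> ^ p) * (\<integral>\<^sup>+\<omega>. ennreal (norm (X \<omega>) ^ p) \<partial>M)"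
    by (subst nn_integral_cmult[symmetric]) (auto simp: power_mult_distrib ennreal_mult)
  also have "\<dots> \<le> ennreal (\<bar>a\<bar> ^ p) * ennreal (c ^ p)"
    using assms by (intro mult_left_mono) (auto simp: Lp_le_def)
  also have "\<dots> = ennreal ((\<bar>a\<bar> * c) ^ p)"
    using Lp_le_nonneg[OF assms(1)] by (simp add: power_mult_distrib ennreal_mult)
  finally have "Lp_le M p (\<lambda>\<omega>. a *\<^sub>R X \<omega>) (\<bar>a\<bar> * c)"
    using Lp_le_nonneg[OF assms(1)] by (simp add: Lp_le_def)
  then show ?thesis using assms(2) by (rule Lp_le_mono)
qed

text \<open>The Cauchy--Schwarz inequality, from \<open>2xy \<le> (d/c) x\<^sup>2 + (c/d) y\<^sup>2\<close>.\<close>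

lemma Lp_le_mult:
  fixes X Y :: "'w \<Rightarrow> real"
  assumes X: "Lp_le M (2 * p) X c" and Y: "Lp_le M (2 * p) Y d" and le: "c * d \<le> e"
  shows "Lp_le M p (\<lambda>\<omega>. X \<omega> * Y \<omega>) e"
proof -
  have [measurable]: "X \<in> borel_measurable M" "Y \<in> borel_measurable M"
    using X Y by (auto simp: Lp_le_def)
  have pos: "Lp_le M p (\<lambda>\<omega>. X \<omega> * Y \<omega>) (c * d)"
    if X: "Lp_le M (2 * p) X c" and Y: "Lp_le M (2 * p) Y d" and pos: "0 < c" "0 < d" for c d
  proof -
    define r s where "r = d ^ p / (2 * c ^ p)" and "s = c ^ p / (2 * d ^ p)"
    have rs: "0 \<le> r" "0 \<le> s" using pos by (auto simp: r_def s_def)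
    have amgm: "norm (x * y) ^ p \<le> r * norm x ^ (2 * p) + s * norm y ^ (2 * p)" for x y :: real
    proof -
      define a b where "a = \<bar>x\<bar> ^ p" and "b = \<bar>y\<bar> ^ p"
      have "0 \<le> (d ^ p * a - c ^ p * b)\<^sup>2 / (2 * c ^ p * d ^ p)" using pos by simp
      also have "\<dots> = r * a\<^sup>2 + s * b\<^sup>2 - a * b"
        using pos by (simp add: r_def s_def power2_eq_square field_simps)
      finally show ?thesis
        by (simp add: a_def b_def abs_mult power_mult_distrib power_mult power_even_eq mult.commute)
    qed
    have "(\<integral>\<^sup>+\<omega>. ennreal (norm (X \<omega> * Y \<omega>) ^ p) \<partial>M)
        \<le> (\<integral>\<^sup>+\<omega>. ennreal r * ennreal (norm (X \<omega>) ^ (2 * p)) + ennreal s * ennreal (norm (Y \<omega>) ^ (2 * p)) \<partial>M)"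
    proof (rule nn_integral_mono)
      fix \<omega>
      have "ennreal (norm (X \<omega> * Y \<omega>) ^ p) \<le> ennreal (r * norm (X \<omega>) ^ (2 * p) + s * norm (Y \<omega>) ^ (2 * p))"
        by (rule ennreal_leI[OF amgm])
      also have "\<dots> = ennreal r * ennreal (norm (X \<omega>) ^ (2 * p)) + ennreal s * ennreal (norm (Y \<omega>) ^ (2 * p))"
        using rs by (simp add: ennreal_mult)
      finally show "ennreal (norm (X \<omega> * Y \<omega>) ^ p)
          \<le> ennreal r * ennreal (norm (X \<omega>) ^ (2 * p)) + ennreal s * ennreal (norm (Y \<omega>) ^ (2 * p))" .
    qed
    also have "\<dots> = ennreal r * (\<integral>\<^sup>+\<omega>. ennreal (norm (X \<omega>) ^ (2 * p)) \<partial>M) + ennreal s * (\<integral>\<^sup>+\<omega>. ennreal (norm (Y \<omega>) ^ (2 * p)) \<partial>M)"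
      by (simp add: nn_integral_add nn_integral_cmult)
    also have "\<dots> \<le> ennreal r * ennreal (c ^ (2 * p)) + ennreal s * ennreal (d ^ (2 * p))"
      using X Y by (intro add_mono mult_left_mono) (auto simp: Lp_le_def)
    also have "\<dots> = ennreal (r * c ^ (2 * p) + s * d ^ (2 * p))"
      using rs pos by (simp add: ennreal_mult ennreal_plus)
    also have "r * c ^ (2 * p) + s * d ^ (2 * p) = (c * d) ^ p"
    proof -
      have "r * c ^ (2 * p) = (c * d) ^ p / 2" "s * d ^ (2 * p) = (c * d) ^ p / 2"
        using pos unfolding r_def s_def mult_2 power_add power_mult_distrib by auto
      then show ?thesis by linarith
    qed
    finally show ?thesis using pos by (simp add: Lp_le_def)
  qed
  have cd: "0 \<le> c" "0 \<le> d" using X Y by (auto simp: Lp_le_def)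
  have "Lp_le M p (\<lambda>\<omega>. X \<omega> * Y \<omega>) (c * d)"
  proof (rule Lp_le_eps)
    fix e :: real assume e: "0 < e"
    \<comment> \<open>Since \<open>t \<le> 1\<close>, the excess of \<open>(c + t) * (d + t)\<close>
      over \<open>c * d\<close> is at most \<open>t * (c + d + 1)\<close>, hence at most
      \<open>e\<close>.\<close>
    define t where "t = min 1 (e / (c + d + 1))"
    have t: "0 < t" "t \<le> 1" "t \<le> e / (c + d + 1)"
      using e cd by (auto simp: t_def)
    then have t3: "t * (c + d + 1) \<le> e"
      using cd by (simp add: le_divide_eq)
    have "Lp_le M p (\<lambda>\<omega>. X \<omega> * Y \<omega>) ((c + t) * (d + t))"
      using t cd by (intro pos Lp_le_mono[OF X] Lp_le_mono[OF Y]) auto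
    moreover have "(c + t) * (d + t) \<le> c * d + e"
    proof -
      have "t * t \<le> t * 1" using t by (intro mult_left_mono) auto
      then show ?thesis using t3 by (simp add: algebra_simps)
    qed
    ultimately show "Lp_le M p (\<lambda>\<omega>. X \<omega> * Y \<omega>) (c * d + e)" by (rule Lp_le_mono)
  qed (use cd in auto)
  then show ?thesis using le by (rule Lp_le_mono)
qed

text \<open>Cauchy--Schwarz for a bilinear map of norm at most one. It serves for the inner product
  in Efron--Stein and for the tensor product in the estimator.\<close>

lemma Lp_le_bilinear:
  fixes B :: "'b::{real_normed_vector, second_countable_topology} \<Rightarrow>
      'c::{real_normed_vector, second_countable_topology} \<Rightarrow> 'd::real_normed_vector"
  assumes B: "bounded_bilinear B" and norm_B: "\<And>x y. norm (B x y) \<le> norm x * norm y"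
    and X: "Lp_le M (2 * p) X c" and Y: "Lp_le M (2 * p) Y d" and le: "c * d \<le> e"
  shows "Lp_le M p (\<lambda>\<omega>. B (X \<omega>) (Y \<omega>)) e"
proof -
  have [measurable]: "X \<in> borel_measurable M" "Y \<in> borel_measurable M"
    using X Y by (auto simp: Lp_le_def)
  have cont: "continuous_on UNIV (\<lambda>z. B (fst z) (snd z))"
    by (intro bounded_bilinear.continuous_on[OF B] continuous_intros)
  have meas: "(\<lambda>\<omega>. B (X \<omega>) (Y \<omega>)) \<in> borel_measurable M"
    by (rule borel_measurable_continuous_Pair[OF _ _ cont]) measurable
  show ?thesis
    by (rule Lp_le_dominated[OF Lp_le_mult[OF Lp_le_norm[OF X] Lp_le_norm[OF Y] le] meas])
      (simp add: norm_B)
qed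

section \<open>Comparison of moments, Bochner integrals and image measures\<close>

lemma (in prob_space) Lp_le_const: "0 \<le> c \<Longrightarrow> norm x \<le> c \<Longrightarrow> Lp_le M p (\<lambda>_. x) c"
  by (simp add: Lp_le_def emeasure_space_1 ennreal_leI power_mono)

text \<open>Cauchy--Schwarz against the constant function 1.\<close>

lemma (in prob_space) Lp_le_lower:
  fixes X :: "'a \<Rightarrow> 'c::{real_normed_vector, second_countable_topology}"
  assumes "Lp_le M (2 * p) X c"
  shows "Lp_le M p X c"
proof -
  have "Lp_le M p (\<lambda>\<omega>. norm (X \<omega>) * 1) c"
    by (rule Lp_le_mult[OF Lp_le_norm[OF assms] Lp_le_const[of 1]]) auto
  then show ?thesis
    by (rule Lp_le_dominated) (use assms in \<open>auto simp: Lp_le_def\<close>)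
qed

lemma (in prob_space) Lp_le_2_1:
  "Lp_le M 2 X c \<Longrightarrow> Lp_le M 1 X c" for X :: "'a \<Rightarrow> 'c::{real_normed_vector, second_countable_topology}"
  using Lp_le_lower[of 1] by simp

lemma (in prob_space) Lp_le_4_2:
  "Lp_le M 4 X c \<Longrightarrow> Lp_le M 2 X c" for X :: "'a \<Rightarrow> 'c::{real_normed_vector, second_countable_topology}"
  using Lp_le_lower[of 2] by simp

lemma Lp_le_1_integrable:
  fixes X :: "'w \<Rightarrow> 'b::{banach, second_countable_topology}"
  assumes "Lp_le M 1 X c"
  shows "integrable M X" and "norm (\<integral>\<omega>. X \<omega> \<partial>M) \<le> c" and "(\<integral>\<omega>. norm (X \<omega>) \<partial>M) \<le> c"
proof -
  show i: "integrable M X"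
    using assms by (intro integrableI_bounded) (auto simp: Lp_le_def intro: le_less_trans)
  have "ennreal (\<integral>\<omega>. norm (X \<omega>) \<partial>M) \<le> ennreal c"
    using assms i by (subst nn_integral_eq_integral[symmetric]) (auto simp: Lp_le_def)
  then show *: "(\<integral>\<omega>. norm (X \<omega>) \<partial>M) \<le> c"
    using assms by (simp add: Lp_le_def)
  show "norm (\<integral>\<omega>. X \<omega> \<partial>M) \<le> c"
    by (rule order_trans[OF integral_norm_bound *])
qed

lemma Lp_le_power_integrable:
  fixes X :: "'w \<Rightarrow> 'b::{banach, second_countable_topology}"
  assumes "Lp_le M p X c"
  shows "integrable M (\<lambda>\<omega>. norm (X \<omega>) ^ p)" and "(\<integral>\<omega>. norm (X \<omega>) ^ p \<partial>M) \<le> c ^ p"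
proof -
  have "Lp_le M 1 (\<lambda>\<omega>. norm (X \<omega>) ^ p) (c ^ p)"
    using assms by (auto simp: Lp_le_def)
  from Lp_le_1_integrable[OF this]
  show "integrable M (\<lambda>\<omega>. norm (X \<omega>) ^ p)" "(\<integral>\<omega>. norm (X \<omega>) ^ p \<partial>M) \<le> c ^ p"
    by auto
qed

lemma Lp_leI_integral:
  fixes X :: "'w \<Rightarrow> 'b::{banach, second_countable_topology}"
  assumes "X \<in> borel_measurable M" "integrable M (\<lambda>\<omega>. norm (X \<omega>) ^ p)" "(\<integral>\<omega>. norm (X \<omega>) ^ p \<partial>M) \<le> c ^ p" "0 \<le> c"
  shows "Lp_le M p X c"
  using assms by (simp add: Lp_le_def nn_integral_eq_integral ennreal_leI)

lemma Lp_le_distr: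
  assumes g: "g \<in> M \<rightarrow>\<^sub>M N" and X: "X \<in> borel_measurable N"
  shows "Lp_le (distr M N g) p X c \<longleftrightarrow> Lp_le M p (\<lambda>\<omega>. X (g \<omega>)) c"
  using measurable_compose[OF g X] X g by (auto simp: Lp_le_def nn_integral_distr)

section \<open>Exchanging innovations and the Efron--Stein inequality\<close>

text \<open>
  Coordinate \<open>(i, False)\<close> is the innovation at time \<open>i\<close> and \<open>(i, True)\<close> an independent copy of it.
\<close>

definition innov :: "'s measure \<Rightarrow> (int \<times> bool \<Rightarrow> 's) measure" where
  "innov \<mu> = PiM UNIV (\<lambda>_. \<mu>)"

text \<open>An innovation trades places with its copy instead of being overwritten by it. This makes
  the map an involution that preserves the product measure, so norms and expectations are invariant
  under it.\<close>

definition swap :: "int set \<Rightarrow> (int \<times> bool \<Rightarrow> 's) \<Rightarrow> int \<times> bool \<Rightarrow> 's" where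
  "swap A \<omega> = (\<lambda>(i, c). \<omega> (i, c \<noteq> (i \<in> A)))"

lemma swap_apply: "swap A \<omega> (i, c) = \<omega> (i, c \<noteq> (i \<in> A))"
  by (simp add: swap_def)

lemma swap_empty [simp]: "swap {} \<omega> = \<omega>"
  by (auto simp: swap_def fun_eq_iff)

text \<open>Exchanges compose by symmetric difference of their index sets; these are the three
  instances for nested sets that the Efron--Stein chain requires.\<close>

lemma swap_Diff: "A \<subseteq> B \<Longrightarrow> swap A (swap (B - A) \<omega>) = swap B \<omega>"
  and swap_Diff_larger: "A \<subseteq> B \<Longrightarrow> swap B (swap (B - A) \<omega>) = swap A \<omega>"
  and swap_Diff_smaller: "A \<subseteq> B \<Longrightarrow> swap (B - A) (swap A \<omega>) = swap B \<omega>"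
  by (auto simp: swap_def fun_eq_iff subset_iff intro!: arg_cong[of _ _ \<omega>])

section \<open>Invariance under exchanges and independence of the two fibres\<close>

context prob_space
begin

lemma prob_space_innov: "prob_space (innov M)"
  unfolding innov_def by (intro prob_space_PiM prob_space_axioms)

lemma measurable_reindex:
  "(\<lambda>\<omega> n. \<omega> (\<phi> n)) \<in> PiM UNIV (\<lambda>_. M) \<rightarrow>\<^sub>M PiM UNIV (\<lambda>_. M)"
  by (rule measurable_PiM_single') (auto simp: space_PiM)

lemma distr_reindex:
  assumes "inj \<phi>"
  shows "distr (PiM UNIV (\<lambda>_. M)) (PiM UNIV (\<lambda>_. M)) (\<lambda>\<omega> n. \<omega> (\<phi> n)) = PiM UNIV (\<lambda>_. M)"
  using distr_PiM_reindex[of UNIV "\<lambda>_. M" \<phi> UNIV] assms prob_space_axioms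
  by (simp add: restrict_UNIV)

lemma measurable_swap: "swap A \<in> innov M \<rightarrow>\<^sub>M innov M"
  and distr_swap: "distr (innov M) (innov M) (swap A) = innov M"
proof -
  have eq: "swap A = (\<lambda>\<omega> n. \<omega> (fst n, snd n \<noteq> (fst n \<in> A)))" for A
    by (auto simp: swap_def fun_eq_iff)
  have "inj (\<lambda>n :: int \<times> bool. (fst n, snd n \<noteq> (fst n \<in> A)))"
    by (auto simp: inj_def)
  then show "swap A \<in> innov M \<rightarrow>\<^sub>M innov M" "distr (innov M) (innov M) (swap A) = innov M"
    unfolding innov_def eq by (auto intro: measurable_reindex distr_reindex)
qed

lemma Lp_le_swap:
  assumes "Lp_le (innov M) p X c"
  shows "Lp_le (innov M) p (\<lambda>\<omega>. X (swap A \<omega>)) c"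
  using assms Lp_le_distr[OF measurable_swap Lp_le_measurable[OF assms], where c=c and p=p]
  by (simp add: distr_swap)

lemma integral_swap:
  fixes X :: "_ \<Rightarrow> 'c::{banach, second_countable_topology}"
  assumes "X \<in> borel_measurable (innov M)"
  shows "(\<integral>\<omega>. X (swap A \<omega>) \<partial>innov M) = (\<integral>\<omega>. X \<omega> \<partial>innov M)"
  using integral_distr[OF measurable_swap assms, of A] by (simp add: distr_swap)

lemma measurable_fibre: "(\<lambda>\<omega> i. \<omega> (i, c)) \<in> innov M \<rightarrow>\<^sub>M PiM UNIV (\<lambda>_. M)"
  and distr_fibre: "distr (innov M) (PiM UNIV (\<lambda>_. M)) (\<lambda>\<omega> i. \<omega> (i, c)) = PiM UNIV (\<lambda>_. M)"
  unfolding innov_def by (auto intro: measurable_reindex distr_reindex simp: inj_def)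

text \<open>The coordinates of a product measure are independent, so the families over the disjoint
  index sets with flag \<open>False\<close> and with flag \<open>True\<close> are independent as
  well, and each is again a product by reindexing.\<close>

lemma distr_fibres:
  "distr (innov M) (PiM UNIV (\<lambda>_. M) \<Otimes>\<^sub>M PiM UNIV (\<lambda>_. M)) (\<lambda>\<omega>. (\<lambda>i. \<omega> (i, False), \<lambda>i. \<omega> (i, True)))
   = PiM UNIV (\<lambda>_. M) \<Otimes>\<^sub>M PiM UNIV (\<lambda>_. M)"
proof -
  interpret R: prob_space "innov M" by (rule prob_space_innov)
  have "R.indep_vars (\<lambda>_. M) (\<lambda>i \<omega>. \<omega> i) UNIV"
  proof (subst R.indep_vars_iff_distr_eq_PiM)
    show "(\<lambda>\<omega>. \<omega> i) \<in> innov M \<rightarrow>\<^sub>M M" for i :: "int \<times> bool"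
      unfolding innov_def by simp
    have "distr (PiM UNIV (\<lambda>_. M)) M (\<lambda>\<omega>. \<omega> i) = M" for i :: "int \<times> bool"
      by (rule distr_PiM_component) (simp_all add: prob_space_axioms)
    then show "distr (innov M) (PiM UNIV (\<lambda>_. M)) (\<lambda>x. \<lambda>i\<in>UNIV. x i) =
        PiM UNIV (\<lambda>i. distr (innov M) M (\<lambda>\<omega>. \<omega> i))"
      unfolding innov_def by (simp add: restrict_UNIV distr_id)
  qed simp
  then have ind: "R.indep_var (PiM (UNIV \<times> {False}) (\<lambda>_. M)) (\<lambda>\<omega>. restrict (\<lambda>i. \<omega> i) (UNIV \<times> {False}))
      (PiM (UNIV \<times> {True}) (\<lambda>_. M)) (\<lambda>\<omega>. restrict (\<lambda>i. \<omega> i) (UNIV \<times> {True}))"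
    by (rule R.indep_var_restrict) auto
  have meas: "(\<lambda>z i. z (i, c)) \<in> PiM (UNIV \<times> {c}) (\<lambda>_. M) \<rightarrow>\<^sub>M PiM (UNIV :: int set) (\<lambda>_. M)" for c :: bool
    by (rule measurable_PiM_single') (auto simp: space_PiM PiE_iff)
  have "R.indep_var (PiM UNIV (\<lambda>_. M)) ((\<lambda>z i. z (i, False)) \<circ> (\<lambda>\<omega>. restrict (\<lambda>i. \<omega> i) (UNIV \<times> {False})))
      (PiM UNIV (\<lambda>_. M)) ((\<lambda>z i. z (i, True)) \<circ> (\<lambda>\<omega>. restrict (\<lambda>i. \<omega> i) (UNIV \<times> {True})))"
    by (rule R.indep_var_compose[OF ind meas meas])
  then have "R.indep_var (PiM UNIV (\<lambda>_. M)) (\<lambda>\<omega> i. \<omega> (i, False)) (PiM UNIV (\<lambda>_. M)) (\<lambda>\<omega> i. \<omega> (i, True))"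
    by (simp add: comp_def)
  then show ?thesis
    unfolding R.indep_var_distribution_eq by (simp add: distr_fibre)
qed

text \<open>By Fubini a bilinear expression in independent arguments has expectation
  \<open>B\<close> of the expectations. With the inner product it identifies the last term of the
  Efron--Stein chain; with a general \<open>B\<close> it makes decoupled covariances vanish.\<close>

lemma integral_bilinear_fibres:
  fixes B :: "'b::{banach, second_countable_topology} \<Rightarrow> 'c::{banach, second_countable_topology} \<Rightarrow>
      'd::{banach, second_countable_topology}"
  assumes B: "bounded_bilinear B"
    and F: "integrable (PiM UNIV (\<lambda>_. M)) F" and G: "integrable (PiM UNIV (\<lambda>_. M)) G"
  shows "integrable (innov M) (\<lambda>\<omega>. B (F (\<lambda>i. \<omega> (i, False))) (G (\<lambda>i. \<omega> (i, True))))"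
    and "(\<integral>\<omega>. B (F (\<lambda>i. \<omega> (i, False))) (G (\<lambda>i. \<omega> (i, True))) \<partial>innov M) =
      B (\<integral>x. F x \<partial>PiM UNIV (\<lambda>_. M)) (\<integral>x. G x \<partial>PiM UNIV (\<lambda>_. M))"
proof -
  let ?Q = "PiM (UNIV :: int set) (\<lambda>_. M)"
  interpret B: bounded_bilinear B by (rule B)
  interpret Q: prob_space ?Q by (intro prob_space_PiM prob_space_axioms)
  interpret QQ: pair_prob_space ?Q ?Q ..
  have [measurable]: "F \<in> borel_measurable ?Q" "G \<in> borel_measurable ?Q"
    using F G by auto
  have cont: "continuous_on UNIV (\<lambda>z. B (fst z) (snd z))"
    by (intro B.continuous_on continuous_intros)
  have meas [measurable]: "(\<lambda>z. B (F (fst z)) (G (snd z))) \<in> borel_measurable (?Q \<Otimes>\<^sub>M ?Q)"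
    by (rule borel_measurable_continuous_Pair[OF _ _ cont]) measurable
  obtain K where K: "0 \<le> K" "\<And>a b. norm (B a b) \<le> norm a * norm b * K"
    using B.nonneg_bounded by blast
  have "integrable (?Q \<Otimes>\<^sub>M ?Q) (\<lambda>z. norm (F (fst z)) * norm (G (snd z)) * K)"
  proof (intro integrable_mult_left QQ.Fubini_integrable)
    show "AE x in ?Q. integrable ?Q (\<lambda>y. norm (F (fst (x, y))) * norm (G (snd (x, y))))"
      using G by auto
    show "integrable ?Q (\<lambda>x. \<integral>y. norm (norm (F (fst (x, y))) * norm (G (snd (x, y)))) \<partial>?Q)"
      using F by simp
  qed measurable
  then have int: "integrable (?Q \<Otimes>\<^sub>M ?Q) (\<lambda>z. B (F (fst z)) (G (snd z)))"
    by (rule Bochner_Integration.integrable_bound) (auto intro!: order_trans[OF K(2)] simp: K(1))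
  have split: "(\<lambda>\<omega>. (\<lambda>i. \<omega> (i, False), \<lambda>i. \<omega> (i, True))) \<in> innov M \<rightarrow>\<^sub>M ?Q \<Otimes>\<^sub>M ?Q"
    by (intro measurable_Pair measurable_fibre)
  show "integrable (innov M) (\<lambda>\<omega>. B (F (\<lambda>i. \<omega> (i, False))) (G (\<lambda>i. \<omega> (i, True))))"
    using integrable_distr_eq[OF split meas] int by (simp add: distr_fibres)
  have "(\<integral>\<omega>. B (F (\<lambda>i. \<omega> (i, False))) (G (\<lambda>i. \<omega> (i, True))) \<partial>innov M)
      = (\<integral>z. B (F (fst z)) (G (snd z)) \<partial>(?Q \<Otimes>\<^sub>M ?Q))"
    using integral_distr[OF split meas] by (simp add: distr_fibres)
  also have "\<dots> = (\<integral>x. \<integral>y. B (F x) (G y) \<partial>?Q \<partial>?Q)"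
    using QQ.integral_fst'[OF int] by simp
  also have "\<dots> = (\<integral>x. B (F x) (\<integral>y. G y \<partial>?Q) \<partial>?Q)"
    by (intro Bochner_Integration.integral_cong integral_bounded_linear B.bounded_linear_right G refl)
  also have "\<dots> = B (\<integral>x. F x \<partial>?Q) (\<integral>y. G y \<partial>?Q)"
    by (intro integral_bounded_linear[OF B.bounded_linear_left F])
  finally show "(\<integral>\<omega>. B (F (\<lambda>i. \<omega> (i, False))) (G (\<lambda>i. \<omega> (i, True))) \<partial>innov M) =
      B (\<integral>x. F x \<partial>?Q) (\<integral>x. G x \<partial>?Q)" .
qed

lemma integral_fibre:
  fixes \<Phi> :: "_ \<Rightarrow> 'c::{banach, second_countable_topology}"
  assumes "\<Phi> \<in> borel_measurable (PiM UNIV (\<lambda>_. M))"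
  shows "(\<integral>\<omega>. \<Phi> (\<lambda>i. \<omega> (i, c)) \<partial>innov M) = (\<integral>x. \<Phi> x \<partial>PiM UNIV (\<lambda>_. M))"
  using integral_distr[OF measurable_fibre assms, of c] by (simp add: distr_fibre)

text \<open>
  The Efron--Stein inequality: along the chain \<open>A 0 \<subseteq> A 1 \<subseteq> \<dots>\<close> of coordinate sets the covariance of
  \<open>F\<close> with \<open>F \<circ> swap (A k)\<close> descends from \<open>E \<parallel>F\<parallel>\<^sup>2\<close> to \<open>\<parallel>E F\<parallel>\<^sup>2\<close>, and each decrement is symmetrised by
  applying \<open>swap (A (Suc k) - A k)\<close>.
\<close>

lemma efron_stein:
  fixes \<Phi> :: "(int \<Rightarrow> 'a) \<Rightarrow> 'k::{real_inner, banach, second_countable_topology}"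
  defines "F \<equiv> \<lambda>\<omega>. \<Phi> (\<lambda>i. \<omega> (i, False))"
  assumes \<Phi>: "Lp_le (innov M) 2 F c" "\<Phi> \<in> borel_measurable (PiM UNIV (\<lambda>_. M))"
    and A: "A 0 = {}" "\<And>k. A k \<subseteq> A (Suc k)" "\<And>\<omega>. F (swap (A n) \<omega>) = F (swap UNIV \<omega>)"
    and d: "\<And>k. k < n \<Longrightarrow> Lp_le (innov M) 2 (\<lambda>\<omega>. F \<omega> - F (swap (A (Suc k) - A k) \<omega>)) (d k)"
  shows "Lp_le (innov M) 2 (\<lambda>\<omega>. F \<omega> - (\<integral>\<omega>. F \<omega> \<partial>innov M)) (sqrt (\<Sum>k<n. (d k)\<^sup>2))"
proof -
  interpret R: prob_space "innov M" by (rule prob_space_innov)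
  let ?R = "innov M"
  define G where "G k \<omega> = F (swap (A k) \<omega>)" for k \<omega>
  define e where "e k = (\<integral>\<omega>. F \<omega> \<bullet> G k \<omega> \<partial>?R)" for k
  have Fm [measurable]: "F \<in> borel_measurable ?R" using \<Phi>(1) by (rule Lp_le_measurable)
  have FL: "Lp_le ?R 2 (\<lambda>\<omega>. F (swap B \<omega>)) c" for B by (rule Lp_le_swap[OF \<Phi>(1)])
  have GL: "Lp_le ?R 2 (G k) c" for k unfolding G_def by (rule FL)
  have inner: "Lp_le ?R 1 (\<lambda>\<omega>. X \<omega> \<bullet> Y \<omega>) (a * b)" if "Lp_le ?R 2 X a" "Lp_le ?R 2 Y b" for X Y :: "_ \<Rightarrow> 'k" and a b
    by (rule Lp_le_bilinear[OF bounded_bilinear_inner, where c=a and d=b]) (use that in \<open>auto simp: Cauchy_Schwarz_ineq2\<close>)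
  have int: "integrable ?R (\<lambda>\<omega>. X \<omega> \<bullet> Y \<omega>)" if "Lp_le ?R 2 X a" "Lp_le ?R 2 Y b" for X Y :: "_ \<Rightarrow> 'k" and a b
    by (rule Lp_le_1_integrable(1)[OF inner[OF that]])
  have F1: "integrable ?R F" by (rule Lp_le_1_integrable(1)[OF R.Lp_le_2_1[OF \<Phi>(1)]])
  have \<Phi>1: "integrable (PiM UNIV (\<lambda>_. M)) \<Phi>"
    using F1 integrable_distr_eq[OF measurable_fibre \<Phi>(2), of False] by (simp add: F_def distr_fibre)
  have e0: "e 0 = (\<integral>\<omega>. (norm (F \<omega>))\<^sup>2 \<partial>?R)"
    by (simp add: e_def G_def A(1) power2_norm_eq_inner)
  \<comment> \<open>After the last exchange the second factor reads only the copies, so the two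
    factors live on different fibres and the expectation factorises.\<close>
  have "e n = (\<integral>\<omega>. \<Phi> (\<lambda>i. \<omega> (i, False)) \<bullet> \<Phi> (\<lambda>i. \<omega> (i, True)) \<partial>?R)"
    by (simp add: e_def G_def A(3)) (simp add: F_def swap_apply)
  also have "\<dots> = (\<integral>x. \<Phi> x \<partial>PiM UNIV (\<lambda>_. M)) \<bullet> (\<integral>x. \<Phi> x \<partial>PiM UNIV (\<lambda>_. M))"
    by (rule integral_bilinear_fibres(2)[OF bounded_bilinear_inner \<Phi>1 \<Phi>1])
  also have "(\<integral>x. \<Phi> x \<partial>PiM UNIV (\<lambda>_. M)) = (\<integral>\<omega>. F \<omega> \<partial>?R)"
    unfolding F_def by (rule integral_fibre[OF \<Phi>(2), symmetric])
  finally have en: "e n = (norm (\<integral>\<omega>. F \<omega> \<partial>?R))\<^sup>2"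
    by (simp add: power2_norm_eq_inner)
  have step: "e k - e (Suc k) \<le> (d k)\<^sup>2" if "k < n" for k
  proof -
    define s :: "(int \<times> bool \<Rightarrow> 'a) \<Rightarrow> _" where "s = swap (A (Suc k) - A k)"
    have Gs: "G k (s \<omega>) = G (Suc k) \<omega>" "G (Suc k) (s \<omega>) = G k \<omega>" for \<omega>
      using A(2)[of k] by (simp_all add: G_def s_def swap_Diff swap_Diff_larger)
    have sL: "Lp_le ?R 2 (\<lambda>\<omega>. F (s \<omega>)) c" unfolding s_def by (rule FL)
    have [measurable]: "G k \<in> borel_measurable ?R" for k using GL by (rule Lp_le_measurable)
    have es: "e l = (\<integral>\<omega>. F (s \<omega>) \<bullet> G l (s \<omega>) \<partial>?R)" for l
      unfolding e_def s_def by (rule integral_swap[symmetric]) measurable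
    have "e k = (\<integral>\<omega>. F (s \<omega>) \<bullet> G (Suc k) \<omega> \<partial>?R)" "e (Suc k) = (\<integral>\<omega>. F (s \<omega>) \<bullet> G k \<omega> \<partial>?R)"
      unfolding es Gs by (rule refl)+
    \<comment> \<open>Each of \<open>e k\<close> and \<open>e (Suc k)\<close> is written twice,
      before and after \<open>s\<close>. As \<open>s\<close> interchanges \<open>G k\<close> and
      \<open>G (Suc k)\<close>, the sum of both versions is the expectation of a product of two
      increments.\<close>
    then have "2 * (e k - e (Suc k)) = (\<integral>\<omega>. F \<omega> \<bullet> G k \<omega> \<partial>?R) - (\<integral>\<omega>. F \<omega> \<bullet> G (Suc k) \<omega> \<partial>?R)
        + (\<integral>\<omega>. F (s \<omega>) \<bullet> G (Suc k) \<omega> \<partial>?R) - (\<integral>\<omega>. F (s \<omega>) \<bullet> G k \<omega> \<partial>?R)"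
      by (simp add: e_def)
    also have "\<dots> = (\<integral>\<omega>. (F \<omega> - F (s \<omega>)) \<bullet> (G k \<omega> - G (Suc k) \<omega>) \<partial>?R)"
      by (simp add: inner_diff_left inner_diff_right int[OF \<Phi>(1) GL] int[OF sL GL])
    also have "\<dots> \<le> norm \<dots>" by simp
    also have "\<dots> \<le> d k * d k"
    proof (rule Lp_le_1_integrable(2), rule inner)
      show "Lp_le ?R 2 (\<lambda>\<omega>. F \<omega> - F (s \<omega>)) (d k)" unfolding s_def by (rule d[OF that])
      \<comment> \<open>The second increment is the first one composed with
        \<open>swap (A k)\<close>, so it has the same norm.\<close>
      from Lp_le_swap[OF this, of "A k"]
      show "Lp_le ?R 2 (\<lambda>\<omega>. G k \<omega> - G (Suc k) \<omega>) (d k)"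
        using A(2)[of k] by (simp add: G_def s_def swap_Diff_smaller)
    qed
    finally have "2 * (e k - e (Suc k)) \<le> (d k)\<^sup>2" by (simp add: power2_eq_square)
    \<comment> \<open>The factor 1/2 of the classical inequality is given away here.\<close>
    then have "e k - e (Suc k) \<le> (d k)\<^sup>2 / 2" by simp
    also have "\<dots> \<le> (d k)\<^sup>2" by simp
    finally show ?thesis .
  qed
  let ?m = "\<integral>\<omega>. F \<omega> \<partial>?R"
  have "e 0 - e n = (\<Sum>k<n. e k - e (Suc k))"
    by (simp add: sum_lessThan_telescope')
  also have "\<dots> \<le> (\<Sum>k<n. (d k)\<^sup>2)"
    by (intro sum_mono step) simp
  finally have var: "(\<integral>\<omega>. (norm (F \<omega>))\<^sup>2 \<partial>?R) - (norm ?m)\<^sup>2 \<le> (\<Sum>k<n. (d k)\<^sup>2)"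
    by (simp add: e0 en)
  have DL: "Lp_le ?R 2 (\<lambda>\<omega>. F \<omega> - ?m) (c + norm ?m)"
    by (intro Lp_le_diff \<Phi>(1) R.Lp_le_const) auto
  have "(\<integral>\<omega>. (norm (F \<omega> - ?m))\<^sup>2 \<partial>?R) = (\<integral>\<omega>. F \<omega> \<bullet> F \<omega> - 2 * (F \<omega> \<bullet> ?m) + ?m \<bullet> ?m \<partial>?R)"
    by (intro Bochner_Integration.integral_cong refl) (simp add: power2_norm_eq_inner algebra_simps inner_commute)
  also have "\<dots> = (\<integral>\<omega>. F \<omega> \<bullet> F \<omega> \<partial>?R) - 2 * (?m \<bullet> ?m) + ?m \<bullet> ?m"
    using F1 by (simp add: int[OF \<Phi>(1) \<Phi>(1)] R.prob_space)
  finally have "(\<integral>\<omega>. (norm (F \<omega> - ?m))\<^sup>2 \<partial>?R) \<le> (\<Sum>k<n. (d k)\<^sup>2)"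
    using var by (simp add: power2_norm_eq_inner)
  then show ?thesis
    using Lp_le_power_integrable(1)[OF DL] by (intro Lp_leI_integral) (auto simp: sum_nonneg)
qed

end

section \<open>Linear and quadratic forms of causal processes\<close>

text \<open>Schur's test: a nonnegative matrix with row and column sums at most \<open>c\<close> has
  norm at most \<open>c\<close> on l^2. Each entry is split into two square roots; Cauchy--Schwarz
  then uses the column sums, and the interchanged double sum uses the row sums.\<close>

lemma schur_test:
  fixes D :: "'i \<Rightarrow> 'j \<Rightarrow> real" and a :: "'i \<Rightarrow> real"
  assumes "finite I" "finite J" and nonneg: "\<And>i j. i \<in> I \<Longrightarrow> j \<in> J \<Longrightarrow> 0 \<le> D i j"
    and row: "\<And>i. i \<in> I \<Longrightarrow> (\<Sum>j\<in>J. D i j) \<le> c" and col: "\<And>j. j \<in> J \<Longrightarrow> (\<Sum>i\<in>I. D i j) \<le> c" and "0 \<le> c"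
  shows "(\<Sum>j\<in>J. (\<Sum>i\<in>I. \<bar>a i\<bar> * D i j)\<^sup>2) \<le> c\<^sup>2 * (\<Sum>i\<in>I. (a i)\<^sup>2)"
proof -
  have "(\<Sum>i\<in>I. \<bar>a i\<bar> * D i j)\<^sup>2 \<le> c * (\<Sum>i\<in>I. (a i)\<^sup>2 * D i j)" if j: "j \<in> J" for j
  proof -
    have "(\<Sum>i\<in>I. \<bar>a i\<bar> * D i j) = (\<Sum>i\<in>I. (\<bar>a i\<bar> * sqrt (D i j)) * sqrt (D i j))"
      using nonneg[OF _ j] by (intro sum.cong refl) (simp add: mult.assoc)
    then have "(\<Sum>i\<in>I. \<bar>a i\<bar> * D i j)\<^sup>2 \<le> (\<Sum>i\<in>I. (\<bar>a i\<bar> * sqrt (D i j))\<^sup>2) * (\<Sum>i\<in>I. (sqrt (D i j))\<^sup>2)"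
      using Cauchy_Schwarz_ineq_sum[of "\<lambda>i. \<bar>a i\<bar> * sqrt (D i j)" "\<lambda>i. sqrt (D i j)" I] by simp
    also have "\<dots> = (\<Sum>i\<in>I. (a i)\<^sup>2 * D i j) * (\<Sum>i\<in>I. D i j)"
      using nonneg[OF _ j] by (simp add: power_mult_distrib)
    also have "\<dots> \<le> (\<Sum>i\<in>I. (a i)\<^sup>2 * D i j) * c"
      using nonneg[OF _ j] by (intro mult_left_mono col j sum_nonneg) auto
    finally show ?thesis by (simp add: mult.commute)
  qed
  then have "(\<Sum>j\<in>J. (\<Sum>i\<in>I. \<bar>a i\<bar> * D i j)\<^sup>2) \<le> (\<Sum>j\<in>J. c * (\<Sum>i\<in>I. (a i)\<^sup>2 * D i j))"
    by (rule sum_mono)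
  also have "\<dots> = c * (\<Sum>i\<in>I. (a i)\<^sup>2 * (\<Sum>j\<in>J. D i j))"
    unfolding sum_distrib_left by (subst sum.swap) (rule refl)
  also have "\<dots> \<le> c * (\<Sum>i\<in>I. (a i)\<^sup>2 * c)"
    using \<open>0 \<le> c\<close> by (intro mult_left_mono sum_mono row) auto
  also have "\<dots> = c\<^sup>2 * (\<Sum>i\<in>I. (a i)\<^sup>2)"
    by (simp add: sum_distrib_left power2_eq_square mult_ac)
  finally show ?thesis .
qed

text \<open>The canonical model. In \<open>coupling_0\<close> the argument number \<open>k\<close>
  of \<open>f\<close> is the innovation at time \<open>-k\<close>, replaced by its copy from lag
  \<open>m\<close> on, so \<open>\<theta> m\<close> bounds the coupling error of the m-approximation
  at time 0. The other times follow by shift invariance.\<close>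

locale causal_process = prob_space \<mu> for \<mu> :: "'s measure" +
  fixes f :: "(nat \<Rightarrow> 's) \<Rightarrow> 'h::{real_inner, banach, second_countable_topology}"
    and \<theta> :: "nat \<Rightarrow> real" and \<kappa> :: real
  assumes f_measurable [measurable]: "f \<in> borel_measurable (PiM UNIV (\<lambda>_. \<mu>))"
    and f_L4: "Lp_le (PiM UNIV (\<lambda>_. \<mu>)) 4 f \<kappa>"
    and centred: "(\<integral>x. f x \<partial>PiM UNIV (\<lambda>_. \<mu>)) = 0"
    and coupling_0: "\<And>m. Lp_le (innov \<mu>) 4
        (\<lambda>\<omega>. f (\<lambda>k. \<omega> (- int k, False)) - f (\<lambda>k. \<omega> (- int k, m \<le> k))) (\<theta> m)"
    and summable_\<theta>: "summable \<theta>"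
begin

definition Y :: "int \<Rightarrow> (int \<times> bool \<Rightarrow> 's) \<Rightarrow> 'h" where
  "Y t \<omega> = f (\<lambda>k. \<omega> (t - int k, False))"

text \<open>The factor 2 is due to the two couplings that the exchange of one block costs.\<close>

definition \<Delta> :: real where
  "\<Delta> = 2 * suminf \<theta>"

text \<open>The L^4 effect on \<open>Y\<close> at time \<open>t\<close> of exchanging block
  \<open>k\<close>, that is \<open>A (Suc k) - A k\<close>; a block after time \<open>t\<close> has
  no effect.\<close>

definition \<delta> :: "nat \<Rightarrow> nat \<Rightarrow> real" where
  "\<delta> t k = (if k \<le> t then \<theta> (t - k) + \<theta> (Suc (t - k)) else 0)"

text \<open>Block 0 is the entire past up to time 0, block \<open>k > 0\<close> the single time
  \<open>k\<close>. The case distinction makes the chain start at the empty set, as Efron--Stein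
  demands, and the past is exchanged in one step.\<close>

definition A :: "nat \<Rightarrow> int set" where
  "A k = (if k = 0 then {} else {..<int k})"

lemma \<theta>_nonneg: "0 \<le> \<theta> m"
  using coupling_0 by (rule Lp_le_nonneg)

lemma \<Delta>_nonneg: "0 \<le> \<Delta>"
  unfolding \<Delta>_def using \<theta>_nonneg summable_\<theta> by (simp add: suminf_nonneg)

lemma \<delta>_nonneg: "0 \<le> \<delta> t k"
  by (simp add: \<delta>_def \<theta>_nonneg)

sublocale R: prob_space "innov \<mu>"
  by (rule prob_space_innov)

lemma reindex_integral:
  fixes X :: "('i \<Rightarrow> 's) \<Rightarrow> 'c::{banach, second_countable_topology}"
  assumes "inj \<phi>" "X \<in> borel_measurable (PiM UNIV (\<lambda>_. \<mu>))"
  shows "(\<integral>\<omega>. X (\<lambda>n. \<omega> (\<phi> n)) \<partial>PiM UNIV (\<lambda>_. \<mu>)) = (\<integral>\<omega>. X \<omega> \<partial>PiM UNIV (\<lambda>_. \<mu>))"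
  using integral_distr[OF measurable_reindex assms(2), of \<phi>] distr_reindex[OF assms(1)] by simp

lemma Lp_le_reindex:
  assumes "Lp_le (PiM UNIV (\<lambda>_. \<mu>)) p X c" "inj \<phi>"
  shows "Lp_le (PiM UNIV (\<lambda>_. \<mu>)) p (\<lambda>\<omega>. X (\<lambda>n. \<omega> (\<phi> n))) c"
  using assms(1) Lp_le_distr[OF measurable_reindex Lp_le_measurable[OF assms(1)], of \<phi> p c]
    distr_reindex[OF assms(2)] by simp

lemma Y_L4: "Lp_le (innov \<mu>) 4 (Y t) \<kappa>"
  unfolding innov_def Y_def by (rule Lp_le_reindex[OF f_L4]) (auto simp: inj_def)

lemma Y_measurable [measurable]: "Y t \<in> borel_measurable (innov \<mu>)"
  using Y_L4 by (rule Lp_le_measurable)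

lemma Y_centred: "(\<integral>\<omega>. Y t \<omega> \<partial>innov \<mu>) = 0"
  unfolding innov_def Y_def by (subst reindex_integral) (auto simp: inj_def centred)

text \<open>The time shift reindexes the product measure injectively and therefore preserves it,
  which carries the bound from time 0 to time \<open>t\<close>.\<close>

lemma coupling:
  "Lp_le (innov \<mu>) 4 (\<lambda>\<omega>. Y t \<omega> - Y t (swap {..t - int m} \<omega>)) (\<theta> m)"
proof -
  have "Lp_le (innov \<mu>) 4
      (\<lambda>\<omega>. (\<lambda>\<omega>. f (\<lambda>k. \<omega> (- int k, False)) - f (\<lambda>k. \<omega> (- int k, m \<le> k))) (\<lambda>n. \<omega> (fst n + t, snd n))) (\<theta> m)"
    unfolding innov_def
    by (rule Lp_le_reindex[OF coupling_0[unfolded innov_def]]) (auto simp: inj_def)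
  then show ?thesis by (simp add: Y_def swap_apply)
qed

text \<open>From the increment of \<open>F\<close> along \<open>D\<close> subtract the increment
  along \<open>C\<close> evaluated at \<open>swap (D - C) \<omega>\<close>. The terms with
  \<open>swap D\<close> cancel, and the shift of the argument does not alter the norm.\<close>

lemma Lp_le_swap_Diff:
  fixes F :: "(int \<times> bool \<Rightarrow> 's) \<Rightarrow> 'c::{real_normed_vector, second_countable_topology}"
  assumes "C \<subseteq> D" "Lp_le (innov \<mu>) p (\<lambda>\<omega>. F \<omega> - F (swap D \<omega>)) d"
    and "Lp_le (innov \<mu>) p (\<lambda>\<omega>. F \<omega> - F (swap C \<omega>)) c"
  shows "Lp_le (innov \<mu>) p (\<lambda>\<omega>. F \<omega> - F (swap (D - C) \<omega>)) (d + c)"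
  using Lp_le_diff[OF assms(2) Lp_le_swap[OF assms(3), of "D - C"]] assms(1)
  by (simp add: swap_Diff)

text \<open>Exchanging block \<open>k\<close> means exchanging everything up to time
  \<open>k\<close> and undoing it up to time \<open>k - 1\<close>. These are couplings at the
  adjacent lags \<open>t - k\<close> and \<open>Suc (t - k)\<close>, which is how summability passes
  from remote pasts to single innovations.\<close>

lemma block_coupling:
  assumes "1 \<le> t"
  shows "Lp_le (innov \<mu>) 4 (\<lambda>\<omega>. Y (int t) \<omega> - Y (int t) (swap (A (Suc k) - A k) \<omega>)) (\<delta> t k)"
proof (cases "k \<le> t")
  case False
  then have "Y (int t) (swap (A (Suc k) - A k) \<omega>) = Y (int t) \<omega>" for \<omega>
    unfolding Y_def by (intro arg_cong[of _ _ f]) (auto simp: swap_apply A_def)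
  then show ?thesis using False by (simp add: \<delta>_def Lp_le_zero)
next
  case True
  have eq: "A (Suc j) = {..int t - int (t - j)}" if "j \<le> t" for j
    using that by (auto simp: A_def of_nat_diff)
  have D: "Lp_le (innov \<mu>) 4 (\<lambda>\<omega>. Y (int t) \<omega> - Y (int t) (swap (A (Suc k)) \<omega>)) (\<theta> (t - k))"
    unfolding eq[OF True] by (rule coupling)
  have C: "Lp_le (innov \<mu>) 4 (\<lambda>\<omega>. Y (int t) \<omega> - Y (int t) (swap (A k) \<omega>)) (\<theta> (Suc (t - k)))"
  proof (cases k)
    case 0
    then show ?thesis by (simp add: A_def Lp_le_zero \<theta>_nonneg)
  next
    case (Suc j)
    then have "j \<le> t" "Suc (t - k) = t - j" using True by auto
    then show ?thesis unfolding Suc eq[OF \<open>j \<le> t\<close>] using coupling by metis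
  qed
  have "A k \<subseteq> A (Suc k)" by (auto simp: A_def)
  from Lp_le_swap_Diff[OF this D C] show ?thesis using True by (simp add: \<delta>_def)
qed

lemma sum_\<theta>_le:
  assumes "finite K" "inj_on g K"
  shows "(\<Sum>k\<in>K. \<theta> (g k) + \<theta> (Suc (g k))) \<le> \<Delta>"
proof -
  have "(\<Sum>k\<in>K. \<theta> (g k)) = (\<Sum>n\<in>g ` K. \<theta> n)" "(\<Sum>k\<in>K. \<theta> (Suc (g k))) = (\<Sum>n\<in>Suc ` g ` K. \<theta> n)"
    using assms by (simp_all add: sum.reindex)
  moreover have "(\<Sum>n\<in>g ` K. \<theta> n) \<le> suminf \<theta>" "(\<Sum>n\<in>Suc ` g ` K. \<theta> n) \<le> suminf \<theta>"
    using assms(1) by (auto intro!: sum_le_suminf[OF summable_\<theta>] \<theta>_nonneg)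
  ultimately show ?thesis
    unfolding sum.distrib \<Delta>_def by linarith
qed

lemma sum_\<delta>_le:
  assumes "finite K"
  shows "(\<Sum>k\<in>K. \<delta> t k) \<le> \<Delta>" and "(\<Sum>t\<in>K. \<delta> t k) \<le> \<Delta>"
proof -
  have "(\<Sum>k\<in>K. \<delta> t k) = (\<Sum>k\<in>{k\<in>K. k \<le> t}. \<theta> (t - k) + \<theta> (Suc (t - k)))"
    by (subst sum.inter_filter[OF assms]) (simp add: \<delta>_def)
  also have "\<dots> \<le> \<Delta>"
    using assms by (intro sum_\<theta>_le) (auto simp: inj_on_def)
  finally show "(\<Sum>k\<in>K. \<delta> t k) \<le> \<Delta>" .
  have "(\<Sum>t\<in>K. \<delta> t k) = (\<Sum>t\<in>{t\<in>K. k \<le> t}. \<theta> (t - k) + \<theta> (Suc (t - k)))"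
    by (subst sum.inter_filter[OF assms]) (simp add: \<delta>_def)
  also have "\<dots> \<le> \<Delta>"
    using assms by (intro sum_\<theta>_le) (auto simp: inj_on_def)
  finally show "(\<Sum>t\<in>K. \<delta> t k) \<le> \<Delta>" .
qed

lemma sum_\<delta>_sq_le:
  assumes "finite J"
  shows "(\<Sum>k<n. (\<Sum>t\<in>J. \<bar>a t\<bar> * \<delta> t k)\<^sup>2) \<le> \<Delta>\<^sup>2 * (\<Sum>t\<in>J. (a t)\<^sup>2)"
  by (rule schur_test) (auto simp: assms \<delta>_nonneg sum_\<delta>_le \<Delta>_nonneg)

lemma Y_swap_A:
  assumes "t \<le> T"
  shows "Y (int t) (swap (A (Suc T)) \<omega>) = Y (int t) (swap UNIV \<omega>)"
  unfolding Y_def using assms by (intro arg_cong[of _ _ f]) (auto simp: swap_apply A_def)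

lemma A_mono: "A k \<subseteq> A (Suc k)"
  by (auto simp: A_def)

text \<open>The chain has \<open>Suc T\<close> steps: the blocks 0 to \<open>T\<close> contain every
  innovation that a functional of the process up to time \<open>T\<close> can see.\<close>

lemma efron_stein_causal:
  fixes F :: "(int \<times> bool \<Rightarrow> 's) \<Rightarrow> 'k::{real_inner, banach, second_countable_topology}"
  assumes F: "\<And>\<omega>. F \<omega> = \<Phi> (\<lambda>i. \<omega> (i, False))" "\<Phi> \<in> borel_measurable (PiM UNIV (\<lambda>_. \<mu>))"
    and L2: "Lp_le (innov \<mu>) 2 F c"
    and causal: "\<And>\<omega>. F (swap (A (Suc T)) \<omega>) = F (swap UNIV \<omega>)"
    and d: "\<And>k. Lp_le (innov \<mu>) 2 (\<lambda>\<omega>. F \<omega> - F (swap (A (Suc k) - A k) \<omega>)) (d k)"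
  shows "Lp_le (innov \<mu>) 2 (\<lambda>\<omega>. F \<omega> - (\<integral>\<omega>. F \<omega> \<partial>innov \<mu>)) (sqrt (\<Sum>k<Suc T. (d k)\<^sup>2))"
proof -
  have F_eq: "F = (\<lambda>\<omega>. \<Phi> (\<lambda>i. \<omega> (i, False)))" using F(1) by (rule ext)
  show ?thesis
    using L2 F(2) _ A_mono causal d unfolding F_eq by (rule efron_stein) (simp add: A_def)
qed

section \<open>Moments of linear forms\<close>

definition linear_form :: "nat set \<Rightarrow> (nat \<Rightarrow> real) \<Rightarrow> (int \<times> bool \<Rightarrow> 's) \<Rightarrow> 'h" where
  "linear_form J a \<omega> = (\<Sum>t\<in>J. a t *\<^sub>R Y (int t) \<omega>)"

lemma path_measurable: "(\<lambda>x. f (\<lambda>k. x (t - int k))) \<in> borel_measurable (PiM UNIV (\<lambda>_. \<mu>))"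
  by (rule measurable_compose[OF measurable_reindex f_measurable])

lemma linear_form_diff:
  assumes J: "J \<subseteq> {1..T}"
  shows "Lp_le (innov \<mu>) 4 (\<lambda>\<omega>. linear_form J a \<omega> - linear_form J a (swap (A (Suc k) - A k) \<omega>))
    (\<Sum>t\<in>J. \<bar>a t\<bar> * \<delta> t k)"
proof -
  have "Lp_le (innov \<mu>) 4 (\<lambda>\<omega>. \<Sum>t\<in>J. a t *\<^sub>R (Y (int t) \<omega> - Y (int t) (swap (A (Suc k) - A k) \<omega>)))
    (\<Sum>t\<in>J. \<bar>a t\<bar> * \<delta> t k)"
    using J by (intro Lp_le_sum Lp_le_scaleR[OF block_coupling]) auto
  then show ?thesis by (simp add: linear_form_def sum_subtractf scaleR_diff_right)
qed

lemma linear_form_L4_finite: "Lp_le (innov \<mu>) 4 (linear_form J a) (\<Sum>t\<in>J. \<bar>a t\<bar> * \<kappa>)"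
  unfolding linear_form_def by (intro Lp_le_sum Lp_le_scaleR[OF Y_L4]) auto

lemma linear_form_centred: "(\<integral>\<omega>. linear_form J a \<omega> \<partial>innov \<mu>) = 0"
proof -
  have "integrable (innov \<mu>) (Y t)" for t
    by (rule Lp_le_1_integrable(1)[OF R.Lp_le_2_1[OF R.Lp_le_4_2[OF Y_L4]]])
  then show ?thesis by (simp add: linear_form_def Y_centred)
qed

text \<open>The effect of block \<open>k\<close> on the form is at most the sum of
  \<open>\<bar>a t\<bar> * \<delta> t k\<close>, and Schur's test bounds the sum of the squares over
  \<open>k\<close>. As the form is centred, Efron--Stein bounds the form itself.\<close>

lemma linear_form_L2:
  assumes J: "J \<subseteq> {1..T}"
  shows "Lp_le (innov \<mu>) 2 (linear_form J a) (\<Delta> * sqrt (\<Sum>t\<in>J. (a t)\<^sup>2))"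
proof -
  have fin: "finite J" using J finite_subset by blast
  have "Lp_le (innov \<mu>) 2 (\<lambda>\<omega>. linear_form J a \<omega> - (\<integral>\<omega>. linear_form J a \<omega> \<partial>innov \<mu>))
      (sqrt (\<Sum>k<Suc T. (\<Sum>t\<in>J. \<bar>a t\<bar> * \<delta> t k)\<^sup>2))"
  proof (rule efron_stein_causal)
    show "linear_form J a \<omega> = (\<lambda>x. \<Sum>t\<in>J. a t *\<^sub>R f (\<lambda>k. x (int t - int k))) (\<lambda>i. \<omega> (i, False))" for \<omega>
      by (simp add: linear_form_def Y_def)
    show "Lp_le (innov \<mu>) 2 (linear_form J a) (\<Sum>t\<in>J. \<bar>a t\<bar> * \<kappa>)"
      by (rule R.Lp_le_4_2[OF linear_form_L4_finite])
    show "(\<lambda>x. \<Sum>t\<in>J. a t *\<^sub>R f (\<lambda>k. x (int t - int k))) \<in> borel_measurable (PiM UNIV (\<lambda>_. \<mu>))"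
      by (intro borel_measurable_sum borel_measurable_scaleR path_measurable) auto
    show "linear_form J a (swap (A (Suc T)) \<omega>) = linear_form J a (swap UNIV \<omega>)" for \<omega>
      using J unfolding linear_form_def by (intro sum.cong refl) (auto simp: Y_swap_A)
    show "Lp_le (innov \<mu>) 2 (\<lambda>\<omega>. linear_form J a \<omega> - linear_form J a (swap (A (Suc k) - A k) \<omega>))
        (\<Sum>t\<in>J. \<bar>a t\<bar> * \<delta> t k)" for k
      by (rule R.Lp_le_4_2[OF linear_form_diff[OF J]])
  qed
  then have L: "Lp_le (innov \<mu>) 2 (linear_form J a) (sqrt (\<Sum>k<Suc T. (\<Sum>t\<in>J. \<bar>a t\<bar> * \<delta> t k)\<^sup>2))"
    by (simp only: linear_form_centred diff_zero)
  have "sqrt (\<Sum>k<Suc T. (\<Sum>t\<in>J. \<bar>a t\<bar> * \<delta> t k)\<^sup>2) \<le> sqrt (\<Delta>\<^sup>2 * (\<Sum>t\<in>J. (a t)\<^sup>2))"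
    by (intro real_sqrt_le_mono sum_\<delta>_sq_le fin)
  also have "sqrt (\<Delta>\<^sup>2 * (\<Sum>t\<in>J. (a t)\<^sup>2)) = \<Delta> * sqrt (\<Sum>t\<in>J. (a t)\<^sup>2)"
    using \<Delta>_nonneg by (simp add: real_sqrt_mult)
  finally show ?thesis by (rule Lp_le_mono[OF L])
qed

text \<open>
  Applying the Efron--Stein inequality to \<open>\<parallel>S\<parallel>\<^sup>2\<close> bounds \<open>x = (E \<parallel>S\<parallel>\<^sup>4)\<^sup>1\<^sup>/\<^sup>4\<close> by the quadratic
  inequality \<open>x\<^sup>2 \<le> 2 x D + D\<^sup>2\<close>, which forces \<open>x \<le> 3 D\<close>.
\<close>

lemma linear_form_L4:
  assumes J: "J \<subseteq> {1..T}"
  shows "Lp_le (innov \<mu>) 4 (linear_form J a) (3 * \<Delta> * sqrt (\<Sum>t\<in>J. (a t)\<^sup>2))"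
proof -
  have fin: "finite J" using J finite_subset by blast
  define S where "S = linear_form J a"
  define D where "D = \<Delta> * sqrt (\<Sum>t\<in>J. (a t)\<^sup>2)"
  \<comment> \<open>The exact L^4 norm. The crude bound \<open>S4\<close> shows that it is finite,
    without which an inequality having \<open>x\<close> on both sides would yield nothing.\<close>
  define x where "x = root 4 (\<integral>\<omega>. norm (S \<omega>) ^ 4 \<partial>innov \<mu>)"
  define d where "d k = (\<Sum>t\<in>J. \<bar>a t\<bar> * \<delta> t k)" for k
  have D0: "0 \<le> D" using \<Delta>_nonneg by (simp add: D_def sum_nonneg)
  have S4: "Lp_le (innov \<mu>) 4 S (\<Sum>t\<in>J. \<bar>a t\<bar> * \<kappa>)"
    unfolding S_def by (rule linear_form_L4_finite)
  have x: "0 \<le> x" "x ^ 4 = (\<integral>\<omega>. norm (S \<omega>) ^ 4 \<partial>innov \<mu>)"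
    by (simp_all add: x_def)
  have Sx: "Lp_le (innov \<mu>) 4 S x"
    using S4 x by (intro Lp_leI_integral Lp_le_power_integrable[OF S4]) (auto dest: Lp_le_measurable)
  define G where "G \<omega> = (norm (S \<omega>))\<^sup>2" for \<omega>
  have G2: "Lp_le (innov \<mu>) 2 G (x * x)"
  proof -
    have "Lp_le (innov \<mu>) 2 (\<lambda>\<omega>. norm (S \<omega>) * norm (S \<omega>)) (x * x)"
      by (rule Lp_le_mult[OF Lp_le_norm Lp_le_norm]) (use Sx in auto)
    then show ?thesis by (simp add: G_def[abs_def] power2_eq_square)
  qed
  have "Lp_le (innov \<mu>) 2 (\<lambda>\<omega>. G \<omega> - (\<integral>\<omega>. G \<omega> \<partial>innov \<mu>)) (sqrt (\<Sum>k<Suc T. (d k * (x + x))\<^sup>2))"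
  proof (rule efron_stein_causal)
    show "G \<omega> = (\<lambda>x. (norm (\<Sum>t\<in>J. a t *\<^sub>R f (\<lambda>k. x (int t - int k))))\<^sup>2) (\<lambda>i. \<omega> (i, False))" for \<omega>
      by (simp add: G_def S_def linear_form_def Y_def)
    show "Lp_le (innov \<mu>) 2 G (x * x)" by (rule G2)
    show "(\<lambda>x. (norm (\<Sum>t\<in>J. a t *\<^sub>R f (\<lambda>k. x (int t - int k))))\<^sup>2) \<in> borel_measurable (PiM UNIV (\<lambda>_. \<mu>))"
      by (intro borel_measurable_power measurable_compose[OF _ borel_measurable_norm]
          borel_measurable_sum borel_measurable_scaleR path_measurable) auto
    have "S (swap (A (Suc T)) \<omega>) = S (swap UNIV \<omega>)" for \<omega>
      using J unfolding S_def linear_form_def by (intro sum.cong refl) (auto simp: Y_swap_A)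
    then show "G (swap (A (Suc T)) \<omega>) = G (swap UNIV \<omega>)" for \<omega>
      by (simp add: G_def)
    show "Lp_le (innov \<mu>) 2 (\<lambda>\<omega>. G \<omega> - G (swap (A (Suc k) - A k) \<omega>)) (d k * (x + x))" for k
    proof -
      let ?s = "swap (A (Suc k) - A k)"
      \<comment> \<open>A difference of squared norms is the inner product of the difference and the
        sum: an L^4 increment against an L^4 factor of size \<open>2 * x\<close>.\<close>
      have "Lp_le (innov \<mu>) 2 (\<lambda>\<omega>. (S \<omega> - S (?s \<omega>)) \<bullet> (S \<omega> + S (?s \<omega>))) (d k * (x + x))"
      proof (rule Lp_le_bilinear[OF bounded_bilinear_inner, where p=2])
        show "Lp_le (innov \<mu>) (2 * 2) (\<lambda>\<omega>. S \<omega> - S (?s \<omega>)) (d k)"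
          using linear_form_diff[OF J] by (simp add: S_def d_def)
        show "Lp_le (innov \<mu>) (2 * 2) (\<lambda>\<omega>. S \<omega> + S (?s \<omega>)) (x + x)"
          using Lp_le_add[OF Sx Lp_le_swap[OF Sx]] by simp
      qed (simp_all add: Cauchy_Schwarz_ineq2)
      moreover have "(S \<omega> - S (?s \<omega>)) \<bullet> (S \<omega> + S (?s \<omega>)) = G \<omega> - G (?s \<omega>)" for \<omega>
        by (simp add: G_def power2_norm_eq_inner inner_diff_left inner_diff_right inner_add_left
            inner_add_right inner_commute)
      ultimately show ?thesis by simp
    qed
  qed
  moreover have "sqrt (\<Sum>k<Suc T. (d k * (x + x))\<^sup>2) \<le> 2 * x * D"
  proof -
    have "(\<Sum>k<Suc T. (d k * (x + x))\<^sup>2) = (2 * x)\<^sup>2 * (\<Sum>k<Suc T. (d k)\<^sup>2)"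
      by (simp only: sum_distrib_left) (intro sum.cong refl, simp add: power2_eq_square algebra_simps)
    also have "\<dots> \<le> (2 * x)\<^sup>2 * (\<Delta>\<^sup>2 * (\<Sum>t\<in>J. (a t)\<^sup>2))"
      unfolding d_def by (intro mult_left_mono sum_\<delta>_sq_le fin) auto
    also have "\<dots> = (2 * x * D)\<^sup>2"
      by (simp add: D_def power_mult_distrib sum_nonneg)
    finally show ?thesis
      using x(1) D0 by (intro real_le_lsqrt) auto
  qed
  ultimately have "Lp_le (innov \<mu>) 2 (\<lambda>\<omega>. G \<omega> - (\<integral>\<omega>. G \<omega> \<partial>innov \<mu>)) (2 * x * D)"
    by (rule Lp_le_mono)
  moreover have "Lp_le (innov \<mu>) 2 (\<lambda>_. \<integral>\<omega>. G \<omega> \<partial>innov \<mu>) (D\<^sup>2)"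
  proof (rule R.Lp_le_const)
    show "norm (\<integral>\<omega>. G \<omega> \<partial>innov \<mu>) \<le> D\<^sup>2"
      using Lp_le_power_integrable(2)[OF linear_form_L2[OF J, of a]] by (simp add: G_def S_def D_def)
  qed simp
  ultimately have "Lp_le (innov \<mu>) 2 (\<lambda>\<omega>. (G \<omega> - (\<integral>\<omega>. G \<omega> \<partial>innov \<mu>)) + (\<integral>\<omega>. G \<omega> \<partial>innov \<mu>)) (2 * x * D + D\<^sup>2)"
    by (rule Lp_le_add)
  then have "Lp_le (innov \<mu>) 2 G (2 * x * D + D\<^sup>2)" by simp
  from Lp_le_power_integrable(2)[OF this]
  have "(x\<^sup>2)\<^sup>2 \<le> (2 * x * D + D\<^sup>2)\<^sup>2"
    by (simp add: G_def x(2) flip: power_mult)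
  then have le: "x\<^sup>2 \<le> 2 * x * D + D\<^sup>2"
    by (rule power2_le_imp_le) (use x(1) D0 in simp)
  \<comment> \<open>If \<open>D \<le> x / 3\<close>, the right side of \<open>le\<close> is at most
    7/9 of \<open>x\<^sup>2\<close>, which is impossible for \<open>x > 0\<close>.\<close>
  have "x \<le> 3 * D"
  proof (rule ccontr)
    assume "\<not> x \<le> 3 * D"
    then have D: "D \<le> x / 3" and "0 < x" using D0 by auto
    have "D * x \<le> x / 3 * x" using D x(1) by (rule mult_right_mono)
    moreover have "D * D \<le> x / 3 * (x / 3)" by (rule mult_mono[OF D D]) (use x(1) D0 in auto)
    moreover have "0 < x * x" using \<open>0 < x\<close> by simp
    ultimately show False
      using le unfolding power2_eq_square by (simp add: algebra_simps)
  qed  with Sx show ?thesis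
    unfolding S_def D_def mult.assoc by (rule Lp_le_mono)
qed

section \<open>Variance of quadratic forms\<close>

definition quadratic_form :: "('h \<Rightarrow> 'h \<Rightarrow> 'k) \<Rightarrow> nat set \<Rightarrow> (nat \<Rightarrow> nat \<Rightarrow> real) \<Rightarrow> (int \<times> bool \<Rightarrow> 's) \<Rightarrow> 'k::real_vector" where
  "quadratic_form B J a \<omega> = (\<Sum>j\<in>J. \<Sum>k\<in>J. a j k *\<^sub>R B (Y (int j) \<omega>) (Y (int k) \<omega>))"

text \<open>One exchange alters the form by increments of \<open>Y\<close> paired with linear forms
  whose coefficients are rows or columns of \<open>a\<close>, of L^4 norm at most
  \<open>3 * \<Delta> * sqrt \<rho>\<close>. Summing the squared effects by Schur's test contributes
  another factor \<open>\<Delta>\<close> and the square root of \<open>card J\<close>; rows and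
  columns together account for the factor 6.\<close>

lemma quadratic_form_variance:
  fixes B :: "'h \<Rightarrow> 'h \<Rightarrow> 'k::{real_inner, banach, second_countable_topology}"
  assumes B: "bounded_bilinear B" and norm_B: "\<And>x y. norm (B x y) \<le> norm x * norm y"
    and J: "J \<subseteq> {1..T}"
    and row: "\<And>j. j \<in> J \<Longrightarrow> (\<Sum>k\<in>J. (a j k)\<^sup>2) \<le> \<rho>" and col: "\<And>k. k \<in> J \<Longrightarrow> (\<Sum>j\<in>J. (a j k)\<^sup>2) \<le> \<rho>"
  shows "Lp_le (innov \<mu>) 2 (\<lambda>\<omega>. quadratic_form B J a \<omega> - (\<integral>\<omega>. quadratic_form B J a \<omega> \<partial>innov \<mu>))
    (6 * \<Delta>\<^sup>2 * sqrt (\<rho> * card J))"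
proof -
  interpret B: bounded_bilinear B by (rule B)
  have fin: "finite J" using J finite_subset by blast
  define V where "V = quadratic_form B J a"
  define e where "e = 3 * \<Delta> * sqrt \<rho>"
  \<comment> \<open>The factor \<open>\<bar>1\<bar>\<close> puts the sum into the shape of
    \<open>sum_\<delta>_sq_le\<close> with all weights equal to 1.\<close>
  define d where "d i = 2 * e * (\<Sum>j\<in>J. \<bar>1\<bar> * \<delta> j i)" for i
  have cont: "continuous_on UNIV (\<lambda>z. B (fst z) (snd z))"
    by (intro B.continuous_on continuous_intros)
  have "Lp_le (innov \<mu>) 2 (\<lambda>\<omega>. V \<omega> - (\<integral>\<omega>. V \<omega> \<partial>innov \<mu>)) (sqrt (\<Sum>i<Suc T. (d i)\<^sup>2))"
  proof (rule efron_stein_causal)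
    show "V \<omega> = (\<lambda>x. \<Sum>j\<in>J. \<Sum>k\<in>J. a j k *\<^sub>R B (f (\<lambda>l. x (int j - int l))) (f (\<lambda>l. x (int k - int l))))
        (\<lambda>i. \<omega> (i, False))" for \<omega>
      by (simp add: V_def quadratic_form_def Y_def)
    show "Lp_le (innov \<mu>) 2 V (\<Sum>j\<in>J. \<Sum>k\<in>J. \<bar>a j k\<bar> * (\<kappa> * \<kappa>))"
      unfolding V_def quadratic_form_def
      by (intro Lp_le_sum Lp_le_scaleR[OF Lp_le_bilinear[OF B norm_B]]) (auto intro: Y_L4)
    show "(\<lambda>x. \<Sum>j\<in>J. \<Sum>k\<in>J. a j k *\<^sub>R B (f (\<lambda>l. x (int j - int l))) (f (\<lambda>l. x (int k - int l))))
        \<in> borel_measurable (PiM UNIV (\<lambda>_. \<mu>))"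
      by (intro borel_measurable_sum borel_measurable_scaleR borel_measurable_const
          borel_measurable_continuous_Pair[OF _ _ cont] path_measurable)
    show "V (swap (A (Suc T)) \<omega>) = V (swap UNIV \<omega>)" for \<omega>
      using J unfolding V_def quadratic_form_def by (intro sum.cong refl) (auto simp: Y_swap_A subset_iff)
    show "Lp_le (innov \<mu>) 2 (\<lambda>\<omega>. V \<omega> - V (swap (A (Suc i) - A i) \<omega>)) (d i)" for i
    proof -
      let ?s = "swap (A (Suc i) - A i)"
      have row4: "Lp_le (innov \<mu>) 4 (linear_form J (a j)) e" if "j \<in> J" for j
        using row[OF that] \<Delta>_nonneg unfolding e_def
        by (intro Lp_le_mono[OF linear_form_L4[OF J]] mult_left_mono) auto
      have col4: "Lp_le (innov \<mu>) 4 (linear_form J (\<lambda>j. a j k)) e" if "k \<in> J" for k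
        using col[OF that] \<Delta>_nonneg unfolding e_def
        by (intro Lp_le_mono[OF linear_form_L4[OF J]] mult_left_mono) auto
      \<comment> \<open>The product rule B(y,z) - B(y',z') = B(y - y',z) + B(y',z - z'). Summing
        over the unchanged argument gives a row form at the original path and a column form at the
        exchanged path.\<close>
      have dec: "V \<omega> - V (?s \<omega>) = (\<Sum>j\<in>J. B (Y (int j) \<omega> - Y (int j) (?s \<omega>)) (linear_form J (a j) \<omega>))
          + (\<Sum>k\<in>J. B (linear_form J (\<lambda>j. a j k) (?s \<omega>)) (Y (int k) \<omega> - Y (int k) (?s \<omega>)))" for \<omega>
      proof -
        have "(\<Sum>k\<in>J. B (linear_form J (\<lambda>j. a j k) (?s \<omega>)) (Y (int k) \<omega> - Y (int k) (?s \<omega>)))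
            = (\<Sum>j\<in>J. \<Sum>k\<in>J. a j k *\<^sub>R B (Y (int j) (?s \<omega>)) (Y (int k) \<omega> - Y (int k) (?s \<omega>)))"
          unfolding linear_form_def B.sum_left B.scaleR_left by (rule sum.swap)
        moreover have "(\<Sum>j\<in>J. B (Y (int j) \<omega> - Y (int j) (?s \<omega>)) (linear_form J (a j) \<omega>))
            = (\<Sum>j\<in>J. \<Sum>k\<in>J. a j k *\<^sub>R B (Y (int j) \<omega> - Y (int j) (?s \<omega>)) (Y (int k) \<omega>))"
          unfolding linear_form_def B.sum_right B.scaleR_right ..
        ultimately show ?thesis
          by (simp add: V_def quadratic_form_def B.diff_left B.diff_right scaleR_diff_right sum_subtractf)
      qed
      have "Lp_le (innov \<mu>) 2 (\<lambda>\<omega>. (\<Sum>j\<in>J. B (Y (int j) \<omega> - Y (int j) (?s \<omega>)) (linear_form J (a j) \<omega>))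
          + (\<Sum>k\<in>J. B (linear_form J (\<lambda>j. a j k) (?s \<omega>)) (Y (int k) \<omega> - Y (int k) (?s \<omega>))))
          ((\<Sum>j\<in>J. \<delta> j i * e) + (\<Sum>k\<in>J. e * \<delta> k i))"
      proof (intro Lp_le_add Lp_le_sum)
        fix j assume j: "j \<in> J"
        then have "1 \<le> j" using J by auto
        from block_coupling[OF this, of i]
        have bc: "Lp_le (innov \<mu>) (2 * 2) (\<lambda>\<omega>. Y (int j) \<omega> - Y (int j) (?s \<omega>)) (\<delta> j i)" by simp
        show "Lp_le (innov \<mu>) 2 (\<lambda>\<omega>. B (Y (int j) \<omega> - Y (int j) (?s \<omega>)) (linear_form J (a j) \<omega>)) (\<delta> j i * e)"
          by (rule Lp_le_bilinear[OF B norm_B bc]) (use row4[OF j] in auto)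
        show "Lp_le (innov \<mu>) 2 (\<lambda>\<omega>. B (linear_form J (\<lambda>l. a l j) (?s \<omega>)) (Y (int j) \<omega> - Y (int j) (?s \<omega>))) (e * \<delta> j i)"
          by (rule Lp_le_bilinear[OF B norm_B _ bc]) (use Lp_le_swap[OF col4[OF j]] in auto)
      qed auto
      then show ?thesis
        by (simp only: dec) (simp add: d_def sum_distrib_left mult.commute mult.left_commute flip: sum.distrib)
    qed
  qed
  moreover have "sqrt (\<Sum>i<Suc T. (d i)\<^sup>2) \<le> 6 * \<Delta>\<^sup>2 * sqrt (\<rho> * card J)"
  proof (cases "J = {}")
    case True
    then show ?thesis by (simp add: d_def)
  next
    case False
    then obtain j where "j \<in> J" by auto
    then have \<rho>: "0 \<le> \<rho>" using row[of j] sum_nonneg[of J "\<lambda>k. (a j k)\<^sup>2"] by force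
    have "(\<Sum>i<Suc T. (d i)\<^sup>2) = (2 * e)\<^sup>2 * (\<Sum>i<Suc T. (\<Sum>j\<in>J. \<bar>1\<bar> * \<delta> j i)\<^sup>2)"
      by (simp only: d_def power_mult_distrib, subst sum_distrib_left, rule refl)
    also have "\<dots> \<le> (2 * e)\<^sup>2 * (\<Delta>\<^sup>2 * (\<Sum>j\<in>J. 1\<^sup>2))"
      by (intro mult_left_mono sum_\<delta>_sq_le fin) auto
    also have "\<dots> = (6 * \<Delta>\<^sup>2 * sqrt (\<rho> * card J))\<^sup>2"
      using \<rho> by (simp add: e_def power_mult_distrib power2_eq_square)
    finally show ?thesis by (intro real_le_lsqrt) (auto simp: \<rho>)
  qed
  ultimately show ?thesis unfolding V_def by (rule Lp_le_mono)
qed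

end

section \<open>Covariances and transport to the given probability space\<close>

context causal_process
begin

lemma integrable_bilinear_Y:
  fixes B :: "'h \<Rightarrow> 'h \<Rightarrow> 'k::{banach, second_countable_topology}"
  assumes B: "bounded_bilinear B" and norm_B: "\<And>x y. norm (B x y) \<le> norm x * norm y"
  shows "integrable (innov \<mu>) (\<lambda>\<omega>. B (Y j \<omega>) (Y k \<omega>))"
  by (rule Lp_le_1_integrable(1)[OF Lp_le_bilinear[OF B norm_B, where c=\<kappa> and d=\<kappa>]])
    (use R.Lp_le_4_2[OF Y_L4] in auto)

lemma covariance_shift:
  fixes B :: "'h \<Rightarrow> 'h \<Rightarrow> 'k::{banach, second_countable_topology}"
  assumes B: "bounded_bilinear B"
  shows "(\<integral>\<omega>. B (Y (j + s) \<omega>) (Y (k + s) \<omega>) \<partial>innov \<mu>) = (\<integral>\<omega>. B (Y j \<omega>) (Y k \<omega>) \<partial>innov \<mu>)"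
proof -
  interpret B: bounded_bilinear B by (rule B)
  have cont: "continuous_on UNIV (\<lambda>z. B (fst z) (snd z))"
    by (intro B.continuous_on continuous_intros)
  have "(\<lambda>\<omega>. B (Y j \<omega>) (Y k \<omega>)) \<in> borel_measurable (PiM UNIV (\<lambda>_. \<mu>))"
    by (rule borel_measurable_continuous_Pair[OF _ _ cont]) (fold innov_def, measurable)
  from reindex_integral[OF _ this, of "\<lambda>(i, c). (i + s, c)"] show ?thesis
    by (simp add: innov_def Y_def inj_def add.commute add_diff_eq diff_add_eq)
qed

text \<open>Once the innovations up to time 0 are exchanged in \<open>Y (int m)\<close>, that
  variable is independent of \<open>Y 0\<close>, so only the coupling error of lag \<open>m\<close>
  contributes. To see the independence on the fibres, the times after 0 are exchanged too:
  \<open>Y 0\<close> does not notice, while \<open>Y (int m)\<close> then reads copies only.\<close>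

lemma covariance_bound:
  fixes B :: "'h \<Rightarrow> 'h \<Rightarrow> 'k::{banach, second_countable_topology}"
  assumes B: "bounded_bilinear B" and norm_B: "\<And>x y. norm (B x y) \<le> norm x * norm y"
  shows "norm (\<integral>\<omega>. B (Y 0 \<omega>) (Y (int m) \<omega>) \<partial>innov \<mu>) \<le> \<kappa> * \<theta> m"
proof -
  interpret B: bounded_bilinear B by (rule B)
  let ?s = "swap {..0} :: (int \<times> bool \<Rightarrow> 's) \<Rightarrow> _" and ?Q = "PiM (UNIV :: int set) (\<lambda>_. \<mu>)"
  have cont: "continuous_on UNIV (\<lambda>z. B (fst z) (snd z))"
    by (intro B.continuous_on continuous_intros)
  have L2: "Lp_le (innov \<mu>) (2 * 1) (Y t) \<kappa>" for t using R.Lp_le_4_2[OF Y_L4] by simp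
  have Ys: "Lp_le (innov \<mu>) (2 * 1) (\<lambda>\<omega>. Y t (?s \<omega>)) \<kappa>" for t
    by (rule Lp_le_swap[OF L2])
  have Ym [measurable]: "(\<lambda>\<omega>. Y t (?s \<omega>)) \<in> borel_measurable (innov \<mu>)" for t
    by (rule Lp_le_measurable[OF Ys])
  have path_int: "integrable ?Q (\<lambda>x. f (\<lambda>k. x (t - int k)))" and path_0: "(\<integral>x. f (\<lambda>k. x (t - int k)) \<partial>?Q) = 0" for t
  proof -
    have inj: "inj (\<lambda>k. t - int k)" by (auto simp: inj_def)
    interpret Q: prob_space ?Q by (intro prob_space_PiM prob_space_axioms)
    show "integrable ?Q (\<lambda>x. f (\<lambda>k. x (t - int k)))"
      by (rule Lp_le_1_integrable(1)[OF Q.Lp_le_2_1[OF Q.Lp_le_4_2[OF Lp_le_reindex[OF f_L4 inj]]]])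
    show "(\<integral>x. f (\<lambda>k. x (t - int k)) \<partial>?Q) = 0"
      using reindex_integral[OF inj f_measurable] by (simp add: centred)
  qed
  have "(\<integral>\<omega>. B (Y 0 \<omega>) (Y (int m) (?s \<omega>)) \<partial>innov \<mu>)
      = (\<integral>\<omega>. B (Y 0 (swap {0<..} \<omega>)) (Y (int m) (?s (swap {0<..} \<omega>))) \<partial>innov \<mu>)"
    by (rule integral_swap[symmetric]) (rule borel_measurable_continuous_Pair[OF _ _ cont]; measurable)
  also have "\<dots> = (\<integral>\<omega>. B ((\<lambda>x. f (\<lambda>k. x (0 - int k))) (\<lambda>i. \<omega> (i, False)))
      ((\<lambda>x. f (\<lambda>k. x (int m - int k))) (\<lambda>i. \<omega> (i, True))) \<partial>innov \<mu>)"
  proof (intro Bochner_Integration.integral_cong refl arg_cong2[of _ _ _ _ B])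
    fix \<omega> :: "int \<times> bool \<Rightarrow> 's"
    show "Y 0 (swap {0<..} \<omega>) = (\<lambda>x. f (\<lambda>k. x (0 - int k))) (\<lambda>i. \<omega> (i, False))"
      by (simp add: Y_def swap_apply)
    have "swap {..0} (swap {0<..} \<omega>) = swap UNIV \<omega>"
      by (auto simp: swap_def fun_eq_iff intro!: arg_cong[of _ _ \<omega>])
    then show "Y (int m) (?s (swap {0<..} \<omega>)) = (\<lambda>x. f (\<lambda>k. x (int m - int k))) (\<lambda>i. \<omega> (i, True))"
      by (simp add: Y_def swap_apply)
  qed
  also have "\<dots> = 0"
    by (subst integral_bilinear_fibres(2)[OF B path_int path_int]) (simp only: path_0 B.zero_right)
  finally have 0: "(\<integral>\<omega>. B (Y 0 \<omega>) (Y (int m) (?s \<omega>)) \<partial>innov \<mu>) = 0" .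
  have int: "integrable (innov \<mu>) (\<lambda>\<omega>. B (Y 0 \<omega>) (Y (int m) (?s \<omega>)))"
    by (rule Lp_le_1_integrable(1)[OF Lp_le_bilinear[OF B norm_B L2 Ys order_refl]])
  have "(\<integral>\<omega>. B (Y 0 \<omega>) (Y (int m) \<omega>) \<partial>innov \<mu>) = (\<integral>\<omega>. B (Y 0 \<omega>) (Y (int m) \<omega> - Y (int m) (?s \<omega>)) \<partial>innov \<mu>)"
    by (simp add: B.diff_right integrable_bilinear_Y[OF B norm_B] int 0)
  also have "norm \<dots> \<le> \<kappa> * \<theta> m"
  proof (rule Lp_le_1_integrable(2), rule Lp_le_bilinear[OF B norm_B L2 _ order_refl])
    show "Lp_le (innov \<mu>) (2 * 1) (\<lambda>\<omega>. Y (int m) \<omega> - Y (int m) (?s \<omega>)) (\<theta> m)"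
      using R.Lp_le_4_2[OF coupling[of "int m" m]] by simp
  qed
  finally show ?thesis .
qed

lemma summable_covariance:
  fixes B :: "'h \<Rightarrow> 'h \<Rightarrow> 'k::{banach, second_countable_topology}"
  assumes B: "bounded_bilinear B" and norm_B: "\<And>x y. norm (B x y) \<le> norm x * norm y"
  shows "summable (\<lambda>m. norm (\<integral>\<omega>. B (Y 0 \<omega>) (Y (int m) \<omega>) \<partial>innov \<mu>))"
  by (rule summable_comparison_test'[where g="\<lambda>m. \<kappa> * \<theta> m" and N=0])
    (auto intro!: summable_mult summable_\<theta> covariance_bound[OF B norm_B])

end

section \<open>Realisation of the canonical model on the given probability space\<close>

definition joint_innovations :: "(int \<Rightarrow> 'w \<Rightarrow> 's) \<Rightarrow> (int \<Rightarrow> 'w \<Rightarrow> 's) \<Rightarrow> 'w \<Rightarrow> int \<times> bool \<Rightarrow> 's" where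
  "joint_innovations \<epsilon> \<epsilon>' \<omega> = (\<lambda>(i, c). if c then \<epsilon>' i \<omega> else \<epsilon> i \<omega>)"

text \<open>Independence of the copy gives the pair of paths the law of a product of two product
  measures. Merging the two paths into one family is the inverse of splitting
  \<open>innov \<mu>\<close> into fibres, so \<open>distr_fibres\<close> already determines the law
  of the merged family.\<close>

lemma
  fixes M :: "'w measure" and S :: "'s measure"
  assumes M: "prob_space M" and iid: "iid_sequence M S \<epsilon>" and copy: "independent_copy M S \<epsilon> \<epsilon>'"
  defines "\<mu> \<equiv> distr M S (\<epsilon> 0)"
  shows measurable_joint_innovations: "joint_innovations \<epsilon> \<epsilon>' \<in> M \<rightarrow>\<^sub>M innov \<mu>"
    and distr_joint_innovations: "distr M (innov \<mu>) (joint_innovations \<epsilon> \<epsilon>') = innov \<mu>"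
    and prob_space_innovation: "prob_space \<mu>"
proof -
  interpret M: prob_space M by (rule M)
  let ?QS = "PiM (UNIV :: int set) (\<lambda>_. S)" and ?Q = "PiM (UNIV :: int set) (\<lambda>_. \<mu>)"
  have indep: "M.indep_vars (\<lambda>_. S) \<epsilon> UNIV" and same: "distr M S (\<epsilon> j) = \<mu>" for j
    using iid by (auto simp: iid_sequence_def \<mu>_def)
  have rv: "\<epsilon> j \<in> M \<rightarrow>\<^sub>M S" for j
    using indep by (auto simp: M.indep_vars_def)
  show "prob_space \<mu>" unfolding \<mu>_def by (rule M.prob_space_distr[OF rv])
  then interpret \<mu>: prob_space \<mu> .
  have sets: "sets ?Q = sets ?QS" by (rule sets_PiM_cong) (auto simp: \<mu>_def)
  have cop: "M.indep_var ?QS (\<lambda>\<omega> k. \<epsilon> k \<omega>) ?QS (\<lambda>\<omega> k. \<epsilon>' k \<omega>)"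
    "distr M ?QS (\<lambda>\<omega> k. \<epsilon>' k \<omega>) = distr M ?QS (\<lambda>\<omega> k. \<epsilon> k \<omega>)"
    using copy by (auto simp: independent_copy_def)
  have "distr M ?QS (\<lambda>\<omega> k. \<epsilon> k \<omega>) = ?Q"
    using indep M.indep_vars_iff_distr_eq_PiM[of UNIV \<epsilon> "\<lambda>_. S"] rv by (simp add: same restrict_UNIV)
  then have pair: "distr M (?QS \<Otimes>\<^sub>M ?QS) (\<lambda>\<omega>. (\<lambda>k. \<epsilon> k \<omega>, \<lambda>k. \<epsilon>' k \<omega>)) = ?Q \<Otimes>\<^sub>M ?Q"
    using cop unfolding M.indep_var_distribution_eq by simp
  have sets2: "sets (?Q \<Otimes>\<^sub>M ?Q) = sets (?QS \<Otimes>\<^sub>M ?QS)"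
    by (rule sets_pair_measure_cong[OF sets sets])
  have "(\<lambda>\<omega>. (\<lambda>k. \<epsilon> k \<omega>, \<lambda>k. \<epsilon>' k \<omega>)) \<in> M \<rightarrow>\<^sub>M ?QS \<Otimes>\<^sub>M ?QS"
    using cop(1) unfolding M.indep_var_distribution_eq by (intro measurable_Pair) auto
  then have pm: "(\<lambda>\<omega>. (\<lambda>k. \<epsilon> k \<omega>, \<lambda>k. \<epsilon>' k \<omega>)) \<in> M \<rightarrow>\<^sub>M ?Q \<Otimes>\<^sub>M ?Q"
    by (simp add: measurable_cong_sets[OF refl sets2])
  have pair': "distr M (?Q \<Otimes>\<^sub>M ?Q) (\<lambda>\<omega>. (\<lambda>k. \<epsilon> k \<omega>, \<lambda>k. \<epsilon>' k \<omega>)) = ?Q \<Otimes>\<^sub>M ?Q"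
    using pair by (simp add: distr_cong[OF refl sets2])
  define mg :: "(int \<Rightarrow> 's) \<times> (int \<Rightarrow> 's) \<Rightarrow> int \<times> bool \<Rightarrow> 's"
    where "mg z = (\<lambda>n. if snd n then snd z (fst n) else fst z (fst n))" for z
  have mgm: "mg \<in> ?Q \<Otimes>\<^sub>M ?Q \<rightarrow>\<^sub>M innov \<mu>"
    unfolding innov_def
  proof (rule measurable_PiM_single')
    fix n :: "int \<times> bool"
    show "(\<lambda>z. mg z n) \<in> ?Q \<Otimes>\<^sub>M ?Q \<rightarrow>\<^sub>M \<mu>"
      unfolding mg_def by (cases "snd n") simp_all
  qed (auto simp: mg_def space_pair_measure space_PiM PiE_iff)
  have split: "(\<lambda>\<omega>. (\<lambda>i. \<omega> (i, False), \<lambda>i. \<omega> (i, True))) \<in> innov \<mu> \<rightarrow>\<^sub>M ?Q \<Otimes>\<^sub>M ?Q"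
    by (intro measurable_Pair \<mu>.measurable_fibre)
  \<comment> \<open>The product of the path laws is itself the image of \<open>innov \<mu>\<close>
    under splitting, and merging after splitting is the identity.\<close>
  have "distr (?Q \<Otimes>\<^sub>M ?Q) (innov \<mu>) mg =
      distr (distr (innov \<mu>) (?Q \<Otimes>\<^sub>M ?Q) (\<lambda>\<omega>. (\<lambda>i. \<omega> (i, False), \<lambda>i. \<omega> (i, True)))) (innov \<mu>) mg"
    by (simp only: \<mu>.distr_fibres)
  also have "\<dots> = distr (innov \<mu>) (innov \<mu>) (\<lambda>\<omega>. \<omega>)"
    by (subst distr_distr[OF mgm split]) (rule distr_cong, auto simp: mg_def fun_eq_iff)
  finally have mgd: "distr (?Q \<Otimes>\<^sub>M ?Q) (innov \<mu>) mg = innov \<mu>"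
    by (simp add: distr_id2)
  have eq: "joint_innovations \<epsilon> \<epsilon>' = mg \<circ> (\<lambda>\<omega>. (\<lambda>k. \<epsilon> k \<omega>, \<lambda>k. \<epsilon>' k \<omega>))"
    by (auto simp: joint_innovations_def mg_def fun_eq_iff)
  show "joint_innovations \<epsilon> \<epsilon>' \<in> M \<rightarrow>\<^sub>M innov \<mu>"
    unfolding eq by (rule measurable_comp[OF pm mgm])
  show "distr M (innov \<mu>) (joint_innovations \<epsilon> \<epsilon>') = innov \<mu>"
    unfolding eq distr_distr[OF mgm pm, symmetric] pair' mgd ..
qed

lemma v_norm_nonneg: "0 \<le> v_norm M p X"
  by (simp add: v_norm_def)

lemma Lp_le_v_norm_4:
  fixes X :: "'w \<Rightarrow> 'b::{banach, second_countable_topology}"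
  assumes "X \<in> borel_measurable M" "integrable M (\<lambda>\<omega>. norm (X \<omega>) ^ 4)"
  shows "Lp_le M 4 X (v_norm M 4 X)"
proof (rule Lp_leI_integral)
  have p: "norm (X \<omega>) powr 4 = norm (X \<omega>) ^ 4" for \<omega>
    using powr_realpow'[of "norm (X \<omega>)" 4] by simp
  have "0 \<le> (\<integral>\<omega>. norm (X \<omega>) ^ 4 \<partial>M)" by simp
  then have "v_norm M 4 X ^ 4 = (\<integral>\<omega>. norm (X \<omega>) ^ 4 \<partial>M)"
    unfolding v_norm_def p by (cases "(\<integral>\<omega>. norm (X \<omega>) ^ 4 \<partial>M) = 0") (auto simp: powr_powr simp flip: powr_realpow)
  then show "(\<integral>\<omega>. norm (X \<omega>) ^ 4 \<partial>M) \<le> v_norm M 4 X ^ 4" by simp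
qed (use assms in \<open>auto simp: v_norm_nonneg\<close>)

text \<open>The hypotheses describe the law of the innovations together with one copy at a time.
  Hence every lag \<open>m\<close> gets its own map
  \<open>joint_innovations \<epsilon> (\<epsilon>' m 0)\<close>; all of these maps have the same
  image law \<open>innov \<mu>\<close>, and the resulting bounds meet on one space.\<close>

lemma causal_process_of_approximable:
  fixes X :: "int \<Rightarrow> 'w \<Rightarrow> 'h::{real_inner, banach, second_countable_topology}"
  assumes M: "prob_space M" and approx: "Lp_m_approximable M S 4 f \<epsilon> \<epsilon>' X"
    and centred: "\<And>t. (\<integral>\<omega>. X t \<omega> \<partial>M) = 0"
  obtains \<theta> \<kappa> where "causal_process (distr M S (\<epsilon> 0)) f \<theta> \<kappa>"
proof -
  interpret M: prob_space M by (rule M)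
  define \<mu> where "\<mu> = distr M S (\<epsilon> 0)"
  have iid: "iid_sequence M S \<epsilon>" and copy: "\<And>m t. m \<ge> 1 \<Longrightarrow> independent_copy M S \<epsilon> (\<epsilon>' m t)"
    and X_L4: "X t \<in> Lp_H M 4" and f_S: "f \<in> borel_measurable (PiM UNIV (\<lambda>_. S))"
    and X_eq: "AE \<omega> in M. X t \<omega> = f (\<lambda>k. \<epsilon> (t - int k) \<omega>)"
    and sm: "summable (\<lambda>m. v_norm M 4 (\<lambda>\<omega>. X t \<omega> - m_approximation f \<epsilon> \<epsilon>' (Suc m) t \<omega>))" for t
    using approx by (auto simp: Lp_m_approximable_def)
  interpret \<mu>: prob_space \<mu> unfolding \<mu>_def by (rule prob_space_innovation[OF M iid copy[of 1 0]]) simp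
  have sets: "sets (PiM UNIV (\<lambda>_. \<mu>)) = sets (PiM (UNIV :: nat set) (\<lambda>_. S))"
    by (rule sets_PiM_cong) (auto simp: \<mu>_def)
  have f_m [measurable]: "f \<in> borel_measurable (PiM UNIV (\<lambda>_. \<mu>))"
    using f_S by (simp add: measurable_cong_sets[OF sets refl])
  define \<kappa> where "\<kappa> = v_norm M 4 (X 0)"
  \<comment> \<open>The given couplings start at lag 1. At lag 0 all innovations are replaced, and
    the triangle inequality gives twice the norm of \<open>X 0\<close>.\<close>
  define \<theta> where "\<theta> m = (if m = 0 then 2 * \<kappa> else v_norm M 4 (\<lambda>\<omega>. X 0 \<omega> - m_approximation f \<epsilon> \<epsilon>' m 0 \<omega>))" for m
  have \<Psi>: "joint_innovations \<epsilon> (\<epsilon>' m 0) \<in> M \<rightarrow>\<^sub>M innov \<mu>" "distr M (innov \<mu>) (joint_innovations \<epsilon> (\<epsilon>' m 0)) = innov \<mu>"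
    if "m \<ge> 1" for m
    unfolding \<mu>_def by (rule measurable_joint_innovations[OF M iid copy[OF that]] distr_joint_innovations[OF M iid copy[OF that]])+
  have Xm [measurable]: "X t \<in> borel_measurable M" for t
    using X_L4 by (simp add: Lp_H_def)
  have inj0: "inj (\<lambda>k. (- int k, c k))" for c :: "nat \<Rightarrow> bool" by (auto simp: inj_def)
  have fm: "(\<lambda>\<omega>. f (\<lambda>k. \<omega> (- int k, c k))) \<in> borel_measurable (innov \<mu>)" for c
    unfolding innov_def by (rule measurable_compose[OF \<mu>.measurable_reindex f_m])
  have int4: "integrable M (\<lambda>\<omega>. norm (X 0 \<omega>) ^ 4)"
  proof -
    have "norm (X 0 \<omega>) powr 4 = norm (X 0 \<omega>) ^ 4" for \<omega>
      using powr_realpow'[of "norm (X 0 \<omega>)" 4] by simp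
    then show ?thesis using X_L4[of 0] by (simp add: Lp_H_def)
  qed
  have X0: "Lp_le M 4 (X 0) \<kappa>"
    unfolding \<kappa>_def by (rule Lp_le_v_norm_4[OF Xm int4])
  have Y0_eq: "AE \<omega> in M. f (\<lambda>k. joint_innovations \<epsilon> (\<epsilon>' m 0) \<omega> (- int k, False)) = X 0 \<omega>" for m
    using X_eq[of 0] by eventually_elim (simp add: joint_innovations_def)
  have Y0: "Lp_le (innov \<mu>) 4 (\<lambda>\<omega>. f (\<lambda>k. \<omega> (- int k, False))) \<kappa>"
  proof -
    have "Lp_le M 4 (\<lambda>\<omega>. f (\<lambda>k. joint_innovations \<epsilon> (\<epsilon>' 1 0) \<omega> (- int k, False))) \<kappa>"
      using measurable_compose[OF \<Psi>(1) fm[of "\<lambda>_. False"], of 1] by (intro Lp_le_cong_AE[OF X0 _ Y0_eq]) simp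
    then have "Lp_le (distr M (innov \<mu>) (joint_innovations \<epsilon> (\<epsilon>' 1 0))) 4 (\<lambda>\<omega>. f (\<lambda>k. \<omega> (- int k, False))) \<kappa>"
      by (subst Lp_le_distr[OF \<Psi>(1) fm]) auto
    then show ?thesis by (simp add: \<Psi>(2))
  qed
  have f_L4: "Lp_le (PiM UNIV (\<lambda>_. \<mu>)) 4 f \<kappa>"
  proof -
    have "Lp_le (distr (innov \<mu>) (PiM UNIV (\<lambda>_. \<mu>)) (\<lambda>\<omega> k. \<omega> (- int k, False))) 4 f \<kappa>"
      unfolding innov_def by (subst Lp_le_distr[OF \<mu>.measurable_reindex f_m]) (rule Y0[unfolded innov_def])
    then show ?thesis
      unfolding innov_def by (subst (asm) \<mu>.distr_reindex[OF inj0])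
  qed
  have f_shift: "Lp_le (innov \<mu>) 4 (\<lambda>\<omega>. f (\<lambda>k. \<omega> (- int k, c k))) \<kappa>" for c
    unfolding innov_def
    by (rule Lp_le_distr[OF \<mu>.measurable_reindex f_m, THEN iffD1]) (subst \<mu>.distr_reindex[OF inj0], rule f_L4)
  have f0: "(\<integral>x. f x \<partial>PiM UNIV (\<lambda>_. \<mu>)) = 0"
  proof -
    have "(\<integral>x. f x \<partial>PiM UNIV (\<lambda>_. \<mu>)) = (\<integral>\<omega>. f (\<lambda>k. \<omega> (- int k, False)) \<partial>innov \<mu>)"
      unfolding innov_def by (subst integral_distr[OF \<mu>.measurable_reindex f_m, symmetric])
        (subst \<mu>.distr_reindex[OF inj0], rule refl)
    also have "\<dots> = (\<integral>\<omega>. f (\<lambda>k. joint_innovations \<epsilon> (\<epsilon>' 1 0) \<omega> (- int k, False)) \<partial>M)"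
      using integral_distr[OF \<Psi>(1)[of 1] fm[of "\<lambda>_. False"]] by (simp add: \<Psi>(2))
    also have "\<dots> = (\<integral>\<omega>. X 0 \<omega> \<partial>M)"
      by (rule integral_cong_AE[OF _ _ Y0_eq])
        (use measurable_compose[OF \<Psi>(1) fm[of "\<lambda>_. False"], of 1] in auto)
    finally show ?thesis by (simp add: centred)
  qed
  have coup: "Lp_le (innov \<mu>) 4 (\<lambda>\<omega>. f (\<lambda>k. \<omega> (- int k, False)) - f (\<lambda>k. \<omega> (- int k, m \<le> k))) (\<theta> m)" for m
  proof (cases "m = 0")
    case True
    then show ?thesis using Lp_le_diff[OF f_shift[of "\<lambda>_. False"] f_shift[of "\<lambda>k. m \<le> k"]] by (simp add: \<theta>_def)
  next
    case False
    then have m: "m \<ge> 1" by simp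
    let ?D = "\<lambda>\<omega>. f (\<lambda>k. \<omega> (- int k, False)) - f (\<lambda>k. \<omega> (- int k, m \<le> k))"
    let ?\<Psi> = "joint_innovations \<epsilon> (\<epsilon>' m 0)"
    let ?Z = "\<lambda>\<omega>. X 0 \<omega> - m_approximation f \<epsilon> \<epsilon>' m 0 \<omega>"
    \<comment> \<open>A Bochner integral of a non-integrable function is 0, so \<open>v_norm\<close>
      is a bound only once the fourth moment is known to be finite. The triangle inequality provides
      this.\<close>
    have D: "Lp_le (innov \<mu>) 4 ?D (\<kappa> + \<kappa>)"
      by (rule Lp_le_diff[OF f_shift f_shift])
    then have D_m: "?D \<in> borel_measurable (innov \<mu>)" by (rule Lp_le_measurable)
    have D_M: "Lp_le M 4 (\<lambda>\<omega>. ?D (?\<Psi> \<omega>)) (\<kappa> + \<kappa>)"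
      by (rule Lp_le_distr[OF \<Psi>(1)[OF m] D_m, THEN iffD1]) (subst \<Psi>(2)[OF m], rule D)
    have app_eq: "m_approximation f \<epsilon> \<epsilon>' m 0 \<omega> = f (\<lambda>k. ?\<Psi> \<omega> (- int k, m \<le> k))" for \<omega>
      unfolding m_approximation_def joint_innovations_def
      by (intro arg_cong[of _ _ f]) (auto simp: fun_eq_iff)
    have Z_eq: "AE \<omega> in M. ?Z \<omega> = ?D (?\<Psi> \<omega>)"
      using Y0_eq[of m] by eventually_elim (simp add: app_eq)
    have Z_m: "?Z \<in> borel_measurable M"
      unfolding app_eq by (intro borel_measurable_diff Xm measurable_compose[OF \<Psi>(1)[OF m] fm])
    have Z: "Lp_le M 4 ?Z (\<theta> m)"
      using Lp_le_v_norm_4[OF Z_m Lp_le_power_integrable(1)[OF Lp_le_cong_AE[OF D_M Z_m Z_eq]]] False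
      by (simp add: \<theta>_def)
    have "Lp_le M 4 (\<lambda>\<omega>. ?D (?\<Psi> \<omega>)) (\<theta> m)"
      by (rule Lp_le_cong_AE[OF Z]) (use Z_eq D_M in \<open>auto dest: Lp_le_measurable\<close>)
    then have "Lp_le (distr M (innov \<mu>) ?\<Psi>) 4 ?D (\<theta> m)"
      by (rule Lp_le_distr[OF \<Psi>(1)[OF m] D_m, THEN iffD2])
    then show ?thesis by (simp add: \<Psi>(2)[OF m])
  qed
  have "summable (\<lambda>m. \<theta> (Suc m))" using sm[of 0] by (simp add: \<theta>_def)
  then have "summable \<theta>" by (simp add: summable_Suc_iff)
  then have "causal_process \<mu> f \<theta> \<kappa>"
    by unfold_locales (use f_m f_L4 f0 coup in auto)
  then show thesis unfolding \<mu>_def by (rule that)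
qed

text \<open>All bounds are pulled back along a measure-preserving map \<open>\<Psi>\<close> with X_t
  = Y_t o \<open>\<Psi>\<close> almost surely. The copy of lag 1 at time 0 completes the observed
  innovations to a point of the doubled space.\<close>

lemma approximable_moment_bounds:
  fixes X :: "int \<Rightarrow> 'w \<Rightarrow> 'h::{real_inner, banach, second_countable_topology}"
    and B :: "'h \<Rightarrow> 'h \<Rightarrow> 'k::{real_inner, banach, second_countable_topology}"
  assumes M: "prob_space M" and approx: "Lp_m_approximable M S 4 f \<epsilon> \<epsilon>' X"
    and centred: "\<And>t. (\<integral>\<omega>. X t \<omega> \<partial>M) = 0"
    and B: "bounded_bilinear B" and norm_B: "\<And>x y. norm (B x y) \<le> norm x * norm y"
  defines "\<gamma> \<equiv> \<lambda>j k. \<integral>\<omega>. B (X j \<omega>) (X k \<omega>) \<partial>M"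
  obtains D where "0 \<le> D"
    and "\<And>J T a. J \<subseteq> {1..T} \<Longrightarrow>
      Lp_le M 2 (\<lambda>\<omega>. \<Sum>t\<in>J. a t *\<^sub>R X (int t) \<omega>) (D * sqrt (\<Sum>t\<in>J. (a t)\<^sup>2))"
    and "\<And>J T a \<rho>. J \<subseteq> {1..T} \<Longrightarrow> (\<And>j. j \<in> J \<Longrightarrow> (\<Sum>k\<in>J. (a j k)\<^sup>2) \<le> \<rho>) \<Longrightarrow>
      (\<And>k. k \<in> J \<Longrightarrow> (\<Sum>j\<in>J. (a j k)\<^sup>2) \<le> \<rho>) \<Longrightarrow>
      Lp_le M 2 (\<lambda>\<omega>. (\<Sum>j\<in>J. \<Sum>k\<in>J. a j k *\<^sub>R B (X (int j) \<omega>) (X (int k) \<omega>))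
          - (\<Sum>j\<in>J. \<Sum>k\<in>J. a j k *\<^sub>R \<gamma> (int j) (int k)))
        (6 * D\<^sup>2 * sqrt (\<rho> * card J))"
    and "\<And>j k s. \<gamma> (j + s) (k + s) = \<gamma> j k"
    and "summable (\<lambda>m. norm (\<gamma> 0 (int m)))" and "summable (\<lambda>m. norm (\<gamma> (int m) 0))"
proof -
  interpret M: prob_space M by (rule M)
  define \<mu> where "\<mu> = distr M S (\<epsilon> 0)"
  obtain \<theta> \<kappa> where "causal_process \<mu> f \<theta> \<kappa>"
    using causal_process_of_approximable[OF M approx centred] unfolding \<mu>_def by blast
  then interpret causal_process \<mu> f \<theta> \<kappa> .
  interpret B: bounded_bilinear B by (rule B)
  have iid: "iid_sequence M S \<epsilon>" and copy: "independent_copy M S \<epsilon> (\<epsilon>' 1 0)"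
    and X_L4: "X t \<in> Lp_H M 4" and X_eq: "AE \<omega> in M. X t \<omega> = f (\<lambda>k. \<epsilon> (t - int k) \<omega>)" for t
    using approx by (auto simp: Lp_m_approximable_def)
  define \<Psi> where "\<Psi> = joint_innovations \<epsilon> (\<epsilon>' 1 0)"
  have \<Psi>: "\<Psi> \<in> M \<rightarrow>\<^sub>M innov \<mu>" "distr M (innov \<mu>) \<Psi> = innov \<mu>"
    unfolding \<Psi>_def \<mu>_def by (rule measurable_joint_innovations[OF M iid copy] distr_joint_innovations[OF M iid copy])+
  have "AE \<omega> in M. X t \<omega> = Y t (\<Psi> \<omega>)" for t
    using X_eq[of t] by eventually_elim (simp add: Y_def \<Psi>_def joint_innovations_def)
  \<comment> \<open>There are countably many times, so one null set serves for all of them.\<close>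
  then have XY: "AE \<omega> in M. \<forall>t. X t \<omega> = Y t (\<Psi> \<omega>)"
    by (simp add: AE_all_countable)
  have [measurable]: "X t \<in> borel_measurable M" for t
    using X_L4 by (simp add: Lp_H_def)
  have cont: "continuous_on UNIV (\<lambda>z. B (fst z) (snd z))"
    by (intro B.continuous_on continuous_intros)
  have BX [measurable]: "(\<lambda>\<omega>. B (X j \<omega>) (X k \<omega>)) \<in> borel_measurable M" for j k
    by (rule borel_measurable_continuous_Pair[OF _ _ cont]) measurable
  have BY [measurable]: "(\<lambda>\<omega>. B (Y j \<omega>) (Y k \<omega>)) \<in> borel_measurable (innov \<mu>)" for j k
    by (rule borel_measurable_continuous_Pair[OF _ _ cont]) measurable
  have Lp: "Lp_le M p (\<lambda>\<omega>. Z (\<Psi> \<omega>)) c" if "Lp_le (innov \<mu>) p Z c"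
    for p c and Z :: "_ \<Rightarrow> 'c::{real_normed_vector, second_countable_topology}"
    by (rule Lp_le_distr[OF \<Psi>(1) Lp_le_measurable[OF that], THEN iffD1]) (subst \<Psi>(2), rule that)
  have \<gamma>: "\<gamma> j k = (\<integral>\<omega>. B (Y j \<omega>) (Y k \<omega>) \<partial>innov \<mu>)" for j k
  proof -
    have "(\<integral>\<omega>. B (Y j \<omega>) (Y k \<omega>) \<partial>innov \<mu>) = (\<integral>\<omega>. B (Y j (\<Psi> \<omega>)) (Y k (\<Psi> \<omega>)) \<partial>M)"
      using integral_distr[OF \<Psi>(1) BY] by (simp add: \<Psi>(2))
    also have "\<dots> = \<gamma> j k"
      unfolding \<gamma>_def
      by (rule integral_cong_AE) (use XY measurable_compose[OF \<Psi>(1) BY] in auto)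
    finally show ?thesis by simp
  qed
  show thesis
  proof (rule that[of \<Delta>])
    show "0 \<le> \<Delta>" by (rule \<Delta>_nonneg)
    show "Lp_le M 2 (\<lambda>\<omega>. \<Sum>t\<in>J. a t *\<^sub>R X (int t) \<omega>) (\<Delta> * sqrt (\<Sum>t\<in>J. (a t)\<^sup>2))"
      if J: "J \<subseteq> {1..T}" for J T a
      by (rule Lp_le_cong_AE[OF Lp[OF linear_form_L2[OF J]]]) (measurable, use XY in \<open>auto simp: linear_form_def\<close>)
    show "\<gamma> (j + s) (k + s) = \<gamma> j k" for j k s
      unfolding \<gamma> by (rule covariance_shift[OF B])
    show "summable (\<lambda>m. norm (\<gamma> 0 (int m)))"
      unfolding \<gamma> by (rule summable_covariance[OF B norm_B])
    show "summable (\<lambda>m. norm (\<gamma> (int m) 0))"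
      unfolding \<gamma> by (rule summable_covariance[OF B.flip]) (subst mult.commute, rule norm_B)
    fix J T and a :: "nat \<Rightarrow> nat \<Rightarrow> real" and \<rho>
    assume J: "J \<subseteq> {1..T}" and row: "\<And>j. j \<in> J \<Longrightarrow> (\<Sum>k\<in>J. (a j k)\<^sup>2) \<le> \<rho>"
      and col: "\<And>k. k \<in> J \<Longrightarrow> (\<Sum>j\<in>J. (a j k)\<^sup>2) \<le> \<rho>"
    have "(\<integral>\<omega>. quadratic_form B J a \<omega> \<partial>innov \<mu>) = (\<Sum>j\<in>J. \<Sum>k\<in>J. a j k *\<^sub>R \<gamma> (int j) (int k))"
      unfolding quadratic_form_def \<gamma> by (simp add: integrable_bilinear_Y[OF B norm_B])
    then have V: "Lp_le M 2 (\<lambda>\<omega>. quadratic_form B J a (\<Psi> \<omega>) - (\<Sum>j\<in>J. \<Sum>k\<in>J. a j k *\<^sub>R \<gamma> (int j) (int k)))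
        (6 * \<Delta>\<^sup>2 * sqrt (\<rho> * card J))"
      using Lp[OF quadratic_form_variance[OF B norm_B J row col]] by simp
    show "Lp_le M 2 (\<lambda>\<omega>. (\<Sum>j\<in>J. \<Sum>k\<in>J. a j k *\<^sub>R B (X (int j) \<omega>) (X (int k) \<omega>))
          - (\<Sum>j\<in>J. \<Sum>k\<in>J. a j k *\<^sub>R \<gamma> (int j) (int k))) (6 * \<Delta>\<^sup>2 * sqrt (\<rho> * card J))"
      by (rule Lp_le_cong_AE[OF V]) (measurable, use XY in \<open>auto simp: quadratic_form_def\<close>)
  qed
qed

section \<open>Kernels and the estimator as a quadratic form\<close>

lemma tensor_add_left: "(x + y) \<otimes>\<^sub>2 z = x \<otimes>\<^sub>2 z + y \<otimes>\<^sub>2 z"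
  by transfer (auto simp: distrib_right intro!: sq_integrable_add sq_integrable_tensor)

lemma tensor_add_right: "x \<otimes>\<^sub>2 (y + z) = x \<otimes>\<^sub>2 y + x \<otimes>\<^sub>2 z"
  by transfer (auto simp: distrib_left intro!: sq_integrable_add sq_integrable_tensor)

lemma tensor_scaleR_left: "(a *\<^sub>R x) \<otimes>\<^sub>2 y = a *\<^sub>R (x \<otimes>\<^sub>2 y)"
  by transfer (auto simp: mult.assoc intro!: sq_integrable_scale sq_integrable_tensor)

lemma tensor_scaleR_right: "x \<otimes>\<^sub>2 (a *\<^sub>R y) = a *\<^sub>R (x \<otimes>\<^sub>2 y)"
  by transfer (auto simp: mult.left_commute intro!: sq_integrable_scale sq_integrable_tensor)

text \<open>Fubini on the product cube. It makes the tensor product a bilinear map of norm one into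
  a Hilbert space, to which the bounds for a general \<open>B\<close> apply.\<close>

lemma inner_tensor: "(x \<otimes>\<^sub>2 y) \<bullet> (x \<otimes>\<^sub>2 y) = (x \<bullet> x) * (y \<bullet> y)"
proof transfer
  fix f :: "'a \<Rightarrow> real" and g :: "'b \<Rightarrow> real"
  assume "sq_integrable f \<and> sq_integrable f \<and> (AE s in cube. f s = f s)"
    and "sq_integrable g \<and> sq_integrable g \<and> (AE s in cube. g s = g s)"
  then have fg: "sq_integrable f" "sq_integrable g" by auto
  let ?h = "\<lambda>s. (f (fst s) * g (snd s)) * (f (fst s) * g (snd s))"
  have "integrable cube ?h"
    by (intro sq_integrable_mult sq_integrable_tensor fg)
  then have int: "integrable (cube \<Otimes>\<^sub>M cube) ?h" by (simp add: cube_prod)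
  have "(\<integral>s. ?h s \<partial>cube) = (\<integral>s. ?h s \<partial>(cube \<Otimes>\<^sub>M cube))" by (simp add: cube_prod)
  also have "\<dots> = (\<integral>x. \<integral>y. (f x * g y) * (f x * g y) \<partial>cube \<partial>cube)"
    using cube_pair.integral_fst'[OF int] by simp
  also have "\<dots> = (\<integral>x. \<integral>y. (f x * f x) * (g y * g y) \<partial>cube \<partial>cube)"
    by (simp add: mult_ac)
  also have "\<dots> = (\<integral>s. f s * f s \<partial>cube) * (\<integral>s. g s * g s \<partial>cube)"
    by (simp only: integral_mult_right_zero integral_mult_left_zero)
  finally show "(\<integral>s. ?h s \<partial>cube) = (\<integral>s. f s * f s \<partial>cube) * (\<integral>s. g s * g s \<partial>cube)" .
qed

lemma norm_tensor: "norm (x \<otimes>\<^sub>2 y) = norm x * norm y"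
  by (simp add: norm_eq_sqrt_inner inner_tensor real_sqrt_mult)

lemma bounded_bilinear_tensor: "bounded_bilinear (\<otimes>\<^sub>2)"
  by unfold_locales
    (auto simp: tensor_add_left tensor_add_right tensor_scaleR_left tensor_scaleR_right norm_tensor
      intro!: exI[of _ 1])

lemma flip_kernel_add: "flip_kernel (k + l) = flip_kernel k + flip_kernel l"
  by transfer (auto intro!: sq_integrable_add sq_integrable_swap)

lemma flip_kernel_scaleR: "flip_kernel (a *\<^sub>R k) = a *\<^sub>R flip_kernel k"
  by transfer (auto intro!: sq_integrable_scale sq_integrable_swap)

lemma flip_kernel_zero: "flip_kernel 0 = 0"
  using flip_kernel_scaleR[of 0 0] by simp

lemma flip_kernel_sum: "flip_kernel (\<Sum>i\<in>I. k i) = (\<Sum>i\<in>I. flip_kernel (k i))"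
  by (induction I rule: infinite_finite_induct) (simp_all add: flip_kernel_zero flip_kernel_add)

lemma flip_kernel_tensor:
  fixes x :: "'a::euclidean_space L2" and y :: "'b::euclidean_space L2"
  shows "flip_kernel (x \<otimes>\<^sub>2 y) = y \<otimes>\<^sub>2 x"
proof transfer
  fix f :: "'a \<Rightarrow> real" and g :: "'b \<Rightarrow> real"
  assume "sq_integrable f \<and> sq_integrable f \<and> (AE s in cube. f s = f s)"
    and "sq_integrable g \<and> sq_integrable g \<and> (AE s in cube. g s = g s)"
  then have "sq_integrable (\<lambda>s. g (fst s) * f (snd s))"
    by (intro sq_integrable_tensor) auto
  then show "sq_integrable (\<lambda>s. f (fst (prod.swap s)) * g (snd (prod.swap s))) \<and>
      sq_integrable (\<lambda>s. g (fst s) * f (snd s)) \<and>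
      (AE s in cube. f (fst (prod.swap s)) * g (snd (prod.swap s)) = g (fst s) * f (snd s))"
    by (simp add: mult.commute)
qed

text \<open>Induction on the size of the square: besides its diagonal entry, the new last row and
  column contribute exactly one symmetric pair to each lag.\<close>

lemma sum_square_by_lag:
  fixes F :: "nat \<Rightarrow> nat \<Rightarrow> 'k::comm_monoid_add"
  shows "(\<Sum>j\<in>{1..T}. \<Sum>k\<in>{1..T}. F j k) =
    (\<Sum>j\<in>{1..T}. F j j) + (\<Sum>t\<in>{1..T - 1}. \<Sum>j\<in>{t + 1..T}. F j (j - t) + F (j - t) j)"
proof (induction T)
  case (Suc T)
  have rev: "(\<Sum>t\<in>{1..T}. G (Suc T - t)) = (\<Sum>k\<in>{1..T}. G k)" for G :: "nat \<Rightarrow> 'k"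
    using sum.atLeastAtMost_rev[of G 1 T] by simp
  \<comment> \<open>The additional lag \<open>t = T\<close> has an empty inner sum, so the old range
    of lags may be extended.\<close>
  have "(\<Sum>t\<in>{1..T}. \<Sum>j\<in>{t + 1..T}. F j (j - t) + F (j - t) j)
      = (\<Sum>t\<in>{1..T - 1}. \<Sum>j\<in>{t + 1..T}. F j (j - t) + F (j - t) j)"
    by (intro sum.mono_neutral_right) auto
  moreover have "(\<Sum>t\<in>{1..T}. \<Sum>j\<in>{t + 1..Suc T}. F j (j - t) + F (j - t) j)
      = (\<Sum>t\<in>{1..T}. (\<Sum>j\<in>{t + 1..T}. F j (j - t) + F (j - t) j)
          + (F (Suc T) (Suc T - t) + F (Suc T - t) (Suc T)))"
    by (intro sum.cong refl) simp
  ultimately have "(\<Sum>t\<in>{1..T}. \<Sum>j\<in>{t + 1..Suc T}. F j (j - t) + F (j - t) j)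
      = (\<Sum>t\<in>{1..T - 1}. \<Sum>j\<in>{t + 1..T}. F j (j - t) + F (j - t) j)
        + (\<Sum>k\<in>{1..T}. F (Suc T) k + F k (Suc T))"
    using rev[of "\<lambda>k. F (Suc T) k + F k (Suc T)"] by (simp only: sum.distrib[of _ "\<lambda>t. F (Suc T) (Suc T - t) + _ t"])
  then show ?case
    using Suc by (simp add: sum.distrib add_ac)
qed simp

text \<open>In the estimator the kernel \<open>K1\<close> sits at the later of the two times, hence
  \<open>max\<close>; the flipped kernel carries the same weight, so the matrix is
  symmetric.\<close>

definition lag_weight ::
  "(real \<Rightarrow> real) \<Rightarrow> (real \<Rightarrow> real) \<Rightarrow> real \<Rightarrow> real \<Rightarrow> real \<Rightarrow> nat \<Rightarrow> nat \<Rightarrow> nat \<Rightarrow> real" where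
  "lag_weight K1 K2 h b u T j k =
     K1 ((u - real (max j k) / real T) / h) * K2 (real (max j k - min j k) / b)"

lemma lag_weight_commute: "lag_weight K1 K2 h b u T j k = lag_weight K1 K2 h b u T k j"
  by (simp add: lag_weight_def max.commute min.commute)

lemma sum_lag_weight:
  fixes G :: "nat \<Rightarrow> nat \<Rightarrow> 'k::real_vector"
  assumes "K2 0 = 1"
  shows "(\<Sum>j\<in>{1..T}. \<Sum>k\<in>{1..T}. lag_weight K1 K2 h b u T j k *\<^sub>R G j k) =
    (\<Sum>j\<in>{1..T}. K1 ((u - real j / real T) / h) *\<^sub>R G j j) +
    (\<Sum>t\<in>{1..T - 1}. K2 (real t / b) *\<^sub>R
      (\<Sum>j\<in>{t + 1..T}. K1 ((u - real j / real T) / h) *\<^sub>R (G j (j - t) + G (j - t) j)))"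
  unfolding sum_square_by_lag scaleR_sum_right
  by (intro arg_cong2[of _ _ _ _ "(+)"] sum.cong refl)
    (auto simp: lag_weight_def assms max_def min_def scaleR_add_right mult.commute)

text \<open>Flipping the kernel of a pair interchanges its factors, so the lags and their flips fill
  the matrix on both sides of the diagonal, and \<open>K2 0 = 1\<close> fits the lag 0 term into the
  same formula.\<close>

lemma c_hat_eq_sum:
  assumes "K2 0 = 1" and y_def: "\<And>j. y j = x j - local_mean K1 h u T x"
  shows "c_hat K1 K2 h b u T x = (1 / (real T * h)) *\<^sub>R
    (\<Sum>j\<in>{1..T}. \<Sum>k\<in>{1..T}. lag_weight K1 K2 h b u T j k *\<^sub>R (y j \<otimes>\<^sub>2 y k))"
proof -
  have "gamma_hat K1 h u T x 0 = (1 / (real T * h)) *\<^sub>R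
      (\<Sum>j\<in>{1..T}. K1 ((u - real j / real T) / h) *\<^sub>R (y j \<otimes>\<^sub>2 y j))"
    by (simp add: gamma_hat_def y_def)
  moreover have "gamma_hat K1 h u T x t + flip_kernel (gamma_hat K1 h u T x t) = (1 / (real T * h)) *\<^sub>R
      (\<Sum>j\<in>{t + 1..T}. K1 ((u - real j / real T) / h) *\<^sub>R (y j \<otimes>\<^sub>2 y (j - t) + y (j - t) \<otimes>\<^sub>2 y j))" for t
    by (simp add: gamma_hat_def y_def flip_kernel_scaleR flip_kernel_sum flip_kernel_tensor
        scaleR_add_right sum.distrib)
  ultimately show ?thesis
    unfolding c_hat_def sum_lag_weight[of K2, OF assms(1)]
    by (simp add: scaleR_add_right scaleR_sum_right mult_ac)
qed

text \<open>The terms linear in \<open>E\<close> are grouped so that each \<open>E j\<close> meets a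
  whole weighted sum of \<open>Y\<close>, whose norm \<open>\<sigma>\<close> profits from
  cancellation. Only the term quadratic in \<open>E\<close> pays the absolute row sum
  \<open>r\<close>.\<close>

lemma (in prob_space) quadratic_perturbation:
  fixes B :: "'h::{real_normed_vector, second_countable_topology} \<Rightarrow> 'h \<Rightarrow>
      'k::{real_normed_vector, second_countable_topology}"
  assumes B: "bounded_bilinear B" and norm_B: "\<And>x y. norm (B x y) \<le> norm x * norm y"
    and E: "\<And>j. j \<in> J \<Longrightarrow> Lp_le M 2 (E j) \<eta>"
    and row: "\<And>j. j \<in> J \<Longrightarrow> Lp_le M 2 (\<lambda>\<omega>. \<Sum>k\<in>J. a j k *\<^sub>R Y k \<omega>) \<sigma>"
    and col: "\<And>k. k \<in> J \<Longrightarrow> Lp_le M 2 (\<lambda>\<omega>. \<Sum>j\<in>J. a j k *\<^sub>R Y j \<omega>) \<sigma>"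
    and abs_row: "\<And>j. j \<in> J \<Longrightarrow> (\<Sum>k\<in>J. \<bar>a j k\<bar>) \<le> r"
  shows "Lp_le M 1 (\<lambda>\<omega>. (\<Sum>j\<in>J. \<Sum>k\<in>J. a j k *\<^sub>R B (Y j \<omega> + E j \<omega>) (Y k \<omega> + E k \<omega>))
      - (\<Sum>j\<in>J. \<Sum>k\<in>J. a j k *\<^sub>R B (Y j \<omega>) (Y k \<omega>)))
    (real (card J) * (2 * \<eta> * \<sigma> + r * \<eta>\<^sup>2))"
proof -
  interpret B: bounded_bilinear B by (rule B)
  have dec: "(\<Sum>j\<in>J. \<Sum>k\<in>J. a j k *\<^sub>R B (Y j \<omega> + E j \<omega>) (Y k \<omega> + E k \<omega>))
      - (\<Sum>j\<in>J. \<Sum>k\<in>J. a j k *\<^sub>R B (Y j \<omega>) (Y k \<omega>))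
    = (\<Sum>j\<in>J. B (E j \<omega>) (\<Sum>k\<in>J. a j k *\<^sub>R Y k \<omega>)) + (\<Sum>k\<in>J. B (\<Sum>j\<in>J. a j k *\<^sub>R Y j \<omega>) (E k \<omega>))
      + (\<Sum>j\<in>J. \<Sum>k\<in>J. a j k *\<^sub>R B (E j \<omega>) (E k \<omega>))" for \<omega>
  proof -
    have "(\<Sum>k\<in>J. B (\<Sum>j\<in>J. a j k *\<^sub>R Y j \<omega>) (E k \<omega>)) = (\<Sum>j\<in>J. \<Sum>k\<in>J. a j k *\<^sub>R B (Y j \<omega>) (E k \<omega>))"
      unfolding B.sum_left B.scaleR_left by (rule sum.swap)
    moreover have "(\<Sum>j\<in>J. B (E j \<omega>) (\<Sum>k\<in>J. a j k *\<^sub>R Y k \<omega>)) = (\<Sum>j\<in>J. \<Sum>k\<in>J. a j k *\<^sub>R B (E j \<omega>) (Y k \<omega>))"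
      unfolding B.sum_right B.scaleR_right ..
    ultimately show ?thesis
      by (simp add: B.add_left B.add_right scaleR_add_right sum.distrib)
  qed
  have E': "Lp_le M (2 * 1) (E j) \<eta>" if "j \<in> J" for j using E[OF that] by simp
  have "Lp_le M 1 (\<lambda>\<omega>. (\<Sum>j\<in>J. B (E j \<omega>) (\<Sum>k\<in>J. a j k *\<^sub>R Y k \<omega>)) + (\<Sum>k\<in>J. B (\<Sum>j\<in>J. a j k *\<^sub>R Y j \<omega>) (E k \<omega>))
      + (\<Sum>j\<in>J. \<Sum>k\<in>J. a j k *\<^sub>R B (E j \<omega>) (E k \<omega>)))
    ((\<Sum>j\<in>J. \<eta> * \<sigma>) + (\<Sum>k\<in>J. \<sigma> * \<eta>) + (\<Sum>j\<in>J. \<Sum>k\<in>J. \<bar>a j k\<bar> * (\<eta> * \<eta>)))"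
  proof (intro Lp_le_add Lp_le_sum)
    fix j assume j: "j \<in> J"
    show "Lp_le M 1 (\<lambda>\<omega>. B (E j \<omega>) (\<Sum>k\<in>J. a j k *\<^sub>R Y k \<omega>)) (\<eta> * \<sigma>)"
      by (rule Lp_le_bilinear[OF B norm_B E'[OF j] _ order_refl]) (use row[OF j] in simp)
    show "Lp_le M 1 (\<lambda>\<omega>. B (\<Sum>i\<in>J. a i j *\<^sub>R Y i \<omega>) (E j \<omega>)) (\<sigma> * \<eta>)"
      by (rule Lp_le_bilinear[OF B norm_B _ E'[OF j] order_refl]) (use col[OF j] in simp)
    show "Lp_le M 1 (\<lambda>\<omega>. a j k *\<^sub>R B (E j \<omega>) (E k \<omega>)) (\<bar>a j k\<bar> * (\<eta> * \<eta>))" if k: "k \<in> J" for k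
      by (rule Lp_le_scaleR[OF Lp_le_bilinear[OF B norm_B E'[OF j] E'[OF k] order_refl] order_refl])
  qed simp_all
  moreover have "(\<Sum>j\<in>J. \<eta> * \<sigma>) + (\<Sum>k\<in>J. \<sigma> * \<eta>) + (\<Sum>j\<in>J. \<Sum>k\<in>J. \<bar>a j k\<bar> * (\<eta> * \<eta>))
      \<le> (\<Sum>j\<in>J. \<eta> * \<sigma>) + (\<Sum>k\<in>J. \<sigma> * \<eta>) + (\<Sum>j\<in>J. r * (\<eta> * \<eta>))"
    unfolding sum_distrib_right[symmetric] by (intro add_left_mono sum_mono mult_right_mono abs_row) auto
  moreover have "(\<Sum>j\<in>J. \<eta> * \<sigma>) + (\<Sum>k\<in>J. \<sigma> * \<eta>) + (\<Sum>j\<in>J. r * (\<eta> * \<eta>))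
      = real (card J) * (2 * \<eta> * \<sigma> + r * \<eta>\<^sup>2)"
    by (simp add: algebra_simps power2_eq_square)
  ultimately show ?thesis
    unfolding dec by (auto intro: Lp_le_mono)
qed

section \<open>Error of the estimator and its limit\<close>

lemma card_nat_between:
  fixes J :: "nat set" and c d :: real
  assumes "finite J" "\<And>j. j \<in> J \<Longrightarrow> c \<le> real j \<and> real j \<le> d" "c \<le> d + 1"
  shows "real (card J) \<le> d - c + 1"
proof (cases "J = {}")
  case True
  then show ?thesis using assms(3) by simp
next
  case False
  have m: "Min J \<in> J" "Max J \<in> J" using assms(1) False by auto
  have "card J \<le> card {Min J..Max J}"
    using assms(1) by (intro card_mono) auto
  then have "real (card J) \<le> real (Max J) - real (Min J) + 1"
    using Min_le[OF assms(1) m(2)] by (simp add: of_nat_diff)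
  then show ?thesis using assms(2)[OF m(1)] assms(2)[OF m(2)] by linarith
qed

text \<open>The radius exceeds that of the kernel support by \<open>h\<close>. This leaves room for
  the earlier index of a pair, at most R b \<le> T h steps back, and for one mesh cell of the
  Riemann sum. The condition T h \<ge> 1 absorbs the additional 1 of the count into the
  constant.\<close>

lemma card_near_le:
  assumes "0 < h" "1 \<le> real T * h" "0 \<le> A" "1 \<le> T"
  shows "real (card {j\<in>{1..T}. \<bar>u - real j / real T\<bar> \<le> (A + 1) * h}) \<le> (2 * A + 3) * (real T * h)"
proof -
  have "real (card {j\<in>{1..T}. \<bar>u - real j / real T\<bar> \<le> (A + 1) * h})
      \<le> (u + (A + 1) * h) * real T - (u - (A + 1) * h) * real T + 1"
  proof (rule card_nat_between)
    fix j assume "j \<in> {j\<in>{1..T}. \<bar>u - real j / real T\<bar> \<le> (A + 1) * h}"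
    then have "u - (A + 1) * h \<le> real j / real T" "real j / real T \<le> u + (A + 1) * h" by (auto simp: abs_le_iff)
    then show "(u - (A + 1) * h) * real T \<le> real j \<and> real j \<le> (u + (A + 1) * h) * real T"
      using assms(4) by (simp add: le_divide_eq divide_le_eq)
  next
    have "0 \<le> (A + 1) * h" using assms by simp
    then have "(u - (A + 1) * h) * real T \<le> (u + (A + 1) * h) * real T"
      by (intro mult_right_mono) auto
    then show "(u - (A + 1) * h) * real T \<le> (u + (A + 1) * h) * real T + 1" by simp
  qed simp
  also have "\<dots> = 2 * (A + 1) * (real T * h) + 1" by (simp add: algebra_simps)
  also have "\<dots> \<le> 2 * (A + 1) * (real T * h) + real T * h" using assms by simp
  finally show ?thesis by (simp add: algebra_simps)
qed

text \<open>The points \<open>(u - real j / real T) / h\<close> form a grid of mesh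
  \<open>1 / (real T * h)\<close>. By the Lipschitz condition a cell contributes an error of at most
  \<open>L\<close> times the squared mesh, and only cells near the support contribute.\<close>

lemma kernel_riemann_sum:
  fixes K :: "real \<Rightarrow> real"
  assumes T: "1 \<le> T" "0 < h" "1 \<le> real T * h"
    and lip: "\<And>x y. \<bar>K x - K y\<bar> \<le> L * \<bar>x - y\<bar>"
    and supp: "\<And>z. K z \<noteq> 0 \<Longrightarrow> \<bar>z\<bar> \<le> A" and A: "0 \<le> A"
    and int: "(\<integral>z. K z \<partial>lborel) = 1"
    and edge: "(u - 1) / h \<le> - A" "A \<le> u / h"
  shows "\<bar>1 / (real T * h) * (\<Sum>j\<in>{1..T}. K ((u - real j / real T) / h)) - 1\<bar>
    \<le> L / (real T * h)\<^sup>2 * real (card {j\<in>{1..T}. \<bar>u - real j / real T\<bar> \<le> (A + 1) * h})"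
proof -
  define l where "l = 1 / (real T * h)"
  define z where "z j = (u - real j / real T) / h" for j
  have l: "0 < l" "l \<le> 1" using T by (auto simp: l_def)
  have z_Suc: "z j = z (Suc j) + l" for j
    using T by (simp add: z_def l_def field_simps)
  have z_mono: "z n \<le> z 0" for n
    using T by (auto simp: z_def intro!: divide_right_mono)
  have cont: "continuous_on S K" for S
  proof -
    have "\<bar>L\<bar>-lipschitz_on S K"
      by (rule lipschitz_onI) (auto simp: dist_real_def intro!: order_trans[OF lip] mult_right_mono)
    then show ?thesis by (rule lipschitz_on_continuous_on)
  qed
  have Ki: "K integrable_on {a..b}" for a b
    by (rule integrable_continuous_real[OF cont])
  \<comment> \<open>The integral is 1, not the default value 0 of a non-integrable function.\<close>
  have "integrable lborel K"
    using int not_integrable_integral_eq by fastforce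
  from has_integral_integral_lborel[OF this] have "(K has_integral 1) UNIV" by (simp add: int)
  \<comment> \<open>By \<open>edge\<close> the grid covers the support, so an interior point
    \<open>u\<close> has no boundary effect.\<close>
  moreover have "K = (\<lambda>x. if x \<in> {z T..z 0} then K x else 0)"
    using supp edge T by (fastforce simp: z_def abs_le_iff)
  ultimately have "(K has_integral 1) {z T..z 0}"
    by (metis has_integral_restrict_UNIV)
  then have total: "integral {z T..z 0} K = 1" by (rule integral_unique)
  have split: "integral {z n..z 0} K = (\<Sum>j<n. integral {z (Suc j)..z j} K)" for n
  proof (induction n)
    case (Suc n)
    have "integral {z (Suc n)..z n} K + integral {z n..z 0} K = integral {z (Suc n)..z 0} K"
      using l z_Suc[of n] z_mono[of n] by (intro Henstock_Kurzweil_Integration.integral_combine Ki) auto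
    then show ?case using Suc by simp
  qed simp
  have piece: "\<bar>l * K (z (Suc j)) - integral {z (Suc j)..z j} K\<bar>
      \<le> (if \<bar>u - real (Suc j) / real T\<bar> \<le> (A + 1) * h then L * l\<^sup>2 else 0)" for j
  proof (cases "\<bar>u - real (Suc j) / real T\<bar> \<le> (A + 1) * h")
    case True
    have le: "z (Suc j) \<le> z j" using z_Suc[of j] l by simp
    have "norm (integral {z (Suc j)..z j} (\<lambda>x. K (z (Suc j)) - K x)) \<le> (L * l) * (z j - z (Suc j))"
    proof (rule integral_bound[OF le])
      show "continuous_on {z (Suc j)..z j} (\<lambda>x. K (z (Suc j)) - K x)" by (intro continuous_intros cont)
      have L: "0 \<le> L" using lip[of 0 1] abs_ge_zero[of "K 0 - K 1"] by simp
      show "norm (K (z (Suc j)) - K x) \<le> L * l" if "x \<in> {z (Suc j)..z j}" for x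
      proof -
        have "\<bar>z (Suc j) - x\<bar> \<le> l" using that z_Suc[of j] by auto
        then show ?thesis
          using order_trans[OF lip[of "z (Suc j)" x] mult_left_mono[OF _ L]] by simp
      qed
    qed
    moreover have "integral {z (Suc j)..z j} (\<lambda>x. K (z (Suc j)) - K x)
        = (z j - z (Suc j)) * K (z (Suc j)) - integral {z (Suc j)..z j} K"
      using le by (subst integral_diff) (auto intro: Ki)
    ultimately show ?thesis using True z_Suc[of j] by (simp add: power2_eq_square)
  next
    case False
    \<comment> \<open>A cell has length at most 1, so one with an endpoint beyond
      \<open>A + 1\<close> misses the support.\<close>
    then have big: "A + 1 < \<bar>z (Suc j)\<bar>"
      using T by (simp add: z_def abs_divide less_divide_eq)
    have "K x = 0" if "x \<in> {z (Suc j)..z j}" for x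
    proof (rule ccontr)
      assume "K x \<noteq> 0"
      then have "\<bar>x\<bar> \<le> A" by (rule supp)
      then show False using big that l z_Suc[of j] by auto
    qed
    moreover from this have "integral {z (Suc j)..z j} K = integral {z (Suc j)..z j} (\<lambda>_. 0)"
      by (intro integral_cong)
    ultimately show ?thesis using False l z_Suc[of j] by simp
  qed
  have "(\<Sum>j\<in>{1..T}. K ((u - real j / real T) / h)) = (\<Sum>j<T. K (z (Suc j)))"
    unfolding z_def by (rule sum.reindex_bij_witness[of _ Suc "\<lambda>j. j - 1"]) auto
  then have "1 / (real T * h) * (\<Sum>j\<in>{1..T}. K ((u - real j / real T) / h)) - 1
      = (\<Sum>j<T. l * K (z (Suc j)) - integral {z (Suc j)..z j} K)"
    using split[of T] total by (simp add: l_def sum_subtractf sum_distrib_left)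
  also have "\<bar>\<dots>\<bar> \<le> (\<Sum>j<T. if \<bar>u - real (Suc j) / real T\<bar> \<le> (A + 1) * h then L * l\<^sup>2 else 0)"
    by (rule order_trans[OF sum_abs]) (intro sum_mono piece)
  also have "\<dots> = (\<Sum>j\<in>{1..T}. if \<bar>u - real j / real T\<bar> \<le> (A + 1) * h then L * l\<^sup>2 else 0)"
    by (rule sum.reindex_bij_witness[of _ "\<lambda>j. j - 1" Suc]) auto
  also have "\<dots> = L * l\<^sup>2 * real (card {j\<in>{1..T}. \<bar>u - real j / real T\<bar> \<le> (A + 1) * h})"
    by (subst sum.inter_filter[symmetric]) auto
  finally show ?thesis by (simp add: l_def power_divide)
qed

text \<open>The centred observation is \<open>Z j + E j\<close>, where \<open>E j\<close> collects
  the local bias, of size \<open>\<eta>0\<close> in the window, and the local mean;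
  \<open>\<eta>\<close> bounds their sum. The perturbation lemma replaces the observations by
  \<open>Z\<close>, and \<open>quad\<close> bounds what remains. The constant \<open>\<rho>\<close>
  counts the at most \<open>(2 * R + 1) * b\<close> nonzero entries of a row.\<close>

lemma (in prob_space) c_hat_error:
  fixes X Z :: "nat \<Rightarrow> 'a \<Rightarrow> 'b::euclidean_space L2" and \<gamma> :: "nat \<Rightarrow> nat \<Rightarrow> ('b \<times> 'b) L2"
  assumes T: "1 \<le> T" "0 < h" "N = real T * h" "1 \<le> N" and b: "1 \<le> b" "R * b \<le> N"
    and K1: "\<And>z. \<bar>K1 z\<bar> \<le> C1" "\<And>z. K1 z \<noteq> 0 \<Longrightarrow> \<bar>z\<bar> \<le> A" "0 \<le> A"
    and K2: "\<And>z. \<bar>K2 z\<bar> \<le> C2" "\<And>z. K2 z \<noteq> 0 \<Longrightarrow> \<bar>z\<bar> \<le> R" "0 \<le> R" "K2 0 = 1"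
    and D: "0 \<le> D"
    and lin: "\<And>J a. J \<subseteq> {1..T} \<Longrightarrow>
      Lp_le M 2 (\<lambda>\<omega>. \<Sum>t\<in>J. a t *\<^sub>R Z t \<omega>) (D * sqrt (\<Sum>t\<in>J. (a t)\<^sup>2))"
    and quad: "\<And>J a \<rho>. J \<subseteq> {1..T} \<Longrightarrow> (\<And>j. j \<in> J \<Longrightarrow> (\<Sum>k\<in>J. (a j k)\<^sup>2) \<le> \<rho>) \<Longrightarrow>
      (\<And>k. k \<in> J \<Longrightarrow> (\<Sum>j\<in>J. (a j k)\<^sup>2) \<le> \<rho>) \<Longrightarrow>
      Lp_le M 2 (\<lambda>\<omega>. (\<Sum>j\<in>J. \<Sum>k\<in>J. a j k *\<^sub>R (Z j \<omega> \<otimes>\<^sub>2 Z k \<omega>)) - (\<Sum>j\<in>J. \<Sum>k\<in>J. a j k *\<^sub>R \<gamma> j k))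
        (6 * D\<^sup>2 * sqrt (\<rho> * card J))"
    and near: "\<And>t. t \<in> {1..T} \<Longrightarrow>
      Lp_le M 2 (\<lambda>\<omega>. X t \<omega> - Z t \<omega>) ((\<bar>real t / real T - u\<bar> + 1 / real T) * C)" and C: "0 \<le> C"
    and c: "c = 2 * A + 3" and \<rho>: "\<rho> = (C1 * C2)\<^sup>2 * ((2 * R + 1) * b)"
    and \<eta>0: "\<eta>0 = (A + 2) * h * C" and \<eta>: "\<eta> = \<eta>0 + (D * (C1 * sqrt c) / sqrt N + C1 * c * \<eta>0)"
  shows "Lp_le M 1 (\<lambda>\<omega>. c_hat K1 K2 h b u T (\<lambda>t. X t \<omega>)
      - (1 / N) *\<^sub>R (\<Sum>j\<in>{1..T}. \<Sum>k\<in>{1..T}. lag_weight K1 K2 h b u T j k *\<^sub>R \<gamma> j k))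
    (c * (2 * \<eta> * (D * sqrt \<rho>) + C1 * C2 * ((2 * R + 1) * b) * \<eta>\<^sup>2) + 6 * D\<^sup>2 * sqrt (\<rho> * (c * N)) / N)"
proof -
  define J where "J = {j\<in>{1..T}. \<bar>u - real j / real T\<bar> \<le> (A + 1) * h}"
  define a where "a = lag_weight K1 K2 h b u T"
  define w where "w t = K1 ((u - real t / real T) / h)" for t
  have J: "J \<subseteq> {1..T}" "finite J" by (auto simp: J_def)
  have N: "0 < N" using T by simp
  have C12: "0 \<le> C1" "0 \<le> C2" using K1(1)[of 0] K2(1)[of 0] by linarith+
  have c0: "0 \<le> c" using c K1(3) by simp
  have card_J: "real (card J) \<le> c * N"
    using card_near_le[OF T(2) _ K1(3) T(1), of u] T by (simp add: J_def c)
  have \<rho>0: "0 \<le> \<rho>" using K2(3) b by (simp add: \<rho>)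
  have \<eta>00: "0 \<le> \<eta>0" using K1(3) T C by (simp add: \<eta>0)
  have w_le: "\<bar>w t\<bar> \<le> C1" for t by (simp add: w_def K1)
  have wJ: "w t = 0" if "t \<in> {1..T}" "t \<notin> J" for t
  proof (rule ccontr)
    assume "w t \<noteq> 0"
    then have "\<bar>(u - real t / real T) / h\<bar> \<le> A" unfolding w_def by (rule K1)
    then have "\<bar>u - real t / real T\<bar> \<le> A * h" using T by (simp add: abs_divide divide_le_eq)
    also have "\<dots> \<le> (A + 1) * h" using T by (simp add: algebra_simps)
    finally show False using that by (simp add: J_def)
  qed
  have a_lag: "real (max j k - min j k) \<le> R * b" if "a j k \<noteq> 0" for j k
  proof -
    have "\<bar>real (max j k - min j k) / b\<bar> \<le> R" using that unfolding a_def lag_weight_def by (intro K2) auto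
    then show ?thesis using b by (simp add: abs_divide divide_le_eq)
  qed
  \<comment> \<open>The later index lies in the kernel support and the earlier one at most R b \<le>
    N = T h steps before it, which is a rescaled distance of at most \<open>h\<close>.\<close>
  have aJ: "j \<in> J \<and> k \<in> J" if "j \<in> {1..T}" "k \<in> {1..T}" "a j k \<noteq> 0" for j k
  proof -
    define m n where "m = max j k" and "n = min j k"
    have "n \<le> m" by (simp add: m_def n_def)
    have mn: "m \<in> {1..T}" "n \<in> {1..T}" "real m - real n \<le> R * b"
      using that a_lag[of j k] \<open>n \<le> m\<close> by (auto simp: m_def n_def of_nat_diff split: if_splits)
    have "w m \<noteq> 0" using that(3) by (auto simp: a_def lag_weight_def w_def m_def)
    then have "\<bar>(u - real m / real T) / h\<bar> \<le> A" unfolding w_def by (rule K1)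
    then have m: "\<bar>u - real m / real T\<bar> \<le> A * h" using T by (simp add: abs_divide divide_le_eq)
    have "real m - real n \<le> real T * h" using mn b T by simp
    then have "(real m - real n) / real T \<le> h" using T by (simp add: divide_le_eq mult.commute)
    then have d: "real m / real T - real n / real T \<le> h" by (simp add: diff_divide_distrib)
    have "real n / real T \<le> real m / real T" using \<open>n \<le> m\<close> by (simp add: divide_right_mono)
    with m d have "\<bar>u - real n / real T\<bar> \<le> (A + 1) * h" "\<bar>u - real m / real T\<bar> \<le> (A + 1) * h"
      using T by (auto simp: abs_le_iff algebra_simps)
    then have "m \<in> J" "n \<in> J" using mn by (auto simp: J_def)
    then show ?thesis by (auto simp: m_def n_def max_def min_def split: if_splits)
  qed
  have a0: "a j k = 0" if "j \<in> {1..T}" "k \<in> {1..T}" "j \<notin> J \<or> k \<notin> J" for j k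
    using aJ[OF that(1,2)] that(3) by blast
  have restrict: "(\<Sum>j\<in>{1..T}. \<Sum>k\<in>{1..T}. a j k *\<^sub>R G j k) = (\<Sum>j\<in>J. \<Sum>k\<in>J. a j k *\<^sub>R G j k)"
    for G :: "nat \<Rightarrow> nat \<Rightarrow> ('b \<times> 'b) L2"
  proof -
    have "(\<Sum>j\<in>{1..T}. \<Sum>k\<in>{1..T}. a j k *\<^sub>R G j k) = (\<Sum>j\<in>{1..T}. \<Sum>k\<in>J. a j k *\<^sub>R G j k)"
      using J by (intro sum.cong[OF refl sum.mono_neutral_right]) (auto simp: a0)
    also have "\<dots> = (\<Sum>j\<in>J. \<Sum>k\<in>J. a j k *\<^sub>R G j k)"
    proof (rule sum.mono_neutral_right)
      show "\<forall>j\<in>{1..T} - J. (\<Sum>k\<in>J. a j k *\<^sub>R G j k) = 0"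
        using J by (intro ballI sum.neutral) (auto simp: a0)
    qed (use J in auto)
    finally show ?thesis .
  qed
  have a_le: "\<bar>a j k\<bar> \<le> (if real (max j k - min j k) \<le> R * b then C1 * C2 else 0)" for j k
  proof (cases "a j k = 0")
    case True
    then show ?thesis using C12 by simp
  next
    case False
    have "\<bar>a j k\<bar> \<le> C1 * C2"
      unfolding a_def lag_weight_def abs_mult by (intro mult_mono K1 K2 C12) auto
    then show ?thesis using a_lag[OF False] by simp
  qed
  \<comment> \<open>At most 2 R b + 1 integers lie within R b of \<open>j\<close>, and
    \<open>1 \<le> b\<close> absorbs the 1.\<close>
  have card_lag: "real (card {k\<in>J. real (max j k - min j k) \<le> R * b}) \<le> (2 * R + 1) * b" for j
  proof -
    have "real (card {k\<in>J. real (max j k - min j k) \<le> R * b}) \<le> (real j + R * b) - (real j - R * b) + 1"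
    proof (rule card_nat_between)
      fix k assume "k \<in> {k\<in>J. real (max j k - min j k) \<le> R * b}"
      then show "real j - R * b \<le> real k \<and> real k \<le> real j + R * b"
        by (auto simp: max_def min_def of_nat_diff split: if_splits)
    next
      have "0 \<le> R * b" using K2 b by simp
      then show "real j - R * b \<le> real j + R * b + 1" by linarith
    qed (use J in auto)
    then show ?thesis using b by (simp add: algebra_simps)
  qed
  have abs_row: "(\<Sum>k\<in>J. \<bar>a j k\<bar>) \<le> C1 * C2 * ((2 * R + 1) * b)" for j
  proof -
    have "(\<Sum>k\<in>J. \<bar>a j k\<bar>) \<le> (\<Sum>k\<in>J. if real (max j k - min j k) \<le> R * b then C1 * C2 else 0)"
      by (intro sum_mono a_le)
    also have "\<dots> = C1 * C2 * real (card {k\<in>J. real (max j k - min j k) \<le> R * b})"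
      using J by (subst sum.inter_filter[symmetric]) auto
    also have "\<dots> \<le> C1 * C2 * ((2 * R + 1) * b)"
      using C12 by (intro mult_left_mono card_lag) auto
    finally show ?thesis .
  qed
  have sq_row: "(\<Sum>k\<in>J. (a j k)\<^sup>2) \<le> \<rho>" for j
  proof -
    have "(a j k)\<^sup>2 \<le> C1 * C2 * \<bar>a j k\<bar>" for k
    proof -
      have "\<bar>a j k\<bar> \<le> C1 * C2" using a_le[of j k] C12 by (auto split: if_splits)
      then have "\<bar>a j k\<bar> * \<bar>a j k\<bar> \<le> C1 * C2 * \<bar>a j k\<bar>" by (rule mult_right_mono) simp
      then show ?thesis by (simp add: power2_eq_square)
    qed
    then have "(\<Sum>k\<in>J. (a j k)\<^sup>2) \<le> C1 * C2 * (\<Sum>k\<in>J. \<bar>a j k\<bar>)"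
      unfolding sum_distrib_left by (intro sum_mono)
    also have "\<dots> \<le> C1 * C2 * (C1 * C2 * ((2 * R + 1) * b))"
      using C12 by (intro mult_left_mono abs_row) auto
    finally show ?thesis by (simp add: \<rho> power2_eq_square mult_ac)
  qed
  have a_comm: "a j k = a k j" for j k unfolding a_def by (rule lag_weight_commute)
  have sq_col: "(\<Sum>j\<in>J. (a j k)\<^sup>2) \<le> \<rho>" for k
    using sq_row[of k] by (simp add: a_comm[of _ k])
  define xbar where "xbar \<omega> = local_mean K1 h u T (\<lambda>t. X t \<omega>)" for \<omega>
  have nearJ: "Lp_le M 2 (\<lambda>\<omega>. X t \<omega> - Z t \<omega>) \<eta>0" if "t \<in> J" for t
  proof (rule Lp_le_mono[OF near])
    show "t \<in> {1..T}" using that J by auto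
    have "1 / real T \<le> h" using T by (simp add: divide_le_eq mult.commute)
    moreover have "\<bar>real t / real T - u\<bar> \<le> (A + 1) * h"
      using that by (simp add: J_def abs_minus_commute)
    ultimately have "\<bar>real t / real T - u\<bar> + 1 / real T \<le> (A + 2) * h" by (simp add: algebra_simps)
    then show "(\<bar>real t / real T - u\<bar> + 1 / real T) * C \<le> \<eta>0"
      unfolding \<eta>0 using C by (intro mult_right_mono)
  qed
  \<comment> \<open>The stationary part of the mean is bounded by cancellation, of order
    \<open>1 / sqrt N\<close>; its bias part only by the triangle inequality, of order
    \<open>\<eta>0\<close>.\<close>
  have xbar_eq: "xbar \<omega> = (1 / N) *\<^sub>R ((\<Sum>t\<in>J. w t *\<^sub>R Z t \<omega>) + (\<Sum>t\<in>J. w t *\<^sub>R (X t \<omega> - Z t \<omega>)))" for \<omega>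
  proof -
    have "xbar \<omega> = (1 / N) *\<^sub>R (\<Sum>t\<in>{1..T}. w t *\<^sub>R X t \<omega>)"
      by (simp add: xbar_def local_mean_def w_def T)
    also have "(\<Sum>t\<in>{1..T}. w t *\<^sub>R X t \<omega>) = (\<Sum>t\<in>J. w t *\<^sub>R X t \<omega>)"
      using J wJ by (intro sum.mono_neutral_right) auto
    finally show ?thesis by (simp add: scaleR_diff_right sum_subtractf)
  qed
  have xbar: "Lp_le M 2 xbar (D * (C1 * sqrt c) / sqrt N + C1 * c * \<eta>0)"
  proof -
    have "Lp_le M 2 (\<lambda>\<omega>. (\<Sum>t\<in>J. w t *\<^sub>R Z t \<omega>) + (\<Sum>t\<in>J. w t *\<^sub>R (X t \<omega> - Z t \<omega>)))
        (D * sqrt (\<Sum>t\<in>J. (w t)\<^sup>2) + (\<Sum>t\<in>J. \<bar>w t\<bar> * \<eta>0))"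
      by (intro Lp_le_add lin J Lp_le_sum Lp_le_scaleR[OF nearJ]) auto
    then have "Lp_le M 2 (\<lambda>\<omega>. (1 / N) *\<^sub>R ((\<Sum>t\<in>J. w t *\<^sub>R Z t \<omega>) + (\<Sum>t\<in>J. w t *\<^sub>R (X t \<omega> - Z t \<omega>))))
        (D * (C1 * sqrt c) / sqrt N + C1 * c * \<eta>0)"
    proof (rule Lp_le_scaleR)
      have "(\<Sum>t\<in>J. (w t)\<^sup>2) \<le> (\<Sum>t\<in>J. C1\<^sup>2)"
        using w_le C12 by (intro sum_mono) (simp flip: abs_le_square_iff)
      also have "\<dots> \<le> C1\<^sup>2 * (c * N)"
        using mult_left_mono[OF card_J, of "C1\<^sup>2"] by (simp add: mult.commute)
      finally have "sqrt (\<Sum>t\<in>J. (w t)\<^sup>2) \<le> sqrt (C1\<^sup>2 * (c * N))" by simp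
      also have "\<dots> = C1 * sqrt c * sqrt N" using C12 by (simp add: real_sqrt_mult)
      finally have 1: "D * sqrt (\<Sum>t\<in>J. (w t)\<^sup>2) \<le> D * (C1 * sqrt c * sqrt N)"
        using D by (rule mult_left_mono)
      have "(\<Sum>t\<in>J. \<bar>w t\<bar> * \<eta>0) \<le> (\<Sum>t\<in>J. C1 * \<eta>0)"
        using \<eta>00 w_le by (intro sum_mono mult_right_mono) auto
      also have "\<dots> \<le> c * N * (C1 * \<eta>0)"
        using mult_right_mono[OF card_J, of "C1 * \<eta>0"] \<eta>00 C12 by simp
      finally have 2: "(\<Sum>t\<in>J. \<bar>w t\<bar> * \<eta>0) \<le> c * N * (C1 * \<eta>0)" .
      have "\<bar>1 / N\<bar> * (D * sqrt (\<Sum>t\<in>J. (w t)\<^sup>2) + (\<Sum>t\<in>J. \<bar>w t\<bar> * \<eta>0))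
          \<le> \<bar>1 / N\<bar> * (D * (C1 * sqrt c * sqrt N) + c * N * (C1 * \<eta>0))"
        by (intro mult_left_mono add_mono 1 2) simp
      also have "\<dots> = D * (C1 * sqrt c) * (sqrt N / N) + C1 * c * \<eta>0"
        using N by (simp add: field_simps)
      also have "sqrt N / N = 1 / sqrt N"
        using N by (simp add: field_simps)
      finally show "\<bar>1 / N\<bar> * (D * sqrt (\<Sum>t\<in>J. (w t)\<^sup>2) + (\<Sum>t\<in>J. \<bar>w t\<bar> * \<eta>0))
          \<le> D * (C1 * sqrt c) / sqrt N + C1 * c * \<eta>0" by simp
    qed
    then show ?thesis by (simp only: xbar_eq[symmetric])
  qed
  \<comment> \<open>The local mean is the same for all \<open>j\<close>, yet it may be treated as a
    perturbation like the bias, since only its norm matters.\<close>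
  define E where "E j \<omega> = (X j \<omega> - Z j \<omega>) - xbar \<omega>" for j \<omega>
  have E: "Lp_le M 2 (E j) \<eta>" if "j \<in> J" for j
    unfolding E_def \<eta> by (rule Lp_le_diff[OF nearJ[OF that] xbar])
  then have \<eta>_nonneg: "0 \<le> \<eta>"
    using \<eta>00 C12 c0 D N by (simp add: \<eta>)
  define V where "V \<omega> = (\<Sum>j\<in>J. \<Sum>k\<in>J. a j k *\<^sub>R (Z j \<omega> \<otimes>\<^sub>2 Z k \<omega>))" for \<omega>
  define V' where "V' \<omega> = (\<Sum>j\<in>J. \<Sum>k\<in>J. a j k *\<^sub>R ((Z j \<omega> + E j \<omega>) \<otimes>\<^sub>2 (Z k \<omega> + E k \<omega>)))" for \<omega>
  define m where "m = (\<Sum>j\<in>J. \<Sum>k\<in>J. a j k *\<^sub>R \<gamma> j k)"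
  have norm_t: "norm (x \<otimes>\<^sub>2 y) \<le> norm x * norm y" for x y :: "'b L2" by (simp add: norm_tensor)
  have row: "Lp_le M 2 (\<lambda>\<omega>. \<Sum>k\<in>J. a j k *\<^sub>R Z k \<omega>) (D * sqrt \<rho>)" for j
    using D sq_row by (intro Lp_le_mono[OF lin[OF J(1)]] mult_left_mono) auto
  have col: "Lp_le M 2 (\<lambda>\<omega>. \<Sum>j\<in>J. a j k *\<^sub>R Z j \<omega>) (D * sqrt \<rho>)" for k
    using row[of k] by (simp add: a_comm[of _ k])
  have P: "Lp_le M 1 (\<lambda>\<omega>. V' \<omega> - V \<omega>)
      (real (card J) * (2 * \<eta> * (D * sqrt \<rho>) + C1 * C2 * ((2 * R + 1) * b) * \<eta>\<^sup>2))"
    unfolding V_def V'_def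
    by (rule quadratic_perturbation[OF bounded_bilinear_tensor norm_t E row col abs_row])
  have Q: "Lp_le M 1 (\<lambda>\<omega>. V \<omega> - m) (6 * D\<^sup>2 * sqrt (\<rho> * card J))"
    unfolding V_def m_def by (rule Lp_le_2_1[OF quad[OF J(1) sq_row sq_col]])
  have "c_hat K1 K2 h b u T (\<lambda>t. X t \<omega>) - (1 / N) *\<^sub>R (\<Sum>j\<in>{1..T}. \<Sum>k\<in>{1..T}. a j k *\<^sub>R \<gamma> j k)
      = (1 / N) *\<^sub>R ((V' \<omega> - V \<omega>) + (V \<omega> - m))" for \<omega>
  proof -
    have "c_hat K1 K2 h b u T (\<lambda>t. X t \<omega>)
        = (1 / N) *\<^sub>R (\<Sum>j\<in>{1..T}. \<Sum>k\<in>{1..T}. a j k *\<^sub>R ((Z j \<omega> + E j \<omega>) \<otimes>\<^sub>2 (Z k \<omega> + E k \<omega>)))"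
      unfolding T(3) a_def by (rule c_hat_eq_sum[of K2, OF K2(4)]) (simp add: E_def xbar_def)
    then show ?thesis
      unfolding restrict V'_def m_def by (simp add: scaleR_diff_right)
  qed
  moreover have "Lp_le M 1 (\<lambda>\<omega>. (1 / N) *\<^sub>R ((V' \<omega> - V \<omega>) + (V \<omega> - m)))
    (c * (2 * \<eta> * (D * sqrt \<rho>) + C1 * C2 * ((2 * R + 1) * b) * \<eta>\<^sup>2) + 6 * D\<^sup>2 * sqrt (\<rho> * (c * N)) / N)"
  proof (rule Lp_le_scaleR[OF Lp_le_add[OF P Q]])
    let ?e = "2 * \<eta> * (D * sqrt \<rho>) + C1 * C2 * ((2 * R + 1) * b) * \<eta>\<^sup>2"
    have "0 \<le> ?e" using \<eta>_nonneg D \<rho>0 C12 K2(3) b by simp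
    then have "real (card J) * ?e \<le> c * N * ?e" by (rule mult_right_mono[OF card_J])
    moreover have "6 * D\<^sup>2 * sqrt (\<rho> * card J) \<le> 6 * D\<^sup>2 * sqrt (\<rho> * (c * N))"
      using card_J \<rho>0 by (intro mult_left_mono real_sqrt_le_mono) auto
    ultimately have "\<bar>1 / N\<bar> * (real (card J) * ?e + 6 * D\<^sup>2 * sqrt (\<rho> * card J))
        \<le> \<bar>1 / N\<bar> * (c * N * ?e + 6 * D\<^sup>2 * sqrt (\<rho> * (c * N)))"
      by (rule mult_left_mono[OF add_mono]) simp
    also have "\<dots> = c * ?e + 6 * D\<^sup>2 * sqrt (\<rho> * (c * N)) / N"
      using N by (simp add: add_divide_distrib)
    finally show "\<bar>1 / N\<bar> * (real (card J) * ?e + 6 * D\<^sup>2 * sqrt (\<rho> * card J))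
        \<le> c * ?e + 6 * D\<^sup>2 * sqrt (\<rho> * (c * N)) / N" .
  qed
  ultimately show ?thesis by (simp only: a_def)
qed

section \<open>Limit of the expectation\<close>

lemma tendsto_suminf_scaleR:
  fixes \<Gamma> :: "nat \<Rightarrow> 'k::banach" and g :: "nat \<Rightarrow> nat \<Rightarrow> real"
  assumes lim: "\<And>s. g s \<longlonglongrightarrow> 1" and bound: "\<forall>\<^sub>F T in sequentially. \<forall>s. \<bar>g s T\<bar> \<le> C"
    and summable: "summable (\<lambda>s. norm (\<Gamma> s))"
  shows "(\<lambda>T. \<Sum>s. g s T *\<^sub>R \<Gamma> s) \<longlonglongrightarrow> suminf \<Gamma>"
proof -
  have sm: "summable (\<lambda>s. \<bar>g s T - 1\<bar> * norm (\<Gamma> s))" and smg: "summable (\<lambda>s. g s T *\<^sub>R \<Gamma> s)"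
    if "\<forall>s. \<bar>g s T\<bar> \<le> C" for T
  proof -
    have "\<bar>g s T - 1\<bar> \<le> C + 1" for s using that[rule_format, of s] by linarith
    then have "summable (\<lambda>s. norm (\<bar>g s T - 1\<bar> * norm (\<Gamma> s)))"
      by (intro summable_comparison_test'[OF summable_mult[OF summable, of "C + 1"], of 0])
        (auto simp: abs_mult intro!: mult_right_mono)
    then show "summable (\<lambda>s. \<bar>g s T - 1\<bar> * norm (\<Gamma> s))" by (rule summable_norm_cancel)
    show "summable (\<lambda>s. g s T *\<^sub>R \<Gamma> s)"
      by (intro summable_comparison_test'[OF summable_mult[OF summable, of C], of 0])
        (auto intro!: mult_right_mono simp: that)
  qed
  \<comment> \<open>Tannery's theorem is applied to this real series, dominated by
    \<open>(C + 1) * norm (\<Gamma> k)\<close>; the vector-valued difference is then compared with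
    it in norm.\<close>
  have "(\<lambda>T. \<Sum>s. \<bar>g s T - 1\<bar> * norm (\<Gamma> s)) \<longlonglongrightarrow> (\<Sum>s. 0)"
  proof (rule tannerys_theorem[THEN conjunct2, THEN conjunct2])
    show "(\<lambda>T. \<bar>g s T - 1\<bar> * norm (\<Gamma> s)) \<longlonglongrightarrow> 0" for s
    proof -
      have "(\<lambda>T. \<bar>g s T - 1\<bar> * norm (\<Gamma> s)) \<longlonglongrightarrow> \<bar>1 - 1\<bar> * norm (\<Gamma> s)"
        by (intro tendsto_intros lim)
      then show ?thesis by simp
    qed
    show "\<forall>\<^sub>F (k, n) in at_top \<times>\<^sub>F sequentially. norm (\<bar>g k n - 1\<bar> * norm (\<Gamma> k)) \<le> (C + 1) * norm (\<Gamma> k)"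
      using eventually_prodI[OF eventually_True[of at_top] bound]
    proof eventually_elim
      case (elim p)
      then have "\<bar>g (fst p) (snd p)\<bar> \<le> C" by blast
      then have "\<bar>g (fst p) (snd p) - 1\<bar> \<le> C + 1" by linarith
      then show ?case by (auto simp: split_beta intro!: mult_right_mono)
    qed
    show "summable (\<lambda>k. (C + 1) * norm (\<Gamma> k))" by (rule summable_mult[OF summable])
  qed simp
  then have lim0: "(\<lambda>T. \<Sum>s. \<bar>g s T - 1\<bar> * norm (\<Gamma> s)) \<longlonglongrightarrow> 0" by simp
  have "(\<lambda>T. (\<Sum>s. g s T *\<^sub>R \<Gamma> s) - suminf \<Gamma>) \<longlonglongrightarrow> 0"
  proof (rule Lim_null_comparison[OF _ lim0])
    show "\<forall>\<^sub>F T in sequentially. norm ((\<Sum>s. g s T *\<^sub>R \<Gamma> s) - suminf \<Gamma>) \<le> (\<Sum>s. \<bar>g s T - 1\<bar> * norm (\<Gamma> s))"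
      using bound
    proof eventually_elim
      case (elim T)
      have "(\<Sum>s. g s T *\<^sub>R \<Gamma> s) - suminf \<Gamma> = (\<Sum>s. (g s T - 1) *\<^sub>R \<Gamma> s)"
        using suminf_diff[OF smg[OF elim] summable_norm_cancel[OF summable]]
        by (simp add: scaleR_diff_left)
      also have "norm \<dots> \<le> (\<Sum>s. norm ((g s T - 1) *\<^sub>R \<Gamma> s))"
        using sm[OF elim] by (intro summable_norm) simp
      finally show ?case by simp
    qed
  qed
  then show ?thesis by (rule LIM_zero_cancel)
qed

text \<open>By stationarity the double sum collapses to a series over lags. The coefficient of lag t
  is K2(t/b) times the kernel mass without its first t points; it tends to 1 for fixed t and is
  bounded uniformly in t, while the autocovariances are summable.\<close>

lemma weighted_autocovariance_tendsto:
  fixes \<gamma> :: "int \<Rightarrow> int \<Rightarrow> 'k::banach" and h b :: "nat \<Rightarrow> real" and K1 K2 :: "real \<Rightarrow> real" and u :: real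
  defines "w \<equiv> \<lambda>T j. K1 ((u - real j / real T) / h T)"
  defines "N \<equiv> \<lambda>T. real T * h T"
  assumes shift: "\<And>j k s. \<gamma> (j + s) (k + s) = \<gamma> j k"
    and sm: "summable (\<lambda>m. norm (\<gamma> 0 (int m)))" "summable (\<lambda>m. norm (\<gamma> (int m) 0))"
    and K1: "\<And>z. \<bar>K1 z\<bar> \<le> C1" and K2: "\<And>z. \<bar>K2 z\<bar> \<le> C2" "K2 0 = 1" "continuous (at_right 0) K2"
    and N: "filterlim N at_top sequentially" and b: "filterlim b at_top sequentially"
    and mass: "(\<lambda>T. 1 / N T * (\<Sum>j\<in>{1..T}. w T j)) \<longlonglongrightarrow> 1"
    and abs_mass: "\<forall>\<^sub>F T in sequentially. 1 / N T * (\<Sum>j\<in>{1..T}. \<bar>w T j\<bar>) \<le> C"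
  shows "(\<lambda>T. (1 / N T) *\<^sub>R (\<Sum>j\<in>{1..T}. \<Sum>k\<in>{1..T}.
      lag_weight K1 K2 (h T) (b T) u T j k *\<^sub>R \<gamma> (int j) (int k)))
    \<longlonglongrightarrow> \<gamma> 0 0 + (\<Sum>t. \<gamma> 0 (int (Suc t))) + (\<Sum>t. \<gamma> (int (Suc t)) 0)"
proof -
  define W where "W s T = 1 / N T * (\<Sum>j\<in>{s + 1..T}. w T j)" for s T
  define \<Gamma> where "\<Gamma> s = \<gamma> (int (Suc s)) 0 + \<gamma> 0 (int (Suc s))" for s
  \<comment> \<open>The index \<open>s\<close> stands for lag \<open>Suc s\<close>; the value 0
    beyond lag \<open>T - 1\<close> turns the finite sum into a series with fixed range.\<close>
  define g where "g s T = (if s < T - 1 then K2 (real (Suc s) / b T) * W (Suc s) T else 0)" for s T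
  have C12: "0 \<le> C1" "0 \<le> C2" using K1[of 0] K2(1)[of 0] by linarith+
  have Npos: "\<forall>\<^sub>F T in sequentially. 0 < N T" using N by (simp add: filterlim_at_top_dense)
  have sm1: "summable (\<lambda>t. \<gamma> 0 (int (Suc t)))" "summable (\<lambda>t. \<gamma> (int (Suc t)) 0)"
    using sm[THEN summable_norm_cancel] by (simp_all only: summable_Suc_iff[of "\<lambda>t. \<gamma> 0 (int t)"] summable_Suc_iff[of "\<lambda>t. \<gamma> (int t) 0"])
  have smn: "summable (\<lambda>t. norm (\<gamma> 0 (int (Suc t))))" "summable (\<lambda>t. norm (\<gamma> (int (Suc t)) 0))"
    using sm by (simp_all only: summable_Suc_iff[of "\<lambda>t. norm (\<gamma> 0 (int t))"] summable_Suc_iff[of "\<lambda>t. norm (\<gamma> (int t) 0)"])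
  have \<Gamma>_sum: "summable (\<lambda>s. norm (\<Gamma> s))"
    by (rule summable_comparison_test'[OF summable_add[OF smn(2) smn(1)], of 0])
      (simp add: \<Gamma>_def norm_triangle_ineq)
  have \<Gamma>_inf: "suminf \<Gamma> = (\<Sum>t. \<gamma> 0 (int (Suc t))) + (\<Sum>t. \<gamma> (int (Suc t)) 0)"
    unfolding \<Gamma>_def using suminf_add[OF sm1(2) sm1(1)] by (simp add: add.commute)
  have eq: "(1 / N T) *\<^sub>R (\<Sum>j\<in>{1..T}. \<Sum>k\<in>{1..T}. lag_weight K1 K2 (h T) (b T) u T j k *\<^sub>R \<gamma> (int j) (int k))
      = W 0 T *\<^sub>R \<gamma> 0 0 + (\<Sum>s. g s T *\<^sub>R \<Gamma> s)" for T
  proof -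
    have sh: "\<gamma> (int j) (int j) = \<gamma> 0 0" for j using shift[of 0 "int j" 0] by simp
    have sh2: "\<gamma> (int j) (int j - int t) = \<gamma> (int t) 0" "\<gamma> (int j - int t) (int j) = \<gamma> 0 (int t)" for j t
      using shift[of "int t" "int j - int t" 0] shift[of 0 "int j - int t" "int t"] by simp_all
    have "(\<Sum>j\<in>{1..T}. \<Sum>k\<in>{1..T}. lag_weight K1 K2 (h T) (b T) u T j k *\<^sub>R \<gamma> (int j) (int k))
      = (\<Sum>j\<in>{1..T}. w T j *\<^sub>R \<gamma> 0 0) + (\<Sum>t\<in>{1..T - 1}. K2 (real t / b T) *\<^sub>R
          (\<Sum>j\<in>{t + 1..T}. w T j *\<^sub>R (\<gamma> (int t) 0 + \<gamma> 0 (int t))))"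
      unfolding sum_lag_weight[of K2, OF K2(2)] w_def
      by (intro arg_cong2[of _ _ _ _ "(+)"] sum.cong refl arg_cong2[of _ _ _ _ scaleR]) (auto simp: sh sh2 of_nat_diff)
    also have "\<dots> = (\<Sum>j\<in>{1..T}. w T j) *\<^sub>R \<gamma> 0 0 + (\<Sum>t\<in>{1..T - 1}. K2 (real t / b T) *\<^sub>R
          (\<Sum>j\<in>{t + 1..T}. w T j) *\<^sub>R (\<gamma> (int t) 0 + \<gamma> 0 (int t)))"
      by (simp only: scaleR_sum_left)
    also have "(1 / N T) *\<^sub>R \<dots> = W 0 T *\<^sub>R \<gamma> 0 0
        + (\<Sum>t\<in>{1..T - 1}. (K2 (real t / b T) * W t T) *\<^sub>R (\<gamma> (int t) 0 + \<gamma> 0 (int t)))"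
      by (simp add: W_def scaleR_add_right[of "1 / N T"] scaleR_sum_right mult_ac)
    also have "(\<Sum>t\<in>{1..T - 1}. (K2 (real t / b T) * W t T) *\<^sub>R (\<gamma> (int t) 0 + \<gamma> 0 (int t)))
        = (\<Sum>s<T - 1. g s T *\<^sub>R \<Gamma> s)"
      by (rule sum.reindex_bij_witness[of _ Suc "\<lambda>j. j - 1"]) (auto simp: g_def \<Gamma>_def)
    also have "\<dots> = (\<Sum>s. g s T *\<^sub>R \<Gamma> s)"
      by (rule suminf_finite[symmetric]) (auto simp: g_def)
    finally show ?thesis .
  qed
  have W0: "W 0 \<longlonglongrightarrow> 1" using mass by (simp add: W_def[abs_def])
  have Ws: "W s \<longlonglongrightarrow> 1" for s
  proof -
    \<comment> \<open>Dropping \<open>s\<close> bounded terms from a sum normalised by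
      \<open>N T\<close> is negligible.\<close>
    have "(\<lambda>T. W 0 T - W s T) \<longlonglongrightarrow> 0"
    proof (rule Lim_null_comparison)
      show "\<forall>\<^sub>F T in sequentially. norm (W 0 T - W s T) \<le> real s * C1 * inverse (N T)"
        using Npos eventually_ge_at_top[of s]
      proof eventually_elim
        case (elim T)
        have "{1..T} = {1..s} \<union> {s + 1..T}" using elim by auto
        then have "(\<Sum>j\<in>{1..T}. w T j) = (\<Sum>j\<in>{1..s}. w T j) + (\<Sum>j\<in>{s + 1..T}. w T j)"
          by (simp add: sum.union_disjoint)
        then have "W 0 T - W s T = inverse (N T) * (\<Sum>j\<in>{1..s}. w T j)"
          by (simp add: W_def inverse_eq_divide add_divide_distrib)
        moreover have "\<bar>\<Sum>j\<in>{1..s}. w T j\<bar> \<le> (\<Sum>j\<in>{1..s}. C1)"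
          by (rule order_trans[OF sum_abs]) (intro sum_mono, simp add: w_def K1)
        ultimately show ?case using elim by (simp add: abs_mult mult.commute mult_left_mono)
      qed
      show "(\<lambda>T. real s * C1 * inverse (N T)) \<longlonglongrightarrow> 0"
        by (intro tendsto_mult_right_zero tendsto_inverse_0_at_top N)
    qed
    from tendsto_diff[OF W0 this] show ?thesis by simp
  qed
  have "g s \<longlonglongrightarrow> 1" for s
  proof -
    \<comment> \<open>The argument is positive and tends to 0, so one-sided continuity of
      \<open>K2\<close> applies.\<close>
    have "filterlim (\<lambda>T. real (Suc s) / b T) (at_right 0) sequentially"
    proof (rule filterlim_at_withinI[THEN filterlim_mono[OF _ _ order_refl]])
      show "(\<lambda>T. real (Suc s) / b T) \<longlonglongrightarrow> 0"
        by (rule real_tendsto_divide_at_top[OF tendsto_const b])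
      have "\<forall>\<^sub>F T in sequentially. 0 < b T" using b by (simp add: filterlim_at_top_dense)
      then show "\<forall>\<^sub>F T in sequentially. real (Suc s) / b T \<in> {0<..} - {0}"
        by eventually_elim simp
    qed simp
    moreover have "(K2 \<longlongrightarrow> 1) (at_right 0)"
      using K2(2,3) by (simp add: continuous_within)
    ultimately have "(\<lambda>T. K2 (real (Suc s) / b T)) \<longlonglongrightarrow> 1"
      by (rule filterlim_compose[rotated])
    from tendsto_mult[OF this Ws[of "Suc s"]]
    have "(\<lambda>T. K2 (real (Suc s) / b T) * W (Suc s) T) \<longlonglongrightarrow> 1" by simp
    then show ?thesis
    proof (rule Lim_transform_eventually)
      show "\<forall>\<^sub>F T in sequentially. K2 (real (Suc s) / b T) * W (Suc s) T = g s T"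
        using eventually_ge_at_top[of "s + 2"] by eventually_elim (simp add: g_def)
    qed
  qed
  moreover have "\<forall>\<^sub>F T in sequentially. \<forall>s. \<bar>g s T\<bar> \<le> C2 * C"
    using Npos abs_mass
  proof eventually_elim
    case (elim T)
    show ?case
    proof
      fix s
      have "\<bar>W (Suc s) T\<bar> = 1 / N T * \<bar>\<Sum>j\<in>{Suc s + 1..T}. w T j\<bar>"
        using elim by (simp add: W_def abs_mult)
      also have "\<dots> \<le> 1 / N T * (\<Sum>j\<in>{1..T}. \<bar>w T j\<bar>)"
        using elim by (intro mult_left_mono order_trans[OF sum_abs] sum_mono2) auto
      also have "\<dots> \<le> C" using elim by simp
      finally have W: "\<bar>W (Suc s) T\<bar> \<le> C" .
      then have "0 \<le> C" by (rule order_trans[OF abs_ge_zero])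
      then show "\<bar>g s T\<bar> \<le> C2 * C"
        unfolding g_def using C12 W by (auto simp: abs_mult intro!: mult_mono K2)
    qed
  qed
  ultimately have "(\<lambda>T. \<Sum>s. g s T *\<^sub>R \<Gamma> s) \<longlonglongrightarrow> suminf \<Gamma>"
    using \<Gamma>_sum by (rule tendsto_suminf_scaleR)
  from tendsto_add[OF tendsto_scaleR[OF W0 tendsto_const[of "\<gamma> 0 0"]] this]
  show ?thesis unfolding eq by (simp add: \<Gamma>_inf add.assoc)
qed

section \<open>From the hypotheses to explicit bounds, and from bounds to convergence in
  probability\<close>

lemma compact_support_bound:
  fixes K :: "real \<Rightarrow> real"
  assumes "compact (closure {z. K z \<noteq> 0})"
  obtains A where "0 \<le> A" "\<And>z. K z \<noteq> 0 \<Longrightarrow> \<bar>z\<bar> \<le> A"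
proof -
  have "bounded {z. K z \<noteq> 0}"
    by (rule bounded_subset[OF compact_imp_bounded[OF assms] closure_subset])
  then obtain A where A: "\<And>z. K z \<noteq> 0 \<Longrightarrow> \<bar>z\<bar> \<le> A" by (auto simp: bounded_real)
  show thesis by (rule that[of "max 0 A"]) (use A in \<open>auto simp: le_max_iff_disj\<close>)
qed

text \<open>The event that the squared norm exceeds \<open>d\<close> lies in the event that the norm
  is at least \<open>sqrt d\<close>, so Markov's inequality works with first moments.\<close>

lemma converges_in_prob_norm_sq:
  fixes Y :: "nat \<Rightarrow> 'w \<Rightarrow> 'b::{banach, second_countable_topology}"
  assumes M: "prob_space M" and Y: "\<forall>\<^sub>F n in sequentially. Lp_le M 1 (Y n) (e n)" and e: "e \<longlonglongrightarrow> 0"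
  shows "converges_in_prob M (\<lambda>n \<omega>. (norm (Y n \<omega>))\<^sup>2) 0"
  unfolding converges_in_prob_def
proof (intro allI impI)
  interpret prob_space M by (rule M)
  fix d :: real assume d: "0 < d"
  show "(\<lambda>n. measure M {\<omega> \<in> space M. \<bar>(norm (Y n \<omega>))\<^sup>2 - 0\<bar> > d}) \<longlonglongrightarrow> 0"
  proof (rule Lim_null_comparison)
    show "\<forall>\<^sub>F n in sequentially. norm (measure M {\<omega> \<in> space M. \<bar>(norm (Y n \<omega>))\<^sup>2 - 0\<bar> > d}) \<le> e n / sqrt d"
      using Y
    proof eventually_elim
      case (elim n)
      have [measurable]: "Y n \<in> borel_measurable M" using elim by (rule Lp_le_measurable)
      have int: "integrable M (\<lambda>\<omega>. norm (Y n \<omega>))"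
        using Lp_le_1_integrable(1)[OF elim] by simp
      have "measure M {\<omega> \<in> space M. \<bar>(norm (Y n \<omega>))\<^sup>2 - 0\<bar> > d} \<le> measure M {\<omega> \<in> space M. norm (Y n \<omega>) \<ge> sqrt d}"
        by (intro finite_measure_mono) (auto intro!: real_le_lsqrt)
      also have "\<dots> \<le> (\<integral>\<omega>. norm (Y n \<omega>) \<partial>M) / sqrt d"
        by (rule integral_Markov_inequality_measure[OF int, of "{}"]) (use d in auto)
      also have "\<dots> \<le> e n / sqrt d"
        using d Lp_le_1_integrable(3)[OF elim] by (intro divide_right_mono) auto
      finally show ?case by simp
    qed
    show "(\<lambda>n. e n / sqrt d) \<longlonglongrightarrow> 0"
      using tendsto_divide[OF e tendsto_const[of "sqrt d"]] d by simp
  qed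
qed

text \<open>The fourth moments of the factors \<open>U\<close> are bounded uniformly in
  \<open>u\<close>, \<open>t\<close> and \<open>T\<close>, so one constant serves for all.
  Positivity of \<open>U\<close> lets the real power be read as an ordinary fourth power.\<close>

lemma locally_stationary_L2:
  fixes X :: "nat \<Rightarrow> nat \<Rightarrow> 'w \<Rightarrow> 'h::{banach, second_countable_topology}"
  assumes M: "prob_space M" and ls: "locally_stationary M 4 4 X Xs"
  obtains C where "0 \<le> C" and "\<And>u T t. u \<in> {0..1} \<Longrightarrow> t \<in> {1..T} \<Longrightarrow>
    Lp_le M 2 (\<lambda>\<omega>. X t T \<omega> - Xs u (int t) \<omega>) ((\<bar>real t / real T - u\<bar> + 1 / real T) * C)"
proof -
  interpret prob_space M by (rule M)
  obtain U C where U: "\<forall>u\<in>{0..1}. \<forall>T. \<forall>t\<in>{1..T}.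
        U u t T \<in> borel_measurable M \<and> (\<forall>\<omega>\<in>space M. 0 < U u t T \<omega>) \<and>
        integrable M (\<lambda>\<omega>. U u t T \<omega> powr 4) \<and> (\<integral>\<omega>. U u t T \<omega> powr 4 \<partial>M) < C \<and>
        (AE \<omega> in M. norm (X t T \<omega> - Xs u (int t) \<omega>) \<le> (\<bar>real t / real T - u\<bar> + 1 / real T) * U u t T \<omega>)"
    using ls unfolding locally_stationary_def by (elim conjE exE) (rule that)
  \<comment> \<open>As \<open>C'\<close> is at least 1, its fourth power is at least
    \<open>C'\<close> and hence at least \<open>C\<close>; this replaces a fourth root of
    \<open>C\<close>.\<close>
  define C' where "C' = max 1 C"
  have C': "1 \<le> C'" "C \<le> C' ^ 4"
    using self_le_power[of C' 4] by (auto simp: C'_def)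
  show thesis
  proof (rule that[of C'])
    show "0 \<le> C'" using C' by simp
    fix u :: real and T t :: nat assume ut: "u \<in> {0..1}" "t \<in> {1..T}"
    define V where "V = U u t T"
    have V [measurable]: "V \<in> borel_measurable M" and pos: "\<And>\<omega>. \<omega> \<in> space M \<Longrightarrow> 0 < V \<omega>"
      and int: "integrable M (\<lambda>\<omega>. V \<omega> powr 4)" "(\<integral>\<omega>. V \<omega> powr 4 \<partial>M) < C"
      and near: "AE \<omega> in M. norm (X t T \<omega> - Xs u (int t) \<omega>) \<le> (\<bar>real t / real T - u\<bar> + 1 / real T) * V \<omega>"
      using U[rule_format, OF ut] unfolding V_def by blast+
    have X: "X t T \<in> borel_measurable M" "Xs u (int t) \<in> borel_measurable M"
      using ls ut by (auto simp: locally_stationary_def Lp_H_def)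
    have p: "V \<omega> powr 4 = norm (V \<omega>) ^ 4" if "\<omega> \<in> space M" for \<omega>
      using pos[OF that] powr_realpow[of "V \<omega>" 4] by simp
    have "Lp_le M 4 V C'"
    proof (rule Lp_leI_integral)
      show "integrable M (\<lambda>\<omega>. norm (V \<omega>) ^ 4)"
        using int(1) by (rule Bochner_Integration.integrable_cong[THEN iffD1, rotated 2]) (simp_all add: p)
      have "(\<integral>\<omega>. norm (V \<omega>) ^ 4 \<partial>M) = (\<integral>\<omega>. V \<omega> powr 4 \<partial>M)"
        by (rule Bochner_Integration.integral_cong) (simp_all add: p)
      then show "(\<integral>\<omega>. norm (V \<omega>) ^ 4 \<partial>M) \<le> C' ^ 4" using int(2) C' by simp
    qed (use C' in auto)
    then have "Lp_le M 4 (\<lambda>\<omega>. (\<bar>real t / real T - u\<bar> + 1 / real T) *\<^sub>R V \<omega>) ((\<bar>real t / real T - u\<bar> + 1 / real T) * C')"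
      by (rule Lp_le_scaleR) simp
    then have "Lp_le M 4 (\<lambda>\<omega>. X t T \<omega> - Xs u (int t) \<omega>) ((\<bar>real t / real T - u\<bar> + 1 / real T) * C')"
    proof (rule Lp_le_dominated)
      show "AE \<omega> in M. norm (X t T \<omega> - Xs u (int t) \<omega>) \<le> norm ((\<bar>real t / real T - u\<bar> + 1 / real T) *\<^sub>R V \<omega>)"
        using near by eventually_elim (auto intro: order_trans)
    qed (use X in auto)
    then show "Lp_le M 2 (\<lambda>\<omega>. X t T \<omega> - Xs u (int t) \<omega>) ((\<bar>real t / real T - u\<bar> + 1 / real T) * C')"
      by (rule Lp_le_4_2)
  qed
qed

text \<open>
  Since \<open>h \<surd>b = \<surd>((b / (T h)) (T h\<^sup>3))\<close>, both the local bias \<open>h\<close> and the noise level \<open>(T h)\<^sup>-\<^sup>1\<^sup>/\<^sup>2\<close>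
  vanish after multiplication with \<open>\<surd>b\<close>.
\<close>

lemma bandwidth_rates:
  fixes h b :: "nat \<Rightarrow> real"
  assumes h_pos: "\<And>T. T \<ge> 1 \<Longrightarrow> h T > 0" and b_pos: "\<And>T. T \<ge> 1 \<Longrightarrow> b T > 0"
    and rates: "filterlim (\<lambda>T. Min {real T * h T, 1 / (real T * h T ^ 3), b T, real T * h T / b T}) at_top sequentially"
  shows "filterlim (\<lambda>T. real T * h T) at_top sequentially"
    and "filterlim b at_top sequentially"
    and "filterlim (\<lambda>T. real T * h T / b T) at_top sequentially"
    and "(\<lambda>T. sqrt (b T / (real T * h T))) \<longlonglongrightarrow> 0"
    and "(\<lambda>T. h T * sqrt (b T)) \<longlonglongrightarrow> 0"
proof -
  show N: "filterlim (\<lambda>T. real T * h T) at_top sequentially"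
    and b: "filterlim b at_top sequentially"
    and Nb: "filterlim (\<lambda>T. real T * h T / b T) at_top sequentially"
    by (rule filterlim_at_top_mono[OF rates], rule always_eventually, rule allI, rule Min_le; simp)+
  have h3: "filterlim (\<lambda>T. 1 / (real T * h T ^ 3)) at_top sequentially"
    by (rule filterlim_at_top_mono[OF rates], rule always_eventually, rule allI, rule Min_le; simp)
  have r: "(\<lambda>T. inverse (real T * h T / b T)) \<longlonglongrightarrow> 0" "(\<lambda>T. inverse (1 / (real T * h T ^ 3))) \<longlonglongrightarrow> 0"
    by (rule tendsto_inverse_0_at_top[OF Nb] tendsto_inverse_0_at_top[OF h3])+
  show "(\<lambda>T. sqrt (b T / (real T * h T))) \<longlonglongrightarrow> 0"
    using tendsto_real_sqrt[OF r(1)] by simp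
  have "(\<lambda>T. sqrt (inverse (real T * h T / b T) * inverse (1 / (real T * h T ^ 3)))) \<longlonglongrightarrow> 0"
    using tendsto_real_sqrt[OF tendsto_mult[OF r]] by simp
  then show "(\<lambda>T. h T * sqrt (b T)) \<longlonglongrightarrow> 0"
  proof (rule Lim_transform_eventually)
    show "\<forall>\<^sub>F T in sequentially. sqrt (inverse (real T * h T / b T) * inverse (1 / (real T * h T ^ 3))) = h T * sqrt (b T)"
      using eventually_ge_at_top[of 1]
    proof eventually_elim
      case (elim T)
      have "inverse (real T * h T / b T) * inverse (1 / (real T * h T ^ 3)) = (h T)\<^sup>2 * b T"
        using elim h_pos[OF elim] by (simp add: field_simps power2_eq_square power3_eq_cube)
      then show ?case using h_pos[OF elim] by (simp add: real_sqrt_mult)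
    qed
  qed
qed

theorem theorem3p3:
  fixes M :: "'w measure"
    and S :: "real \<Rightarrow> 's measure"
    and X :: "nat \<Rightarrow> nat \<Rightarrow> 'w \<Rightarrow> (real ^ 'd) L2"
    and Xs :: "real \<Rightarrow> int \<Rightarrow> 'w \<Rightarrow> (real ^ 'd) L2"
    and f :: "real \<Rightarrow> (nat \<Rightarrow> 's) \<Rightarrow> (real ^ 'd) L2"
    and \<epsilon> :: "real \<Rightarrow> int \<Rightarrow> 'w \<Rightarrow> 's"
    and \<epsilon>' :: "real \<Rightarrow> nat \<Rightarrow> int \<Rightarrow> int \<Rightarrow> 'w \<Rightarrow> 's"
    and K1 K2 :: "real \<Rightarrow> real"
    and h b :: "nat \<Rightarrow> real"
    and u :: real
  assumes prob: "prob_space M"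
    and local_stat: "locally_stationary M 4 4 X Xs"
    and approximable:
      "\<And>v. v \<in> {0..1} \<Longrightarrow> Lp_m_approximable M (S v) 4 (f v) (\<epsilon> v) (\<epsilon>' v) (Xs v)"
    and centred: "\<And>v t. v \<in> {0..1} \<Longrightarrow> (\<integral>\<omega>. Xs v t \<omega> \<partial>M) = 0"
    and approx_rate:
      "\<And>v. v \<in> {0..1} \<Longrightarrow>
         (\<lambda>m. real m * v_norm M 2 (\<lambda>\<omega>. Xs v 0 \<omega> - m_approximation (f v) (\<epsilon> v) (\<epsilon>' v) m 0 \<omega>))
           \<longlonglongrightarrow> 0"
    and K1_symmetric: "\<And>z. K1 (- z) = K1 z"
    and K1_bounded: "bounded (range K1)"
    and K1_Lipschitz: "\<exists>L. L-lipschitz_on UNIV K1"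
    and K1_support: "compact (closure {z. K1 z \<noteq> 0})"
    and K1_integral: "(\<integral>z. K1 z \<partial>lborel) = 1"
    and K2_bounded: "bounded (range K2)"
    and K2_support: "compact (closure {z. K2 z \<noteq> 0})"
    and K2_0: "K2 0 = 1"
    and K2_right_cont: "continuous (at_right 0) K2"
    and h_pos: "\<And>T. T \<ge> 1 \<Longrightarrow> h T > 0"
    and b_pos: "\<And>T. T \<ge> 1 \<Longrightarrow> b T > 0"
    and h_lim: "h \<longlonglongrightarrow> 0"
    and rates:
      "filterlim
         (\<lambda>T. Min {real T * h T, 1 / (real T * h T ^ 3), b T, real T * h T / b T})
         at_top sequentially"
    and u: "u \<in> {0<..<1}"
  shows "summable (\<lambda>t. cross_cov M (Xs u 0) (Xs u (int (Suc t)))) \<and>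
         summable (\<lambda>t. cross_cov M (Xs u (int (Suc t))) (Xs u 0)) \<and>
         converges_in_prob M
           (\<lambda>T \<omega>. (norm (c_hat K1 K2 (h T) (b T) u T (\<lambda>t. X t T \<omega>) - long_run_cov M (Xs u)))\<^sup>2) 0"
proof -
  interpret prob_space M by (rule prob)
  have u01: "u \<in> {0..1}" using u by simp
  have norm_t: "norm (x \<otimes>\<^sub>2 y) \<le> norm x * norm y" for x y :: "(real ^ 'd) L2" by (simp add: norm_tensor)
  define \<gamma> where "\<gamma> j k = (\<integral>\<omega>. Xs u j \<omega> \<otimes>\<^sub>2 Xs u k \<omega> \<partial>M)" for j k
  obtain D where D: "0 \<le> D"
    and lin: "\<And>J T a. J \<subseteq> {1..T} \<Longrightarrow>
      Lp_le M 2 (\<lambda>\<omega>. \<Sum>t\<in>J. a t *\<^sub>R Xs u (int t) \<omega>) (D * sqrt (\<Sum>t\<in>J. (a t)\<^sup>2))"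
    and quad: "\<And>J T a \<rho>. J \<subseteq> {1..T} \<Longrightarrow> (\<And>j. j \<in> J \<Longrightarrow> (\<Sum>k\<in>J. (a j k)\<^sup>2) \<le> \<rho>) \<Longrightarrow>
      (\<And>k. k \<in> J \<Longrightarrow> (\<Sum>j\<in>J. (a j k)\<^sup>2) \<le> \<rho>) \<Longrightarrow>
      Lp_le M 2 (\<lambda>\<omega>. (\<Sum>j\<in>J. \<Sum>k\<in>J. a j k *\<^sub>R (Xs u (int j) \<omega> \<otimes>\<^sub>2 Xs u (int k) \<omega>))
          - (\<Sum>j\<in>J. \<Sum>k\<in>J. a j k *\<^sub>R \<gamma> (int j) (int k)))
        (6 * D\<^sup>2 * sqrt (\<rho> * card J))"
    and shift: "\<And>j k s. \<gamma> (j + s) (k + s) = \<gamma> j k"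
    and sm: "summable (\<lambda>m. norm (\<gamma> 0 (int m)))" "summable (\<lambda>m. norm (\<gamma> (int m) 0))"
    unfolding \<gamma>_def
    by (rule approximable_moment_bounds[OF prob approximable[OF u01] centred[OF u01] bounded_bilinear_tensor norm_t])
      blast
  obtain C where C: "0 \<le> C" and near: "\<And>T t. t \<in> {1..T} \<Longrightarrow>
      Lp_le M 2 (\<lambda>\<omega>. X t T \<omega> - Xs u (int t) \<omega>) ((\<bar>real t / real T - u\<bar> + 1 / real T) * C)"
    using locally_stationary_L2[OF prob local_stat] u01 by metis
  obtain A where A: "0 \<le> A" "\<And>z. K1 z \<noteq> 0 \<Longrightarrow> \<bar>z\<bar> \<le> A"
    using compact_support_bound[OF K1_support] by blast
  obtain R where R: "0 \<le> R" "\<And>z. K2 z \<noteq> 0 \<Longrightarrow> \<bar>z\<bar> \<le> R"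
    using compact_support_bound[OF K2_support] by blast
  obtain C1 where C1: "\<And>z. \<bar>K1 z\<bar> \<le> C1" using K1_bounded by (auto simp: bounded_real)
  obtain C2 where C2: "\<And>z. \<bar>K2 z\<bar> \<le> C2" using K2_bounded by (auto simp: bounded_real)
  have C12: "0 \<le> C1" "0 \<le> C2" using C1[of 0] C2[of 0] by linarith+
  obtain L where L: "L-lipschitz_on UNIV K1" using K1_Lipschitz by blast
  have lip: "\<bar>K1 x - K1 y\<bar> \<le> L * \<bar>x - y\<bar>" for x y
    using lipschitz_onD[OF L, of x y] by (simp add: dist_real_def)
  define N where "N T = real T * h T" for T
  define c where "c = 2 * A + 3"
  note br = bandwidth_rates[of h b, OF h_pos b_pos rates, folded N_def]
  have c0: "0 < c" using A by (simp add: c_def)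
  \<comment> \<open>The last two conditions say that the kernel window around \<open>u\<close> stays
    inside the unit interval, which holds for small \<open>h\<close> because \<open>u\<close> is an
    interior point.\<close>
  have ev: "\<forall>\<^sub>F T in sequentially. 1 \<le> T \<and> 0 < h T \<and> 1 \<le> N T \<and> 1 \<le> b T \<and> R * b T \<le> N T
      \<and> (u - 1) / h T \<le> - A \<and> A \<le> u / h T"
  proof -
    have "\<forall>\<^sub>F T in sequentially. 1 \<le> N T" "\<forall>\<^sub>F T in sequentially. 1 \<le> b T"
      "\<forall>\<^sub>F T in sequentially. R \<le> N T / b T"
      using br(1-3) by (simp_all add: filterlim_at_top)
    moreover have "\<forall>\<^sub>F T in sequentially. A * h T < u" "\<forall>\<^sub>F T in sequentially. A * h T < 1 - u"
      using tendsto_mult_right_zero[OF h_lim, of A] u by (auto intro!: order_tendstoD(2))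
    ultimately show ?thesis using eventually_ge_at_top[of 1]
    proof eventually_elim
      case (elim T)
      then show ?case using h_pos[of T] b_pos[of T]
        by (auto simp: le_divide_eq divide_le_eq)
    qed
  qed
  define w where "w T j = K1 ((u - real j / real T) / h T)" for T j
  define J where "J T = {j\<in>{1..T}. \<bar>u - real j / real T\<bar> \<le> (A + 1) * h T}" for T
  have card_J: "\<forall>\<^sub>F T in sequentially. real (card (J T)) \<le> c * N T"
    using ev by eventually_elim (unfold J_def c_def N_def, rule card_near_le, simp_all add: A)
  have mass: "(\<lambda>T. 1 / N T * (\<Sum>j\<in>{1..T}. w T j)) \<longlonglongrightarrow> 1"
  proof -
    have "(\<lambda>T. 1 / N T * (\<Sum>j\<in>{1..T}. w T j) - 1) \<longlonglongrightarrow> 0"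
    proof (rule Lim_null_comparison)
      show "\<forall>\<^sub>F T in sequentially. norm (1 / N T * (\<Sum>j\<in>{1..T}. w T j) - 1) \<le> L * c * inverse (N T)"
        using ev card_J
      proof eventually_elim
        case (elim T)
        have L0: "0 \<le> L" by (rule lipschitz_on_nonneg[OF L])
        have "norm (1 / N T * (\<Sum>j\<in>{1..T}. w T j) - 1) \<le> L / (N T)\<^sup>2 * real (card (J T))"
          unfolding w_def N_def J_def real_norm_def
          by (rule kernel_riemann_sum[OF _ _ _ lip A(2) A(1) K1_integral]) (use elim in \<open>auto simp: N_def\<close>)
        also have "\<dots> \<le> L / (N T)\<^sup>2 * (c * N T)"
          using elim L0 by (intro mult_left_mono) auto
        also have "\<dots> = L * c * inverse (N T)"
          using elim by (simp add: power2_eq_square field_simps)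
        finally show ?case .
      qed
      show "(\<lambda>T. L * c * inverse (N T)) \<longlonglongrightarrow> 0"
        by (intro tendsto_mult_right_zero tendsto_inverse_0_at_top br(1))
    qed
    then show ?thesis by (rule LIM_zero_cancel)
  qed
  have abs_mass: "\<forall>\<^sub>F T in sequentially. 1 / N T * (\<Sum>j\<in>{1..T}. \<bar>w T j\<bar>) \<le> C1 * c"
    using ev card_J
  proof eventually_elim
    case (elim T)
    have "w T j = 0" if "j \<in> {1..T} - J T" for j
    proof (rule ccontr)
      assume "w T j \<noteq> 0"
      then have "\<bar>(u - real j / real T) / h T\<bar> \<le> A" unfolding w_def by (rule A)
      then have "\<bar>u - real j / real T\<bar> \<le> A * h T" using elim by (simp add: abs_divide divide_le_eq)
      also have "\<dots> \<le> (A + 1) * h T" using elim by (simp add: algebra_simps)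
      finally show False using that by (auto simp: J_def)
    qed
    then have "(\<Sum>j\<in>{1..T}. \<bar>w T j\<bar>) = (\<Sum>j\<in>J T. \<bar>w T j\<bar>)"
      by (intro sum.mono_neutral_right) (auto simp: J_def)
    also have "\<dots> \<le> (\<Sum>j\<in>J T. C1)" by (intro sum_mono) (simp add: w_def C1)
    also have "\<dots> \<le> c * N T * C1" using mult_right_mono[OF elim(2) C12(1)] by simp
    finally have "1 / N T * (\<Sum>j\<in>{1..T}. \<bar>w T j\<bar>) \<le> 1 / N T * (c * N T * C1)"
      using elim by (intro mult_left_mono) auto
    then show ?case using elim by (simp add: mult.commute)
  qed
  have lrc: "long_run_cov M (Xs u) = \<gamma> 0 0 + (\<Sum>t. \<gamma> 0 (int (Suc t))) + (\<Sum>t. \<gamma> (int (Suc t)) 0)"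
    by (simp only: long_run_cov_def cross_cov_def \<gamma>_def)
  \<comment> \<open>The deterministic centre: the expectation of the quadratic form in the
    stationary process.\<close>
  define m where "m T = (1 / N T) *\<^sub>R (\<Sum>j\<in>{1..T}. \<Sum>k\<in>{1..T}.
      lag_weight K1 K2 (h T) (b T) u T j k *\<^sub>R \<gamma> (int j) (int k))" for T
  have m_lim: "m \<longlonglongrightarrow> long_run_cov M (Xs u)"
    unfolding m_def N_def lrc
    by (rule weighted_autocovariance_tendsto[OF shift sm C1 C2 K2_0 K2_right_cont br(1,2)[unfolded N_def]
          mass[unfolded N_def w_def] abs_mass[unfolded N_def w_def]])
  define \<rho> where "\<rho> T = (C1 * C2)\<^sup>2 * ((2 * R + 1) * b T)" for T
  define \<eta>0 where "\<eta>0 T = (A + 2) * h T * C" for T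
  define \<eta> where "\<eta> T = \<eta>0 T + (D * (C1 * sqrt c) / sqrt (N T) + C1 * c * \<eta>0 T)" for T
  define e where "e T = c * (2 * \<eta> T * (D * sqrt (\<rho> T)) + C1 * C2 * ((2 * R + 1) * b T) * (\<eta> T)\<^sup>2)
      + 6 * D\<^sup>2 * sqrt (\<rho> T * (c * N T)) / N T" for T
  have err: "\<forall>\<^sub>F T in sequentially. Lp_le M 1 (\<lambda>\<omega>. c_hat K1 K2 (h T) (b T) u T (\<lambda>t. X t T \<omega>) - m T) (e T)"
    using ev
  proof eventually_elim
    case (elim T)
    show ?case
      unfolding m_def e_def
    proof (rule c_hat_error[where Z="\<lambda>t. Xs u (int t)" and A=A and R=R and C=C and ?C1.0=C1
          and ?C2.0=C2 and ?\<eta>0.0="\<eta>0 T" and \<eta>="\<eta> T" and \<rho>="\<rho> T" and X="\<lambda>t. X t T"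
          and \<gamma>="\<lambda>j k. \<gamma> (int j) (int k)"])
      show "Lp_le M 2 (\<lambda>\<omega>. (\<Sum>j\<in>I. \<Sum>k\<in>I. a j k *\<^sub>R (Xs u (int j) \<omega> \<otimes>\<^sub>2 Xs u (int k) \<omega>))
          - (\<Sum>j\<in>I. \<Sum>k\<in>I. a j k *\<^sub>R \<gamma> (int j) (int k))) (6 * D\<^sup>2 * sqrt (r * real (card I)))"
        if "I \<subseteq> {1..T}" "\<And>j. j \<in> I \<Longrightarrow> (\<Sum>k\<in>I. (a j k)\<^sup>2) \<le> r" "\<And>k. k \<in> I \<Longrightarrow> (\<Sum>j\<in>I. (a j k)\<^sup>2) \<le> r"
        for I a r
        by (rule quad) (use that in auto)
    qed (use elim A R C1 C2 C D K2_0 lin near in \<open>auto simp: N_def c_def \<rho>_def \<eta>0_def \<eta>_def\<close>)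
  qed
  have e_lim: "e \<longlonglongrightarrow> 0"
  proof -
    \<comment> \<open>Every term of \<open>e\<close> is a constant times \<open>s T\<close>, its
      square or \<open>sqrt (b T / N T)\<close>, and \<open>s\<close> in turn is a combination of
      \<open>h T * sqrt (b T)\<close> and \<open>sqrt (b T / N T)\<close>, both of which
      vanish.\<close>
    define s where "s T = \<eta> T * sqrt (b T)" for T
    define k1 k2 where "k1 = (1 + C1 * c) * ((A + 2) * C)" and "k2 = D * (C1 * sqrt c)"
    define q where "q = 2 * R + 1"
    have q: "0 \<le> q" using R by (simp add: q_def)
    have s_lim: "s \<longlonglongrightarrow> 0"
    proof (rule Lim_transform_eventually)
      have "(\<lambda>T. k1 * (h T * sqrt (b T)) + k2 * sqrt (b T / N T)) \<longlonglongrightarrow> k1 * 0 + k2 * 0"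
        by (intro tendsto_intros br(4,5))
      then show "(\<lambda>T. k1 * (h T * sqrt (b T)) + k2 * sqrt (b T / N T)) \<longlonglongrightarrow> 0" by simp
      show "\<forall>\<^sub>F T in sequentially. k1 * (h T * sqrt (b T)) + k2 * sqrt (b T / N T) = s T"
        by (rule always_eventually)
          (simp add: s_def \<eta>_def \<eta>0_def k1_def k2_def real_sqrt_divide algebra_simps)
    qed
    have "(\<lambda>T. c * (2 * (D * (C1 * C2 * sqrt q)) * s T + C1 * C2 * q * (s T)\<^sup>2)
        + 6 * D\<^sup>2 * (C1 * C2 * sqrt (q * c)) * sqrt (b T / N T)) \<longlonglongrightarrow>
        c * (2 * (D * (C1 * C2 * sqrt q)) * 0 + C1 * C2 * q * 0\<^sup>2) + 6 * D\<^sup>2 * (C1 * C2 * sqrt (q * c)) * 0"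
      by (intro tendsto_intros s_lim br(4))
    then have "(\<lambda>T. c * (2 * (D * (C1 * C2 * sqrt q)) * s T + C1 * C2 * q * (s T)\<^sup>2)
        + 6 * D\<^sup>2 * (C1 * C2 * sqrt (q * c)) * sqrt (b T / N T)) \<longlonglongrightarrow> 0" by simp
    then show ?thesis
    proof (rule Lim_transform_eventually)
      show "\<forall>\<^sub>F T in sequentially. c * (2 * (D * (C1 * C2 * sqrt q)) * s T + C1 * C2 * q * (s T)\<^sup>2)
          + 6 * D\<^sup>2 * (C1 * C2 * sqrt (q * c)) * sqrt (b T / N T) = e T"
        using ev
      proof eventually_elim
        case (elim T)
        have b: "0 < b T" and N: "0 < N T" using elim by auto
        have r1: "sqrt (\<rho> T) = C1 * C2 * sqrt q * sqrt (b T)"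
          using C12 by (simp add: \<rho>_def q_def real_sqrt_mult)
        have r2: "sqrt (\<rho> T * (c * N T)) / N T = C1 * C2 * sqrt (q * c) * sqrt (b T / N T)"
        proof -
          have "sqrt (N T) / N T = 1 / sqrt (N T)" using N by (simp add: field_simps)
          moreover have "sqrt (\<rho> T * (c * N T)) / N T = sqrt (\<rho> T) * sqrt c * (sqrt (N T) / N T)"
            by (simp add: real_sqrt_mult)
          ultimately show ?thesis
            by (simp add: r1 real_sqrt_mult real_sqrt_divide)
        qed
        have r3: "(s T)\<^sup>2 = b T * (\<eta> T)\<^sup>2"
          using b by (simp add: s_def power_mult_distrib)
        have "6 * D\<^sup>2 * sqrt (\<rho> T * (c * N T)) / N T = 6 * D\<^sup>2 * (C1 * C2 * sqrt (q * c) * sqrt (b T / N T))"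
          unfolding r2[symmetric] by simp
        then show ?case
          unfolding e_def r1 r3 q_def[symmetric] by (simp add: s_def algebra_simps)
      qed
    qed
  qed
  have "\<forall>\<^sub>F T in sequentially. Lp_le M 1 (\<lambda>\<omega>. c_hat K1 K2 (h T) (b T) u T (\<lambda>t. X t T \<omega>) - long_run_cov M (Xs u))
      (e T + norm (m T - long_run_cov M (Xs u)))"
    using err
  proof eventually_elim
    case (elim T)
    have "Lp_le M 1 (\<lambda>\<omega>. (c_hat K1 K2 (h T) (b T) u T (\<lambda>t. X t T \<omega>) - m T) + (m T - long_run_cov M (Xs u)))
        (e T + norm (m T - long_run_cov M (Xs u)))"
      by (rule Lp_le_add[OF elim Lp_le_const]) auto
    then show ?case by simp
  qed
  moreover have "(\<lambda>T. e T + norm (m T - long_run_cov M (Xs u))) \<longlonglongrightarrow> 0"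
    using tendsto_add[OF e_lim tendsto_norm_zero[OF LIM_zero[OF m_lim]]] by simp
  ultimately have "converges_in_prob M
      (\<lambda>T \<omega>. (norm (c_hat K1 K2 (h T) (b T) u T (\<lambda>t. X t T \<omega>) - long_run_cov M (Xs u)))\<^sup>2) 0"
    by (rule converges_in_prob_norm_sq[OF prob])
  \<comment> \<open>\<open>suminf\<close> denotes the sum of the series only if it is summable;
    these two facts give \<open>long_run_cov\<close> its intended meaning.\<close>
  moreover have "summable (\<lambda>t. cross_cov M (Xs u 0) (Xs u (int (Suc t))))"
    "summable (\<lambda>t. cross_cov M (Xs u (int (Suc t))) (Xs u 0))"
    using sm[THEN summable_norm_cancel, THEN summable_ignore_initial_segment, of 1]
    by (simp_all add: cross_cov_def \<gamma>_def)
  ultimately show ?thesis by blast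
qed

end
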